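(* For every $F\in C^1_c(M)$, $$\Big[\|F\|_{L^6(M)}\Big]^2\le 4\pi^{-2/3}\biggl[\int_M|DF|^2\,d\nu-\frac{3}{16}\int_M|F|^2\,d\nu\biggr]\qquad\text{(i)}$$ and $$\Big[\|F\|_{L^6(M)}\Big]^2\le \frac43\,\pi^{-2/3}\biggl[\int_M|DF|^2\,d\nu-\frac14\int_M|F|^2\,d\nu\biggr].\qquad\text{(ii)}$$ Both estimates are sharp as limiting forms, in the following sense. Consider $F\in C^1(M)\cap L^6(M)$, not necessarily in $L^2(M)$, and interpret the bracket on the right-hand side as the weighted form $\mathcal{E}_\alpha(F)=\int_M y^{2\alpha}\,|\nabla(y^{-\alpha}F)|^2\,dx\,dy$, assumed finite, with $\alpha=\tfrac14$ for (i) and $\alpha=\tfrac12$ for (ii). Then the constant $4\pi^{-2/3}$ in $\|F\|_{L^6(M)}^2\le 4\pi^{-2/3}\,\mathcal{E}_{1/4}(F)$ and the constant $\tfrac43\pi^{-2/3}$ in $\|F\|_{L^6(M)}^2\le \tfrac43\pi^{-2/3}\,\mathcal{E}_{1/2}(F)$ cannot be replaced by smaller constants.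
   Context: $M=\{z=x+iy: x\in\mathbb{R},\ y>0\}$ is the upper half-plane (identified with the hyperbolic plane $\mathbb{H}^2\simeq SL(2,\mathbb{R})/SO(2)$), with invariant measure $d\nu=y^{-2}\,dx\,dy$ and invariant gradient $D=y\nabla$, where $\nabla=(\partial_x,\partial_y)$ is the Euclidean gradient; thus $|DF|^2=y^2(|\partial_xF|^2+|\partial_yF|^2)$. $L^p(M)$ is taken with respect to $d\nu$, and $C_c^1(M)$ is the space of continuously differentiable functions with compact support in $M$. For $F\in C^1_c(M)$ and $\alpha>0$ one has the identity $\int_M y^{2\alpha}|\nabla(y^{-\alpha}F)|^2\,dx\,dy=\int_M|DF|^2\,d\nu+\alpha(\alpha-1)\int_M|F|^2\,d\nu$, so that $\mathcal{E}_{1/4}$ and $\mathcal{E}_{1/2}$ agree with the brackets in (i) and (ii) on $C_c^1(M)$. *)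

theory Defs
  imports "HOL-Analysis.Analysis"
begin

text \<open>
  The point \<open>z = x + iy\<close> is represented by the pair \<open>(x, y)\<close>. Functions are total on the plane, but
  everything below depends only on their values on the open set \<open>half_plane\<close>.
  Up to isomorphism, the only types that are both \<open>real_normed_field\<close> and \<open>euclidean_space\<close> are
  the real and the complex numbers, so quantifying over such a value type \<open>'k\<close> covers real-valued
  and complex-valued functions.
\<close>

definition half_plane :: "(real \<times> real) set" where
  "half_plane = {z. snd z > 0}"

definition hyp_measure :: "(real \<times> real) measure" where
  "hyp_measure = density (restrict_space lborel half_plane) (\<lambda>z. ennreal (1 / (snd z)\<^sup>2))"

definition grad :: "(real \<times> real \<Rightarrow> 'k::real_normed_vector) \<Rightarrow> real \<times> real \<Rightarrow> 'k \<times> 'k" where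
  "grad F z = (vector_derivative (\<lambda>t. F (t, snd z)) (at (fst z)),
               vector_derivative (\<lambda>t. F (fst z, t)) (at (snd z)))"

text \<open>
  The norm on a product type is Euclidean, so the squared norm of \<open>grad F z\<close> is
  the sum of the squared norms of the two partial derivatives.
\<close>

definition hyp_grad :: "(real \<times> real \<Rightarrow> 'k::real_normed_vector) \<Rightarrow> real \<times> real \<Rightarrow> 'k \<times> 'k" where
  "hyp_grad F z = snd z *\<^sub>R grad F z"

definition C1_on :: "('a::real_normed_vector \<Rightarrow> 'b::real_normed_vector) \<Rightarrow> 'a set \<Rightarrow> bool" where
  "C1_on F S \<longleftrightarrow> (\<exists>F' :: 'a \<Rightarrow> 'a \<Rightarrow>\<^sub>L 'b.
     (\<forall>z\<in>S. (F has_derivative blinfun_apply (F' z)) (at z)) \<and> continuous_on S F')"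

text \<open>The set required to be compact is the support relative to \<open>half_plane\<close>.\<close>

definition C1_compact_support :: "(real \<times> real \<Rightarrow> 'k::real_normed_vector) \<Rightarrow> bool" where
  "C1_compact_support F \<longleftrightarrow> C1_on F half_plane \<and>
     compact (half_plane \<inter> closure {z \<in> half_plane. F z \<noteq> 0})"

definition in_Lp :: "real \<Rightarrow> (real \<times> real \<Rightarrow> 'k::real_normed_vector) \<Rightarrow> bool" where
  "in_Lp p F \<longleftrightarrow> F \<in> borel_measurable hyp_measure \<and>
     integrable hyp_measure (\<lambda>z. norm (F z) powr p)"

definition Lp_norm :: "real \<Rightarrow> (real \<times> real \<Rightarrow> 'k::real_normed_vector) \<Rightarrow> real" where
  "Lp_norm p F = (\<integral>z. norm (F z) powr p \<partial>hyp_measure) powr (1 / p)"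

definition energy_density :: "real \<Rightarrow> (real \<times> real \<Rightarrow> 'k::real_normed_vector) \<Rightarrow> real \<times> real \<Rightarrow> real" where
  "energy_density \<alpha> F z =
     snd z powr (2 * \<alpha>) * (norm (grad (\<lambda>w. snd w powr (- \<alpha>) *\<^sub>R F w) z))\<^sup>2"

definition energy :: "real \<Rightarrow> (real \<times> real \<Rightarrow> 'k::real_normed_vector) \<Rightarrow> real" where
  "energy \<alpha> F = (LINT z:half_plane|lborel. energy_density \<alpha> F z)"

definition limiting_class :: "real \<Rightarrow> (real \<times> real \<Rightarrow> 'k::real_normed_vector) set" where
  "limiting_class \<alpha> = {F. C1_on F half_plane \<and> in_Lp 6 F \<and>
     set_integrable lborel half_plane (energy_density \<alpha> F)}"

end

theory Submission
  imports Defs "HOL-Real_Asymp.Real_Asymp"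
begin

text \<open>
  Inequality (ii) is a sharp Sobolev inequality in disguise. Writing \<open>F = sqrt y * f\<close> turns the bracket into
  the energy \<open>\<integral> y * |grad f|^2 dx dy\<close> and the sixth power of the norm of \<open>F\<close> into \<open>\<integral> y * |f|^6 dx dy\<close>
  (lemma \<open>hyperbolic_sobolev_poincare\<close>). The factor \<open>y\<close> is the weight that axially symmetric functions on
  three-dimensional space see, and the extremal function is \<open>(1 + x^2 + y^2)^(-1/2)\<close>.

  The weighted inequality is proved by mass transport (lemma \<open>sobolev_inequality\<close>). A triangular (Knothe) map
  \<open>(X x, T x y)\<close> carries the measure \<open>y * h^6 dx dy\<close> to a multiple of the extremal measure. The equation for its
  Jacobian and the arithmetic-geometric mean inequality bound \<open>h^6\<close>, multiplied by \<open>1 + X^2 + T^2\<close>, by \<open>h^4\<close> times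
  the weighted divergence of the map (lemma \<open>transport_amgm\<close>). After integration by parts the derivative falls on
  \<open>h^4\<close>, and Young's inequality leaves the energy of \<open>h\<close> and the second moment of the extremal measure, which
  is known. All steps are equalities for the extremal function, so the constant is sharp. A triangular map
  is explicit, and only its two diagonal derivatives enter, so all the analysis is one-dimensional; both
  integrations by parts enter as inequalities
  (lemmas \<open>integration_by_parts_line\<close> and \<open>integration_by_parts_half_line\<close>).

  Positivity of \<open>h\<close> makes the two rearrangements differentiable. A function \<open>f\<close> with zeros, possibly vector-valued, is therefore
  replaced by \<open>sqrt (|f|^2 + e * g^2)\<close> with \<open>g\<close> extremal and \<open>e\<close> tending to zero
  (lemmas \<open>regularised_sobolev\<close> and \<open>weighted_sobolev\<close>).

  Inequality (i) is weaker than (ii) for functions of compact support. Its constant is sharp only in the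
  larger limiting class, which contains functions that do not vanish at the boundary after division by
  \<open>y powr (1/4)\<close>. Sharpness of either constant needs a single function: evaluating norm and energy of the
  extremal functions (lemmas \<open>sharpness_exponent_half\<close> and \<open>sharpness_exponent_quarter\<close>) gives equality, so no
  smaller constant is possible.
\<close>

section \<open>Real-variable tools\<close>

text \<open>
  Arithmetic-geometric mean inequality for three numbers: it replaces a Jacobian, which is a
  product of three factors, by a divergence, which is their sum. The geometric mean \<open>e\<close> is named in the
  hypotheses so that no cube root occurs in applications.
\<close>

lemma amgm3:
  fixes a b c e :: real
  assumes "0 \<le> a" "0 \<le> b" "0 \<le> c" "0 \<le> e" "a * b * c = e ^ 3"
  shows "3 * e \<le> a + b + c"
proof -
  define u v w where "u = root 3 a" and "v = root 3 b" and "w = root 3 c"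
  have u: "0 \<le> u" "u ^ 3 = a" and v: "0 \<le> v" "v ^ 3 = b" and w: "0 \<le> w" "w ^ 3 = c"
    unfolding u_def v_def w_def using assms(1-3) by (auto simp: real_root_pow_pos2)
  have "(u * v * w) ^ 3 = a * b * c" unfolding power_mult_distrib u(2) v(2) w(2) ..
  then have "(u * v * w) ^ 3 = e ^ 3" using assms(5) by simp
  then have e: "u * v * w = e"
    by (rule power_eq_imp_eq_base) (use u v w assms(4) in auto)
  have "0 \<le> (u + v + w) * ((u - v)\<^sup>2 + (v - w)\<^sup>2 + (w - u)\<^sup>2)"
    using u v w by (intro mult_nonneg_nonneg add_nonneg_nonneg) auto
  also have "\<dots> = 2 * (u ^ 3 + v ^ 3 + w ^ 3 - 3 * (u * v * w))"
    by (simp add: power2_eq_square power3_eq_cube algebra_simps)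
  finally show ?thesis unfolding u(2) v(2) w(2) e by simp
qed

lemma tail_split:
  fixes p :: "real \<Rightarrow> real"
  assumes int: "integrable lborel p" and "a \<le> b"
  shows "(LINT t:{a<..}|lborel. p t) = (LINT t:{a..b}|lborel. p t) + (LINT t:{b<..}|lborel. p t)"
proof -
  have s: "set_integrable lborel A p" if "A \<in> sets borel" for A
    using int that unfolding set_integrable_def by (intro integrable_mult_indicator) auto
  have "(LINT t:{a<..}|lborel. p t) = (LINT t:{a<..b}|lborel. p t) + (LINT t:{b<..}|lborel. p t)"
    using set_integral_Un[of "{a<..b}" "{b<..}" lborel p, OF _ s s] ivl_disj_un_one(5)[OF \<open>a \<le> b\<close>]
    by (simp add: disjoint_iff)
  moreover have "(LINT t:{a<..b}|lborel. p t) = (LINT t:{a..b}|lborel. p t)"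
    unfolding set_lebesgue_integral_def
  proof (rule integral_cong_AE)
    show "AE t in lborel. indicator {a<..b} t *\<^sub>R p t = indicator {a..b} t *\<^sub>R p t"
      using AE_lborel_singleton[of a] by eventually_elim (auto simp: indicator_def)
  qed (use int in auto)
  ultimately show ?thesis by simp
qed

text \<open>
  Tails of a density serve as distribution functions for the one-dimensional rearrangements below;
  they are stated for densities that are continuous on the whole line, which covers a density on
  \<open>{0<..}\<close> that tends to zero at the origin, extended by zero.
\<close>

lemma tail_has_derivative:
  fixes p :: "real \<Rightarrow> real"
  assumes int: "integrable lborel p" and cont: "continuous_on UNIV p"
  shows "((\<lambda>y. LINT t:{y<..}|lborel. p t) has_real_derivative - p y) (at y)"
proof -
  let ?P = "\<lambda>y. LINT t:{y<..}|lborel. p t"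
  have eq: "?P t = ?P (y - 1) - integral {y - 1..t} p" if "t \<in> {y - 1<..<y + 1}" for t
  proof -
    have "set_integrable lborel {y - 1..t} p"
      using int unfolding set_integrable_def by (intro integrable_mult_indicator) auto
    then have "(LINT s:{y - 1..t}|lborel. p s) = integral {y - 1..t} p"
      by (rule set_borel_integral_eq_integral)
    then show ?thesis using tail_split[OF int, of "y - 1" t] that by auto
  qed
  have "((\<lambda>x. integral {y - 1..x} p) has_real_derivative p y) (at y within {y - 1..y + 1})"
    by (rule integral_has_real_derivative) (auto intro: continuous_on_subset[OF cont])
  then have "((\<lambda>x. integral {y - 1..x} p) has_real_derivative p y) (at y)"
    by (simp add: at_within_Icc_at)
  then have "((\<lambda>t. ?P (y - 1) - integral {y - 1..t} p) has_real_derivative - p y) (at y)"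
    using DERIV_diff[OF DERIV_const[of "?P (y - 1)"]] by fastforce
  then show ?thesis
    by (rule has_field_derivative_transform_within_open[where S = "{y - 1<..<y + 1}"])
      (simp_all add: eq)
qed

lemma tail_le_total:
  fixes p :: "real \<Rightarrow> real"
  assumes int: "integrable lborel p" and nn: "\<And>t. 0 \<le> p t"
  shows "(LINT t:{a<..}|lborel. p t) \<le> (\<integral>t. p t \<partial>lborel)"
  unfolding set_lebesgue_integral_def using nn int
  by (intro integral_mono integrable_mult_indicator) (auto simp: indicator_def)

lemma tail_nonneg:
  fixes p :: "real \<Rightarrow> real"
  assumes "\<And>t. 0 \<le> p t"
  shows "0 \<le> (LINT t:{a<..}|lborel. p t)"
  using assms unfolding set_lebesgue_integral_def by (intro Bochner_Integration.integral_nonneg) auto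

lemma tail_strict:
  fixes p :: "real \<Rightarrow> real"
  assumes int: "integrable lborel p" and cont: "continuous_on UNIV p" and nn: "\<And>t. 0 \<le> p t"
    and pos: "0 < p y"
  shows "0 < (LINT t:{y<..}|lborel. p t)" "(LINT t:{y<..}|lborel. p t) < (\<integral>t. p t \<partial>lborel)"
proof -
  let ?P = "\<lambda>y. LINT t:{y<..}|lborel. p t"
  have d: "(?P has_real_derivative - p y) (at y)" by (rule tail_has_derivative[OF int cont])
  obtain e where "e > 0" "\<And>s. 0 < s \<Longrightarrow> s < e \<Longrightarrow> ?P (y + s) < ?P y"
    using DERIV_neg_dec_right[OF d] pos by auto
  from this(2)[of "e / 2"] \<open>e > 0\<close> tail_nonneg[of p, OF nn, of "y + e/2"] show "0 < ?P y" by auto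
  obtain e where "e > 0" "\<And>s. 0 < s \<Longrightarrow> s < e \<Longrightarrow> ?P y < ?P (y - s)"
    using DERIV_neg_dec_left[OF d] pos by auto
  from this(2)[of "e / 2"] \<open>e > 0\<close> tail_le_total[of p, OF int nn, of "y - e/2"]
  show "?P y < (\<integral>t. p t \<partial>lborel)" by auto
qed

lemma tail_total_diff:
  fixes p :: "real \<Rightarrow> real"
  assumes int: "integrable lborel p"
  shows "(LINT t:{y<..}|lborel. p t) = (\<integral>t. p t \<partial>lborel) - (\<integral>t. indicator {..y} t *\<^sub>R p t \<partial>lborel)"
proof -
  have "(\<integral>t. p t \<partial>lborel) = (\<integral>t. indicator {y<..} t *\<^sub>R p t + indicator {..y} t *\<^sub>R p t \<partial>lborel)"
    by (intro Bochner_Integration.integral_cong) (auto simp: indicator_def)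
  also have "\<dots> = (\<integral>t. indicator {y<..} t *\<^sub>R p t \<partial>lborel) + (\<integral>t. indicator {..y} t *\<^sub>R p t \<partial>lborel)"
    using int by (intro Bochner_Integration.integral_add integrable_mult_indicator) auto
  finally show ?thesis by (simp add: set_lebesgue_integral_def)
qed

lemma tail_at_top:
  fixes p :: "real \<Rightarrow> real"
  assumes int: "integrable lborel p"
  shows "((\<lambda>y. LINT t:{y<..}|lborel. p t) \<longlongrightarrow> 0) at_top"
  unfolding tail_total_diff[OF int]
  using tendsto_diff[OF tendsto_const tendsto_integral_at_top[OF sets_lborel int],
      of "\<integral>t. p t \<partial>lborel"] by simp

lemma tail_at_bot:
  fixes p :: "real \<Rightarrow> real"
  assumes int: "integrable lborel p"
  shows "((\<lambda>y. LINT t:{y<..}|lborel. p t) \<longlongrightarrow> (\<integral>t. p t \<partial>lborel)) at_bot"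
proof -
  have int': "integrable lborel (\<lambda>t. p (- t))"
    using lborel_integrable_real_affine[OF int, of "-1" 0] by simp
  have eq: "(LINT t:{y<..}|lborel. p t) = (\<integral>t. indicator {..-y} t *\<^sub>R p (-t) \<partial>lborel)" for y
  proof -
    have "(LINT t:{y<..}|lborel. p t) = (\<integral>t. indicator {y<..} (-t) *\<^sub>R p (-t) \<partial>lborel)"
      using lborel_integral_real_affine[of "-1" "\<lambda>t. indicator {y<..} t *\<^sub>R p t" 0]
      by (simp add: set_lebesgue_integral_def)
    also have "\<dots> = (\<integral>t. indicator {..-y} t *\<^sub>R p (-t) \<partial>lborel)"
    proof (rule integral_cong_AE)
      show "AE t in lborel. indicator {y<..} (-t) *\<^sub>R p (-t) = indicator {..-y} t *\<^sub>R p (-t)"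
        using AE_lborel_singleton[of "-y"] by eventually_elim (auto simp: indicator_def)
    qed (use int' int in \<open>auto simp: indicator_def\<close>)
    finally show ?thesis .
  qed
  have "(\<integral>t. p (-t) \<partial>lborel) = (\<integral>t. p t \<partial>lborel)"
    using lborel_integral_real_affine[of "-1" p 0] by simp
  moreover have "((\<lambda>y. \<integral>t. indicator {..y} t *\<^sub>R p (-t) \<partial>lborel) \<longlongrightarrow> (\<integral>t. p (-t) \<partial>lborel)) at_top"
    by (rule tendsto_integral_at_top[OF _ int']) simp
  ultimately show ?thesis unfolding eq
    by (simp add: filterlim_at_bot_mirror)
qed

text \<open>
  An integrable function need not tend to zero, but it is small at arbitrarily distant points. That is
  how boundary terms at infinity are discarded: along a sequence, from the finiteness of a second moment.
\<close>

lemma small_value_of_integrable: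
  fixes u :: "real \<Rightarrow> real"
  assumes int: "set_integrable lborel {a<..} u" and "0 < d"
  shows "\<exists>t>N. a < t \<and> u t < d"
proof (rule ccontr)
  assume "\<not> ?thesis"
  then have ge: "d \<le> u t" if "t > N" "t > a" for t using that by force
  define c where "c = max N a"
  have "set_integrable lborel {c<..} u"
    by (rule set_integrable_subset[OF int]) (auto simp: c_def)
  then have "set_integrable lborel {c<..} (\<lambda>_. d)"
    by (rule set_integrable_bound) (use ge \<open>0 < d\<close> in \<open>force simp: c_def set_borel_measurable_def\<close>)+
  then have fin: "emeasure lborel {c<..} < \<infinity>"
    using \<open>0 < d\<close> by (simp add: set_integrable_def integrable_mult_left_iff integrable_indicator_iff)
  have "ennreal K \<le> emeasure lborel {c<..}" if "K \<ge> 0" for K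
  proof -
    have "emeasure lborel {c<..c + K} \<le> emeasure lborel {c<..}" by (intro emeasure_mono) auto
    then show ?thesis using that by simp
  qed
  from this[of "enn2real (emeasure lborel {c<..}) + 1"]
  have "ennreal (enn2real (emeasure lborel {c<..}) + 1) \<le> emeasure lborel {c<..}" by simp
  moreover note fin
  ultimately show False
    by (cases "emeasure lborel {c<..}") auto
qed

text \<open>
  Read \<open>\<Phi> = u * v\<close>, \<open>k = u * v'\<close>, \<open>l = u' * v\<close>. Only one of the two products has a sign and only the
  other one is known to be integrable; Fatou's lemma along an exhaustion then still gives one inequality,
  and this is the direction that a Sobolev inequality consumes.
\<close>

lemma integration_by_parts_one_sided:
  fixes \<Phi> k l :: "real \<Rightarrow> real" and p q d :: "nat \<Rightarrow> real"
  assumes deriv: "\<And>t. t \<in> S \<Longrightarrow> (\<Phi> has_real_derivative k t + l t) (at t)"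
    and k: "continuous_on S k" "\<And>t. t \<in> S \<Longrightarrow> 0 \<le> k t"
    and l: "continuous_on S l" "set_integrable lborel S l"
    and S: "S \<in> sets borel"
    and sub: "\<And>n. {p n..q n} \<subseteq> S" "\<And>n. p n \<le> q n"
    and exh: "\<And>t. t \<in> S \<Longrightarrow> eventually (\<lambda>n. t \<in> {p n..q n}) sequentially"
    and bd: "\<And>n. \<Phi> (q n) - \<Phi> (p n) \<le> d n" "d \<longlonglongrightarrow> 0"
  shows "(\<integral>\<^sup>+t\<in>S. ennreal (k t) \<partial>lborel) \<le> ennreal (- (LINT t:S|lborel. l t))"
    and "0 \<le> - (LINT t:S|lborel. l t)"
proof -
  let ?I = "\<lambda>n. {p n..q n}"
  have kc: "continuous_on (?I n) k" and lc: "continuous_on (?I n) l" for n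
    using k(1) l(1) sub(1)[of n] continuous_on_subset by blast+
  have ki: "set_integrable lborel (?I n) k" and li: "set_integrable lborel (?I n) l" for n
    using kc lc by (auto intro: borel_integrable_atLeastAtMost')
  have eq: "(LINT t:?I n|lborel. k t) = \<Phi> (q n) - \<Phi> (p n) - (LINT t:?I n|lborel. l t)" for n
  proof -
    have "(LINT t:?I n|lborel. k t + l t) = \<Phi> (q n) - \<Phi> (p n)"
      unfolding set_lebesgue_integral_def
      by (rule integral_FTC_Icc)
       (use sub(2) kc lc in \<open>auto intro!: continuous_on_add has_field_derivative_at_within
          deriv subsetD[OF sub(1)[of n]] simp: has_real_derivative_iff_has_vector_derivative[symmetric]\<close>)
    moreover have "(LINT t:?I n|lborel. k t + l t) = (LINT t:?I n|lborel. k t) + (LINT t:?I n|lborel. l t)"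
      by (rule set_integral_add[OF ki li])
    ultimately show ?thesis by simp
  qed
  have k0: "0 \<le> (LINT t:?I n|lborel. k t)" for n
    using k(2) sub(1)[of n] unfolding set_lebesgue_integral_def
    by (intro Bochner_Integration.integral_nonneg) (auto simp: indicator_def)
  have pw: "eventually (\<lambda>n. indicator (?I n) t = (indicator S t :: real)) sequentially" for t
  proof (cases "t \<in> S")
    case True
    show ?thesis
      by (rule eventually_mono[OF exh[OF True]]) (use True in \<open>auto simp: indicator_def\<close>)
  next
    case False
    then have "\<And>n. t \<notin> ?I n" using sub(1) by blast
    with False show ?thesis by (auto simp: indicator_def)
  qed
  have lim: "(\<lambda>n. LINT t:?I n|lborel. l t) \<longlonglongrightarrow> (LINT t:S|lborel. l t)"
    unfolding set_lebesgue_integral_def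
  proof (rule integral_dominated_convergence[where w = "\<lambda>t. norm (indicator S t *\<^sub>R l t)"])
    show "integrable lborel (\<lambda>t. norm (indicator S t *\<^sub>R l t))"
      using l(2) unfolding set_integrable_def by (rule integrable_norm)
    show "(\<lambda>t. indicator S t *\<^sub>R l t) \<in> borel_measurable lborel"
      using l(2) unfolding set_integrable_def by auto
    show "(\<lambda>t. indicator (?I n) t *\<^sub>R l t) \<in> borel_measurable lborel" for n
      using li unfolding set_integrable_def by auto
    have "(\<lambda>n. indicator (?I n) t *\<^sub>R l t) \<longlonglongrightarrow> indicator S t *\<^sub>R l t" for t
      by (intro tendsto_eventually) (rule eventually_mono[OF pw[of t]], simp)
    then show "AE t in lborel. (\<lambda>n. indicator (?I n) t *\<^sub>R l t) \<longlonglongrightarrow> indicator S t *\<^sub>R l t"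
      by simp
    show "AE t in lborel. norm (indicator (?I n) t *\<^sub>R l t) \<le> norm (indicator S t *\<^sub>R l t)" for n
      using sub(1)[of n] by (intro AE_I2) (auto simp: indicator_def)
  qed
  have lim': "(\<lambda>n. d n - (LINT t:?I n|lborel. l t)) \<longlonglongrightarrow> - (LINT t:S|lborel. l t)"
    using tendsto_diff[OF bd(2) lim] by simp
  show "0 \<le> - (LINT t:S|lborel. l t)"
    by (rule LIMSEQ_le_const[OF lim'], intro exI[of _ 0] allI impI)
       (use eq[symmetric] k0 bd(1) in \<open>smt (verit)\<close>)
  have nn: "(\<integral>\<^sup>+t\<in>?I n. ennreal (k t) \<partial>lborel) \<le> ennreal (d n - (LINT t:?I n|lborel. l t))" for n
  proof -
    have "(\<integral>\<^sup>+t\<in>?I n. ennreal (k t) \<partial>lborel) = (\<integral>\<^sup>+t. ennreal (indicator (?I n) t *\<^sub>R k t) \<partial>lborel)"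
      by (intro nn_integral_cong) (auto simp: indicator_def)
    also have "\<dots> = ennreal (LINT t:?I n|lborel. k t)"
      unfolding set_lebesgue_integral_def
    proof (rule nn_integral_eq_integral)
      show "integrable lborel (\<lambda>t. indicator (?I n) t *\<^sub>R k t)"
        using ki[of n] by (simp add: set_integrable_def)
      show "AE t in lborel. 0 \<le> indicator (?I n) t *\<^sub>R k t"
        using k(2) subsetD[OF sub(1)[of n]] by (intro AE_I2) (auto simp: indicator_def)
    qed
    also have "\<dots> \<le> ennreal (d n - (LINT t:?I n|lborel. l t))"
      unfolding eq using bd(1)[of n] by (intro ennreal_leI) simp
    finally show ?thesis .
  qed
  have "(\<integral>\<^sup>+t\<in>S. ennreal (k t) \<partial>lborel) = (\<integral>\<^sup>+t. liminf (\<lambda>n. ennreal (k t) * indicator (?I n) t) \<partial>lborel)"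
  proof (intro nn_integral_cong)
    fix t
    have "(\<lambda>n. ennreal (k t) * indicator (?I n) t) \<longlonglongrightarrow> ennreal (k t) * indicator S t"
      by (intro tendsto_eventually) (rule eventually_mono[OF pw[of t]], auto simp: indicator_def split: if_splits)
    then show "ennreal (k t) * indicator S t = liminf (\<lambda>n. ennreal (k t) * indicator (?I n) t)"
      by (simp add: lim_imp_Liminf)
  qed
  also have "\<dots> \<le> liminf (\<lambda>n. \<integral>\<^sup>+t. ennreal (k t) * indicator (?I n) t \<partial>lborel)"
  proof (rule nn_integral_liminf)
    fix n
    have "(\<lambda>t. ennreal (indicator (?I n) t *\<^sub>R k t)) \<in> borel_measurable lborel"
      using ki[of n] unfolding set_integrable_def by measurable
    moreover have "(\<lambda>t. ennreal (indicator (?I n) t *\<^sub>R k t)) = (\<lambda>t. ennreal (k t) * indicator (?I n) t)"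
      by (auto simp: indicator_def)
    ultimately show "(\<lambda>t. ennreal (k t) * indicator (?I n) t) \<in> borel_measurable lborel" by simp
  qed
  also have "\<dots> \<le> liminf (\<lambda>n. ennreal (d n - (LINT t:?I n|lborel. l t)))"
    by (intro Liminf_mono always_eventually allI nn)
  also have "\<dots> = ennreal (- (LINT t:S|lborel. l t))"
    using tendsto_ennrealI[OF lim'] by (intro lim_imp_Liminf) auto
  finally show "(\<integral>\<^sup>+t\<in>S. ennreal (k t) \<partial>lborel) \<le> ennreal (- (LINT t:S|lborel. l t))" .
qed

text \<open>
  The bound \<open>\<Phi>\<^sup>2 \<le> u\<close> with \<open>u\<close> integrable yields endpoints, arbitrarily far out, at which \<open>\<Phi>\<close> is small.
\<close>

lemma integration_by_parts_line:
  fixes \<Phi> k l u :: "real \<Rightarrow> real"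
  assumes deriv: "\<And>t. (\<Phi> has_real_derivative k t + l t) (at t)"
    and k: "continuous_on UNIV k" "\<And>t. 0 \<le> k t"
    and l: "continuous_on UNIV l" "integrable lborel l"
    and u: "integrable lborel u" "\<And>t. (\<Phi> t)\<^sup>2 \<le> u t"
  shows "(\<integral>\<^sup>+t. ennreal (k t) \<partial>lborel) \<le> ennreal (- (\<integral>t. l t \<partial>lborel))"
    and "0 \<le> - (\<integral>t. l t \<partial>lborel)"
proof -
  have bd: "\<bar>\<Phi> t\<bar> < e" if "u t < e\<^sup>2" "0 < e" for t e
    using u(2)[of t] that by (simp add: power2_less_imp_less[of "\<bar>\<Phi> t\<bar>" e])
  have u': "integrable lborel (\<lambda>t. u (- t))"
    using lborel_integrable_real_affine[OF u(1), of "-1" 0] by simp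
  have si: "set_integrable lborel {0<..} v" if "integrable lborel v" for v :: "real \<Rightarrow> real"
    using that unfolding set_integrable_def by (intro integrable_mult_indicator) auto
  have "\<exists>t. real n < t \<and> u t < (1 / (real n + 1))\<^sup>2" for n
    using small_value_of_integrable[OF si[OF u(1)], of "(1 / (real n + 1))\<^sup>2" "real n"]
    by (auto simp: power_divide)
  then obtain q where q: "\<And>n. real n < q n" "\<And>n. u (q n) < (1 / (real n + 1))\<^sup>2" by metis
  have "\<exists>t. real n < t \<and> u (- t) < (1 / (real n + 1))\<^sup>2" for n
    using small_value_of_integrable[OF si[OF u'], of "(1 / (real n + 1))\<^sup>2" "real n"]
    by (auto simp: power_divide)
  then obtain p where p: "\<And>n. real n < p n" "\<And>n. u (- p n) < (1 / (real n + 1))\<^sup>2" by metis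
  have exh: "eventually (\<lambda>n. t \<in> {- p n..q n}) sequentially" for t
    using eventually_ge_at_top[of "nat \<lceil>\<bar>t\<bar>\<rceil>"]
  proof eventually_elim
    case (elim n)
    then have "\<bar>t\<bar> \<le> real n" by linarith
    then show ?case using p(1)[of n] q(1)[of n] by auto
  qed
  have lim: "(\<lambda>n. 2 / (real n + 1)) \<longlonglongrightarrow> 0"
    using tendsto_mult_left[OF LIMSEQ_inverse_real_of_nat, of 2] by (simp add: field_simps)
  have le: "\<Phi> (q n) - \<Phi> (- p n) \<le> 2 / (real n + 1)" for n
    using bd[OF q(2)[of n]] bd[OF p(2)[of n]] by (auto simp: field_simps abs_less_iff)
  have ord: "- p n \<le> q n" for n using p(1)[of n] q(1)[of n] by linarith
  show "(\<integral>\<^sup>+t. ennreal (k t) \<partial>lborel) \<le> ennreal (- (\<integral>t. l t \<partial>lborel))"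
    "0 \<le> - (\<integral>t. l t \<partial>lborel)"
    using integration_by_parts_one_sided[where S = UNIV and p = "\<lambda>n. - p n" and q = q
        and \<Phi> = \<Phi> and k = k and l = l and d = "\<lambda>n. 2 / (real n + 1)"] deriv k l exh lim le ord
    by (simp_all add: set_lebesgue_integral_def set_integrable_def)
qed

text \<open>
  At the origin the boundary term has a favourable sign because \<open>\<Phi>\<close> is nonnegative.
\<close>

lemma integration_by_parts_half_line:
  fixes \<Phi> k l u :: "real \<Rightarrow> real"
  assumes deriv: "\<And>t. 0 < t \<Longrightarrow> (\<Phi> has_real_derivative k t + l t) (at t)"
    and k: "continuous_on {0<..} k" "\<And>t. 0 < t \<Longrightarrow> 0 \<le> k t"
    and l: "continuous_on {0<..} l" "set_integrable lborel {0<..} l"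
    and u: "set_integrable lborel {0<..} u" "\<And>t. 0 < t \<Longrightarrow> (\<Phi> t)\<^sup>2 \<le> u t"
    and pos: "\<And>t. 0 < t \<Longrightarrow> 0 \<le> \<Phi> t"
  shows "(\<integral>\<^sup>+t\<in>{0<..}. ennreal (k t) \<partial>lborel) \<le> ennreal (- (LINT t:{0<..}|lborel. l t))"
    and "0 \<le> - (LINT t:{0<..}|lborel. l t)"
proof -
  have bd: "\<bar>\<Phi> t\<bar> < e" if "u t < e\<^sup>2" "0 < e" "0 < t" for t e
    using u(2)[of t] that by (simp add: power2_less_imp_less[of "\<bar>\<Phi> t\<bar>" e])
  have "\<exists>t. real n + 1 < t \<and> u t < (1 / (real n + 1))\<^sup>2" for n
    using small_value_of_integrable[OF u(1), of "(1 / (real n + 1))\<^sup>2" "real n + 1"]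
    by (auto simp: power_divide)
  then obtain q where q: "\<And>n. real n + 1 < q n" "\<And>n. u (q n) < (1 / (real n + 1))\<^sup>2" by metis
  \<comment> \<open>the lower endpoints tend to 0, the upper ones are far out and chosen where \<open>u\<close> is small\<close>
  define p where "p n = 1 / (real n + 1)" for n
  have p: "0 < p n" "p n \<le> 1" for n by (auto simp: p_def)
  have p0: "p \<longlonglongrightarrow> 0"
    unfolding p_def using LIMSEQ_inverse_real_of_nat by (simp add: field_simps)
  have exh: "eventually (\<lambda>n. t \<in> {p n..q n}) sequentially" if "0 < t" for t
    using eventually_ge_at_top[of "nat \<lceil>\<bar>t\<bar>\<rceil>"] order_tendstoD(2)[OF p0 that]
  proof eventually_elim
    case (elim n)
    then have "\<bar>t\<bar> \<le> real n" by linarith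
    then show ?case using q(1)[of n] elim by auto
  qed
  have q0: "0 < q n" for n using q(1)[of n] by linarith
  have le: "\<Phi> (q n) - \<Phi> (p n) \<le> p n" for n
    using bd[OF q(2)[of n] _ q0[of n]] pos[OF p(1)[of n]] by (auto simp: p_def)
  have ord: "p n \<le> q n" for n using p(2)[of n] q(1)[of n] by linarith
  have sub: "{p n..q n} \<subseteq> {0<..}" for n using p(1)[of n] by auto
  show "(\<integral>\<^sup>+t\<in>{0<..}. ennreal (k t) \<partial>lborel) \<le> ennreal (- (LINT t:{0<..}|lborel. l t))"
    "0 \<le> - (LINT t:{0<..}|lborel. l t)"
    using integration_by_parts_one_sided[where S = "{0<..}" and p = p and q = q
        and \<Phi> = \<Phi> and k = k and l = l and d = p] deriv k l exh p0 le ord sub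
    by simp_all
qed

section \<open>Integrals over half-lines, lines and the plane\<close>

lemma FTC_nonneg_half_line:
  fixes f F :: "real \<Rightarrow> real"
  assumes F: "\<And>t. 0 < t \<Longrightarrow> (F has_real_derivative f t) (at t)"
    and f: "continuous_on {0<..} f" "\<And>t. 0 < t \<Longrightarrow> 0 \<le> f t"
    and A: "(F \<longlongrightarrow> A) (at_right 0)" and B: "(F \<longlongrightarrow> B) at_top"
  shows "has_bochner_integral lborel (\<lambda>t. indicator {0<..} t *\<^sub>R f t) (B - A)"
proof -
  have fc: "isCont f t" if "0 < t" for t
    using f(1) that by (simp add: continuous_on_eq_continuous_at)
  have I: "einterval 0 \<infinity> = {0<..}" by (auto simp: einterval_def zero_ereal_def)
  have "set_integrable lborel (einterval 0 \<infinity>) f" "(LBINT t=0..\<infinity>. f t) = B - A"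
    using interval_integral_FTC_nonneg[of 0 \<infinity> F f A B] F fc f(2) A B
    by (auto simp: zero_ereal_def ereal_tendsto_simps)
  then show ?thesis
    unfolding I by (simp add: has_bochner_integral_iff set_integrable_def
        interval_lebesgue_integral_def set_lebesgue_integral_def I)
qed

lemma FTC_nonneg_line:
  fixes f F :: "real \<Rightarrow> real"
  assumes F: "\<And>t. (F has_real_derivative f t) (at t)"
    and f: "continuous_on UNIV f" "\<And>t. 0 \<le> f t"
    and A: "(F \<longlongrightarrow> A) at_bot" and B: "(F \<longlongrightarrow> B) at_top"
  shows "has_bochner_integral lborel f (B - A)"
proof -
  have fc: "isCont f t" for t
    using f(1) by (simp add: continuous_on_eq_continuous_at)
  have I: "einterval (-\<infinity>) \<infinity> = UNIV" by (auto simp: einterval_def)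
  have "set_integrable lborel (einterval (-\<infinity>) \<infinity>) f" "(LBINT t=-\<infinity>..\<infinity>. f t) = B - A"
    using interval_integral_FTC_nonneg[of "-\<infinity>" \<infinity> F f A B] F fc f(2) A B
    by (auto simp: ereal_tendsto_simps)
  then show ?thesis
    unfolding I by (simp add: has_bochner_integral_iff set_integrable_def
        interval_lebesgue_integral_def set_lebesgue_integral_def I)
qed

lemma has_bochner_integral_iterated:
  fixes f :: "real \<times> real \<Rightarrow> real"
  assumes meas: "f \<in> borel_measurable borel" and nn: "\<And>z. 0 \<le> f z"
    and inner: "\<And>x. has_bochner_integral lborel (\<lambda>y. f (x, y)) (g x)"
    and outer: "has_bochner_integral lborel g c"
  shows "has_bochner_integral lborel f c"
proof -
  have g0: "0 \<le> g x" for x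
    using inner[of x] nn by (metis has_bochner_integral_iff Bochner_Integration.integral_nonneg)
  have c0: "0 \<le> c" using outer g0 by (metis has_bochner_integral_iff Bochner_Integration.integral_nonneg)
  have "(\<integral>\<^sup>+z. ennreal (f z) \<partial>lborel) = (\<integral>\<^sup>+x. \<integral>\<^sup>+y. ennreal (f (x, y)) \<partial>lborel \<partial>lborel)"
    using lborel.nn_integral_fst[of "\<lambda>z. ennreal (f z)" "lborel :: real measure"] meas
    by (simp add: lborel_prod)
  also have "\<dots> = (\<integral>\<^sup>+x. ennreal (g x) \<partial>lborel)"
    using inner nn by (intro nn_integral_cong)
      (metis has_bochner_integral_iff nn_integral_eq_integral AE_I2)
  also have "\<dots> = ennreal c"
    using outer g0 by (metis has_bochner_integral_iff nn_integral_eq_integral AE_I2)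
  finally show ?thesis using meas nn c0 by (intro has_bochner_integral_nn_integral) auto
qed

lemma borel_measurable_swap:
  fixes f :: "real \<times> real \<Rightarrow> 'b::topological_space"
  assumes "f \<in> borel_measurable borel"
  shows "(\<lambda>z. f (snd z, fst z)) \<in> borel_measurable borel"
  by (rule measurable_compose[OF borel_measurable_continuous_onI assms]) (intro continuous_intros)

lemma has_bochner_integral_iterated_swap:
  fixes f :: "real \<times> real \<Rightarrow> real"
  assumes meas: "f \<in> borel_measurable borel" and nn: "\<And>z. 0 \<le> f z"
    and inner: "\<And>y. has_bochner_integral lborel (\<lambda>x. f (x, y)) (g y)"
    and outer: "has_bochner_integral lborel g c"
  shows "has_bochner_integral lborel f c"
proof -
  have "has_bochner_integral lborel (\<lambda>z. f (snd z, fst z)) c"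
    by (rule has_bochner_integral_iterated[OF _ _ _ outer])
       (use nn inner borel_measurable_swap[OF meas] in auto)
  then show ?thesis
    using lborel_pair.integrable_product_swap_iff[of f] lborel_pair.integral_product_swap[of f] meas
    by (auto simp: has_bochner_integral_iff lborel_prod case_prod_unfold)
qed

text \<open>
  Integrates over the plane an inequality that is known on almost every vertical line. The second half of
  the slice hypothesis is there because \<open>ennreal\<close> truncates negative numbers to zero.
\<close>

lemma nn_integral_le_of_slices:
  fixes K L :: "real \<times> real \<Rightarrow> real"
  assumes K: "K \<in> borel_measurable borel" and L: "integrable lborel L"
    and slice: "AE x in lborel. (\<integral>\<^sup>+y. ennreal (K (x, y)) \<partial>lborel) \<le> ennreal (- (\<integral>y. L (x, y) \<partial>lborel))
      \<and> 0 \<le> - (\<integral>y. L (x, y) \<partial>lborel)"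
  shows "(\<integral>\<^sup>+z. ennreal (K z) \<partial>lborel) \<le> ennreal (- (\<integral>z. L z \<partial>lborel))"
proof -
  have L': "integrable (lborel \<Otimes>\<^sub>M lborel) L" using L by (simp add: lborel_prod)
  have i: "integrable lborel (\<lambda>x. - (\<integral>y. L (x, y) \<partial>lborel))"
    by (intro Bochner_Integration.integrable_minus lborel_pair.integrable_fst'[OF L'])
  have "(\<integral>\<^sup>+z. ennreal (K z) \<partial>lborel) = (\<integral>\<^sup>+x. \<integral>\<^sup>+y. ennreal (K (x, y)) \<partial>lborel \<partial>lborel)"
    using lborel.nn_integral_fst[of "\<lambda>z. ennreal (K z)" "lborel :: real measure"] K
    by (simp add: lborel_prod)
  also have "\<dots> \<le> (\<integral>\<^sup>+x. ennreal (- (\<integral>y. L (x, y) \<partial>lborel)) \<partial>lborel)"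
    by (rule nn_integral_mono_AE) (use slice in \<open>auto elim: eventually_mono\<close>)
  also have "\<dots> = ennreal (\<integral>x. - (\<integral>y. L (x, y) \<partial>lborel) \<partial>lborel)"
    by (rule nn_integral_eq_integral[OF i]) (use slice in \<open>auto elim: eventually_mono\<close>)
  also have "(\<integral>x. - (\<integral>y. L (x, y) \<partial>lborel) \<partial>lborel) = - (\<integral>z. L z \<partial>lborel)"
    using lborel_pair.integral_fst'[OF L'] by (simp add: lborel_prod)
  finally show ?thesis .
qed

lemma nn_integral_le_of_slices_swap:
  fixes K L :: "real \<times> real \<Rightarrow> real"
  assumes K: "K \<in> borel_measurable borel" and L: "integrable lborel L"
    and slice: "AE y in lborel. (\<integral>\<^sup>+x. ennreal (K (x, y)) \<partial>lborel) \<le> ennreal (- (\<integral>x. L (x, y) \<partial>lborel))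
      \<and> 0 \<le> - (\<integral>x. L (x, y) \<partial>lborel)"
  shows "(\<integral>\<^sup>+z. ennreal (K z) \<partial>lborel) \<le> ennreal (- (\<integral>z. L z \<partial>lborel))"
proof -
  have L': "integrable (lborel \<Otimes>\<^sub>M lborel) L" using L by (simp add: lborel_prod)
  have "(\<integral>\<^sup>+z. ennreal (K z) \<partial>lborel) = (\<integral>\<^sup>+y. \<integral>\<^sup>+x. ennreal (K (x, y)) \<partial>lborel \<partial>lborel)"
    using lborel_pair.nn_integral_snd[of "\<lambda>z. ennreal (K z)"] K
    by (simp add: lborel_prod)
  also have "\<dots> = (\<integral>\<^sup>+z. ennreal (K (snd z, fst z)) \<partial>lborel)"
    using lborel.nn_integral_fst[of "\<lambda>z. ennreal (K (snd z, fst z))" "lborel :: real measure"]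
      borel_measurable_swap[OF K]
    by (simp add: lborel_prod)
  also have "\<dots> \<le> ennreal (- (\<integral>z. L (snd z, fst z) \<partial>lborel))"
  proof (rule nn_integral_le_of_slices)
    show "(\<lambda>z. K (snd z, fst z)) \<in> borel_measurable borel" by (rule borel_measurable_swap[OF K])
    show "integrable lborel (\<lambda>z. L (snd z, fst z))"
      using lborel_pair.integrable_product_swap[OF L'] by (simp add: lborel_prod case_prod_unfold)
  qed (use slice in simp)
  also have "(\<integral>z. L (snd z, fst z) \<partial>lborel) = (\<integral>z. L z \<partial>lborel)"
    using lborel_pair.integral_product_swap[of L] L
    by (simp add: lborel_prod case_prod_unfold)
  finally show ?thesis .
qed

section \<open>The transport map and the inequality for positive profiles\<close>

lemma borel_measurable_half_plane:
  fixes f :: "real \<times> real \<Rightarrow> real"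
  assumes "continuous_on {z. 0 < snd z} f"
  shows "(\<lambda>z. if 0 < snd z then f z else 0) \<in> borel_measurable borel"
proof -
  have "open {z :: real \<times> real. 0 < snd z}" by (intro open_Collect_less continuous_intros)
  then have "(\<lambda>z. indicator {z. 0 < snd z} z *\<^sub>R f z) \<in> borel_measurable borel"
    by (intro borel_measurable_continuous_on_indicator assms) auto
  moreover have "(\<lambda>z. indicator {z. 0 < snd z} z *\<^sub>R f z) = (\<lambda>z. if 0 < snd z then f z else 0)"
    by (auto simp: indicator_def)
  ultimately show ?thesis by simp
qed

lemma one_plus_squares_pos: "0 < 1 + x\<^sup>2 + (y::real)\<^sup>2" for x :: real
  by (simp add: add_pos_nonneg)

text \<open>
  The horizontal marginal of the extremal density \<open>y * (1 + x\<^sup>2 + y\<^sup>2) ^ (-3)\<close>.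
\<close>

lemma integral_y_over_cube:
  fixes x :: real
  shows "has_bochner_integral lborel (\<lambda>y. indicator {0<..} y *\<^sub>R (y / (1 + x\<^sup>2 + y\<^sup>2) ^ 3)) (1 / (4 * (1 + x\<^sup>2)\<^sup>2))"
proof -
  have p: "0 < 1 + x\<^sup>2 + y\<^sup>2" for y :: real by (rule one_plus_squares_pos)
  have "has_bochner_integral lborel (\<lambda>y. indicator {0<..} y *\<^sub>R (y / (1 + x\<^sup>2 + y\<^sup>2) ^ 3))
      (0 - - 1 / (4 * (1 + x\<^sup>2)\<^sup>2))"
  proof (rule FTC_nonneg_half_line)
    have s: "((\<lambda>s. - 1 / (4 * s\<^sup>2)) has_real_derivative 1 / (2 * s ^ 3)) (at s)" if "0 < s" for s :: real
      using that by (auto intro!: derivative_eq_intros simp: power2_eq_square power3_eq_cube field_simps)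
    have "((\<lambda>y. 1 + x\<^sup>2 + y\<^sup>2) has_real_derivative 2 * y) (at y)" for y
      by (auto intro!: derivative_eq_intros)
    from DERIV_chain2[OF s[OF p] this]
    show "((\<lambda>y. - 1 / (4 * (1 + x\<^sup>2 + y\<^sup>2)\<^sup>2)) has_real_derivative y / (1 + x\<^sup>2 + y\<^sup>2) ^ 3) (at y)" for y
      by simp
    show "continuous_on {0<..} (\<lambda>y. y / (1 + x\<^sup>2 + y\<^sup>2) ^ 3)"
      using p by (intro continuous_intros) (metis less_irrefl power_eq_0_iff)
    show "((\<lambda>y. - 1 / (4 * (1 + x\<^sup>2 + y\<^sup>2)\<^sup>2)) \<longlongrightarrow> - 1 / (4 * (1 + x\<^sup>2)\<^sup>2)) (at_right 0)"
      using p[of 0] by (auto intro!: tendsto_eq_intros)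
    show "((\<lambda>y. - 1 / (4 * (1 + x\<^sup>2 + y\<^sup>2)\<^sup>2)) \<longlongrightarrow> 0) at_top" by real_asymp
  qed (use p in \<open>auto intro!: divide_nonneg_pos\<close>)
  then show ?thesis by simp
qed

text \<open>
  Up to normalisation, the distribution function of the density \<open>(1 + s\<^sup>2) ^ (-2)\<close>, which is the
  horizontal marginal of the extremal density. In the variable \<open>\<theta> = arctan s\<close> it is \<open>\<theta> + sin \<theta> * cos \<theta>\<close>.
\<close>

definition angle_cdf :: "real \<Rightarrow> real" where
  "angle_cdf s = arctan s + s / (1 + s\<^sup>2)"

lemma angle_cdf_derivative: "(angle_cdf has_real_derivative 2 / (1 + s\<^sup>2)\<^sup>2) (at s)"
proof -
  have p: "0 < 1 + s\<^sup>2" by (simp add: add_pos_nonneg)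
  have "(angle_cdf has_real_derivative 1 / (1 + s\<^sup>2) + (1 * (1 + s\<^sup>2) - s * (2 * s)) / ((1 + s\<^sup>2) * (1 + s\<^sup>2))) (at s)"
    unfolding angle_cdf_def using p by (auto intro!: derivative_eq_intros simp: inverse_eq_divide)
  also have "1 / (1 + s\<^sup>2) + (1 * (1 + s\<^sup>2) - s * (2 * s)) / ((1 + s\<^sup>2) * (1 + s\<^sup>2)) = 2 / (1 + s\<^sup>2)\<^sup>2"
    using p by (simp add: divide_simps) (simp add: power2_eq_square algebra_simps)
  finally show ?thesis .
qed

lemma angle_cdf_strict_mono: "strict_mono angle_cdf"
proof (rule strict_monoI)
  fix a b :: real assume "a < b"
  then show "angle_cdf a < angle_cdf b"
    by (rule DERIV_pos_imp_increasing)
      (use angle_cdf_derivative in \<open>force intro!: divide_pos_pos simp: add_pos_nonneg power2_eq_square\<close>)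
qed

lemma angle_cdf_limits: "(angle_cdf \<longlongrightarrow> pi / 2) at_top" "(angle_cdf \<longlongrightarrow> - (pi / 2)) at_bot"
  unfolding angle_cdf_def by real_asymp+

lemma angle_cdf_isCont: "isCont angle_cdf s"
  by (rule DERIV_isCont[OF angle_cdf_derivative])

lemma angle_cdf_bounds: "- (pi / 2) < angle_cdf s" "angle_cdf s < pi / 2"
proof -
  have "angle_cdf (s - 1) < angle_cdf s" "angle_cdf s < angle_cdf (s + 1)"
    using angle_cdf_strict_mono by (auto simp: strict_mono_def)
  moreover have "- (pi / 2) \<le> angle_cdf (s - 1)"
    by (rule tendsto_upperbound[OF angle_cdf_limits(2)])
      (auto simp: eventually_at_bot_linorder strict_mono_less_eq[OF angle_cdf_strict_mono])
  moreover have "angle_cdf (s + 1) \<le> pi / 2"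
    by (rule tendsto_lowerbound[OF angle_cdf_limits(1)])
      (auto simp: eventually_at_top_linorder strict_mono_less_eq[OF angle_cdf_strict_mono])
  ultimately show "- (pi / 2) < angle_cdf s" "angle_cdf s < pi / 2" by linarith+
qed

lemma angle_cdf_surj:
  assumes "- (pi / 2) < t" "t < pi / 2"
  shows "\<exists>s. angle_cdf s = t"
proof -
  obtain b where b: "t < angle_cdf b"
    using order_tendstoD(1)[OF angle_cdf_limits(1) assms(2)] by (auto simp: eventually_at_top_linorder)
  obtain a where a: "angle_cdf a < t"
    using order_tendstoD(2)[OF angle_cdf_limits(2) assms(1)] by (auto simp: eventually_at_bot_linorder)
  have "a \<le> b" using a b angle_cdf_strict_mono by (metis less_trans strict_mono_less less_imp_le)
  then show ?thesis
    using IVT[of angle_cdf a t b] a b angle_cdf_isCont by auto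
qed

definition angle_cdf_inv :: "real \<Rightarrow> real" where
  "angle_cdf_inv t = (THE s. angle_cdf s = t)"

lemma angle_cdf_inv_left [simp]: "angle_cdf_inv (angle_cdf s) = s"
  unfolding angle_cdf_inv_def
  using strict_mono_eq[OF angle_cdf_strict_mono] by auto

lemma angle_cdf_inv_right: "- (pi / 2) < t \<Longrightarrow> t < pi / 2 \<Longrightarrow> angle_cdf (angle_cdf_inv t) = t"
  using angle_cdf_surj[of t] by auto

lemma angle_cdf_inv_derivative:
  assumes "- (pi / 2) < t" "t < pi / 2"
  shows "(angle_cdf_inv has_real_derivative (1 + (angle_cdf_inv t)\<^sup>2)\<^sup>2 / 2) (at t)"
proof -
  have "isCont angle_cdf_inv (angle_cdf (angle_cdf_inv t))"
    by (rule isCont_inverse_function[where d = 1]) (auto simp: angle_cdf_isCont)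
  then have c: "isCont angle_cdf_inv t" using angle_cdf_inv_right[OF assms] by simp
  have "1 + (angle_cdf_inv t)\<^sup>2 \<noteq> 0" by (metis add_pos_nonneg less_irrefl zero_le_power2 zero_less_one)
  then have "(angle_cdf_inv has_real_derivative inverse (2 / (1 + (angle_cdf_inv t)\<^sup>2)\<^sup>2)) (at t)"
    by (intro DERIV_inverse_function[OF angle_cdf_derivative _ assms] angle_cdf_inv_right c) auto
  then show ?thesis by simp
qed

lemma angle_cdf_inv_at_top:
  assumes lim: "(N \<longlongrightarrow> pi / 2) F" and N: "\<And>x. - (pi / 2) < N x" "\<And>x. N x < pi / 2"
  shows "filterlim (\<lambda>x. angle_cdf_inv (N x)) at_top F"
  unfolding filterlim_at_top
proof
  fix Z :: real
  have "eventually (\<lambda>x. angle_cdf Z < N x) F"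
    by (rule order_tendstoD(1)[OF lim]) (rule angle_cdf_bounds)
  then show "eventually (\<lambda>x. Z \<le> angle_cdf_inv (N x)) F"
  proof eventually_elim
    case (elim x)
    then have "angle_cdf Z < angle_cdf (angle_cdf_inv (N x))" using angle_cdf_inv_right N by simp
    then show ?case using strict_mono_less[OF angle_cdf_strict_mono] by auto
  qed
qed

lemma angle_cdf_inv_at_bot:
  assumes lim: "(N \<longlongrightarrow> - (pi / 2)) F" and N: "\<And>x. - (pi / 2) < N x" "\<And>x. N x < pi / 2"
  shows "filterlim (\<lambda>x. angle_cdf_inv (N x)) at_bot F"
  unfolding filterlim_at_bot
proof
  fix Z :: real
  have "eventually (\<lambda>x. N x < angle_cdf Z) F"
    by (rule order_tendstoD(2)[OF lim]) (rule angle_cdf_bounds)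
  then show "eventually (\<lambda>x. angle_cdf_inv (N x) \<le> Z) F"
  proof eventually_elim
    case (elim x)
    then have "angle_cdf (angle_cdf_inv (N x)) < angle_cdf Z" using angle_cdf_inv_right N by simp
    then show ?case using strict_mono_less[OF angle_cdf_strict_mono] by auto
  qed
qed

lemma integral_inverse_square: "has_bochner_integral lborel (\<lambda>s::real. 1 / (1 + s\<^sup>2)\<^sup>2) (pi / 2)"
proof -
  have p: "1 + s\<^sup>2 \<noteq> 0" for s :: real by (metis add_pos_nonneg less_irrefl zero_le_power2 zero_less_one)
  have "has_bochner_integral lborel (\<lambda>s::real. 2 / (1 + s\<^sup>2)\<^sup>2) (pi / 2 - - (pi / 2))"
    by (rule FTC_nonneg_line[OF angle_cdf_derivative _ _ angle_cdf_limits(2,1)])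
      (use p in \<open>auto intro!: continuous_intros\<close>)
  from has_bochner_integral_divide_zero[OF this, of 2] show ?thesis by simp
qed

text \<open>
  Positive functions on the half-plane of at most the size of the extremal function
  \<open>(1 + x\<^sup>2 + y\<^sup>2) ^ (-1/2)\<close>. Positivity makes the
  two rearrangements of the transport map differentiable; the upper bound makes the measure
  \<open>y * h ^ 6\<close> finite and its horizontal marginal continuous.
\<close>

locale half_plane_profile =
  fixes h hx hy :: "real \<Rightarrow> real \<Rightarrow> real" and C :: real
  assumes pos: "\<And>x y. 0 < y \<Longrightarrow> 0 < h x y"
    and bound: "\<And>x y. 0 < y \<Longrightarrow> h x y \<le> C / sqrt (1 + x\<^sup>2 + y\<^sup>2)"
    and dx: "\<And>x y. 0 < y \<Longrightarrow> ((\<lambda>x. h x y) has_real_derivative hx x y) (at x)"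
    and dy: "\<And>x y. 0 < y \<Longrightarrow> ((\<lambda>y. h x y) has_real_derivative hy x y) (at y)"
    and cont: "continuous_on {z. 0 < snd z} (\<lambda>z. h (fst z) (snd z))"
      "continuous_on {z. 0 < snd z} (\<lambda>z. hx (fst z) (snd z))"
      "continuous_on {z. 0 < snd z} (\<lambda>z. hy (fst z) (snd z))"
begin

text \<open>
  The measure to be transported has density \<open>w\<close>, horizontal marginal \<open>m\<close> and total mass \<open>M\<close>;
  \<open>R x\<close> is the normalised tail of \<open>w\<close> on the vertical line over \<open>x\<close>. The target is the multiple of
  \<open>y * (1 + x\<^sup>2 + y\<^sup>2) ^ (-3)\<close> with mass \<open>M\<close>. The Knothe map \<open>(X x, T x y)\<close> matches first the horizontal marginals
  and then the conditional laws on vertical lines. For the target, the law of \<open>y\<^sup>2 / (1 + x\<^sup>2)\<close> conditional on \<open>x\<close> has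
  tail \<open>u \<mapsto> (1 + u) ^ (-2)\<close>; solving \<open>(1 + T\<^sup>2 / (1 + X\<^sup>2)) ^ (-2) = R\<close> gives the closed form of \<open>T\<close>.
\<close>

definition w :: "real \<Rightarrow> real \<Rightarrow> real" where
  "w x y = (if 0 < y then y * h x y ^ 6 else 0)"

definition m :: "real \<Rightarrow> real" where "m x = (\<integral>y. w x y \<partial>lborel)"

definition M :: real where "M = (\<integral>x. m x \<partial>lborel)"

definition R :: "real \<Rightarrow> real \<Rightarrow> real" where
  "R x y = (LINT t:{y<..}|lborel. w x t) / m x"

definition X :: "real \<Rightarrow> real" where
  "X x = angle_cdf_inv (pi * (1 / 2 - (LINT t:{x<..}|lborel. m t) / M))"

definition T :: "real \<Rightarrow> real \<Rightarrow> real" where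
  "T x y = sqrt ((1 + (X x)\<^sup>2) * (1 / sqrt (R x y) - 1))"

lemma cont_slices:
  assumes c: "continuous_on {z. 0 < snd z} (\<lambda>z. g (fst z) (snd z))"
  shows "0 < y \<Longrightarrow> continuous_on UNIV (\<lambda>x. g x y)" "continuous_on {0<..} (\<lambda>y. g x y)"
proof -
  show "continuous_on UNIV (\<lambda>x. g x y)" if "0 < y"
    by (rule continuous_on_compose2[OF c, where f = "\<lambda>x. (x, y)", simplified])
      (use that in \<open>auto intro!: continuous_on_Pair continuous_on_id continuous_on_const\<close>)
  show "continuous_on {0<..} (\<lambda>y. g x y)"
    by (rule continuous_on_compose2[OF c, where f = "\<lambda>y. (x, y)", simplified])
      (auto intro!: continuous_on_Pair continuous_on_id continuous_on_const)
qed

lemma w_nonneg: "0 \<le> w x y" by (auto simp: w_def)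

lemma w_pos: "0 < y \<Longrightarrow> 0 < w x y" using pos[of y x] by (simp add: w_def)

lemma C_pos: "0 < C"
proof -
  have "0 < C / sqrt (1 + 0\<^sup>2 + 1\<^sup>2)" using pos[of 1 0] bound[of 1 0] by simp
  then show ?thesis by (simp add: zero_less_divide_iff)
qed

lemma h_bound: assumes "0 < y" shows "(h x y)\<^sup>2 \<le> C\<^sup>2 / (1 + x\<^sup>2 + y\<^sup>2)" 
proof -
  have "(h x y)\<^sup>2 \<le> (C / sqrt (1 + x\<^sup>2 + y\<^sup>2))\<^sup>2"
    using pos[OF assms, of x] bound[OF assms, of x] by (intro power_mono) auto
  then show ?thesis using one_plus_squares_pos[of x y] by (simp add: power_divide)
qed

lemma w_bound: "w x y \<le> C ^ 6 * (indicator {0<..} y *\<^sub>R (y / (1 + x\<^sup>2 + y\<^sup>2) ^ 3))"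
proof (cases "0 < y")
  case True
  have "((h x y)\<^sup>2) ^ 3 \<le> (C\<^sup>2 / (1 + x\<^sup>2 + y\<^sup>2)) ^ 3" by (intro power_mono h_bound True) auto
  then have "h x y ^ 6 \<le> C ^ 6 / (1 + x\<^sup>2 + y\<^sup>2) ^ 3" by (simp add: power_divide flip: power_mult)
  from mult_left_mono[OF this, of y] True show ?thesis by (simp add: w_def field_simps)
qed (simp add: w_def)

lemma w_measurable: "(\<lambda>z. w (fst z) (snd z)) \<in> borel_measurable borel"
  unfolding w_def using cont by (intro borel_measurable_half_plane continuous_intros)

lemma w_measurable_slice: "w x \<in> borel_measurable borel"
  using measurable_compose[OF borel_measurable_continuous_onI w_measurable, of "\<lambda>y. (x, y)"]
  by (simp add: continuous_on_Pair continuous_on_id)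

lemma w_integrable: "integrable lborel (w x)"
proof (rule Bochner_Integration.integrable_bound)
  show "integrable lborel (\<lambda>y. C ^ 6 * (indicator {0<..} y *\<^sub>R (y / (1 + x\<^sup>2 + y\<^sup>2) ^ 3)))"
    using integral_y_over_cube[of x] by (intro integrable_mult_right) (simp add: has_bochner_integral_iff)
  show "AE y in lborel. norm (w x y) \<le> norm (C ^ 6 * (indicator {0<..} y *\<^sub>R (y / (1 + x\<^sup>2 + y\<^sup>2) ^ 3)))"
    using w_bound w_nonneg by (intro AE_I2) (smt (verit) real_norm_def)
qed (use w_measurable_slice in simp)

lemma w_bound_uniform: "w x y \<le> C ^ 6 * (indicator {0<..} y *\<^sub>R (y / (1 + 0\<^sup>2 + y\<^sup>2) ^ 3))"
proof -
  have "y / (1 + x\<^sup>2 + y\<^sup>2) ^ 3 \<le> y / (1 + 0\<^sup>2 + y\<^sup>2) ^ 3" if "0 < y"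
    using that by (intro divide_left_mono power_mono mult_pos_pos zero_less_power one_plus_squares_pos) auto
  then have "C ^ 6 * (indicator {0<..} y *\<^sub>R (y / (1 + x\<^sup>2 + y\<^sup>2) ^ 3))
      \<le> C ^ 6 * (indicator {0<..} y *\<^sub>R (y / (1 + 0\<^sup>2 + y\<^sup>2) ^ 3))"
    using C_pos by (intro mult_left_mono) (auto simp: indicator_def)
  then show ?thesis using w_bound[of x y] by linarith
qed

text \<open>
  The factor \<open>y\<close> makes the extension by zero continuous across the boundary.
\<close>

lemma w_cont: "continuous_on UNIV (w x)"
proof -
  have "isCont (w x) y" for y
  proof -
    consider "0 < y" | "y = 0" | "y < 0" by linarith
    then show ?thesis
    proof cases
      case 1
      have c: "isCont (\<lambda>y. y * h x y ^ 6) y" by (intro continuous_intros DERIV_isCont[OF dy] 1)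
      have "eventually (\<lambda>t. t \<in> {0<..}) (nhds y)"
        using eventually_nhds_in_open[of "{0<..}" y] 1 by simp
      then have "eventually (\<lambda>t. t * h x t ^ 6 = w x t) (nhds y)"
        by (rule eventually_mono) (simp add: w_def)
      from isCont_cong[OF this] c show ?thesis by simp
    next
      case 2
      have "norm (w x t) \<le> C ^ 6 * \<bar>t\<bar>" for t
      proof (cases "0 < t")
        case True
        have d: "1 \<le> (1 + 0\<^sup>2 + t\<^sup>2) ^ 3" by (intro one_le_power) simp
        have "t / (1 + 0\<^sup>2 + t\<^sup>2) ^ 3 \<le> t"
          using frac_le[OF less_imp_le[OF True] order_refl zero_less_one d] by (simp only: div_by_1)
        then have "C ^ 6 * (t / (1 + 0\<^sup>2 + t\<^sup>2) ^ 3) \<le> C ^ 6 * t"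
          by (rule mult_left_mono[OF _ zero_le_power[OF less_imp_le[OF C_pos]]])
        then have "w x t \<le> C ^ 6 * t" using w_bound_uniform[of x t] True by simp
        with True w_nonneg[of x t] show ?thesis by (simp only: real_norm_def abs_of_nonneg abs_of_pos)
      next
        case False
        then have "norm (w x t) = 0" by (simp add: w_def)
        with mult_nonneg_nonneg[OF zero_le_power[OF less_imp_le[OF C_pos], of 6] abs_ge_zero[of t]]
        show ?thesis by linarith
      qed
      then have b: "eventually (\<lambda>t. norm (w x t) \<le> C ^ 6 * \<bar>t\<bar>) (at 0)" by (intro always_eventually allI)
      have "((\<lambda>t. C ^ 6 * \<bar>t\<bar>) \<longlongrightarrow> C ^ 6 * \<bar>0\<bar>) (at 0)" by (intro tendsto_intros)
      then have "((w x) \<longlongrightarrow> 0) (at 0)" by (intro Lim_null_comparison[OF b]) simp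
      then show ?thesis using 2 by (simp add: isCont_def w_def)
    next
      case 3
      have "eventually (\<lambda>t. t \<in> {..<0}) (nhds y)"
        using eventually_nhds_in_open[of "{..<0}" y] 3 by simp
      then have "eventually (\<lambda>t. 0 = w x t) (nhds y)"
        by (rule eventually_mono) (simp add: w_def)
      then show ?thesis using isCont_cong[of "\<lambda>_. 0" "w x" y] by simp
    qed
  qed
  then show ?thesis by (simp add: continuous_on_eq_continuous_at)
qed

lemma m_pos: "0 < m x"
  using tail_strict[OF w_integrable w_cont w_nonneg w_pos, of 1 x] by (simp add: m_def)

lemma m_bound: "m x \<le> C ^ 6 * (1 / (4 * (1 + x\<^sup>2)\<^sup>2))"
proof -
  have k: "integrable lborel (\<lambda>y. indicator {0<..} y *\<^sub>R (y / (1 + x\<^sup>2 + y\<^sup>2) ^ 3))"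
    "(\<integral>y. indicator {0<..} y *\<^sub>R (y / (1 + x\<^sup>2 + y\<^sup>2) ^ 3) \<partial>lborel) = 1 / (4 * (1 + x\<^sup>2)\<^sup>2)"
    using integral_y_over_cube[of x] by (auto simp: has_bochner_integral_iff)
  have "m x \<le> (\<integral>y. C ^ 6 * (indicator {0<..} y *\<^sub>R (y / (1 + x\<^sup>2 + y\<^sup>2) ^ 3)) \<partial>lborel)"
    unfolding m_def by (intro integral_mono w_integrable integrable_mult_right k(1) w_bound)
  also have "\<dots> = C ^ 6 * (1 / (4 * (1 + x\<^sup>2)\<^sup>2))" by (simp only: k(2) integral_mult_right_zero)
  finally show ?thesis .
qed

lemma m_cont: "continuous_on UNIV m"
proof -
  have "isCont m x" for x
    unfolding continuous_at_sequentially
  proof (intro allI impI)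
    fix u assume u: "u \<longlonglongrightarrow> x"
    have "(\<lambda>n. \<integral>y. w (u n) y \<partial>lborel) \<longlonglongrightarrow> (\<integral>y. w x y \<partial>lborel)"
    proof (rule integral_dominated_convergence
        [where w = "\<lambda>y. C ^ 6 * (indicator {0<..} y *\<^sub>R (y / (1 + 0\<^sup>2 + y\<^sup>2) ^ 3))"])
      show "integrable lborel (\<lambda>y. C ^ 6 * (indicator {0<..} y *\<^sub>R (y / (1 + 0\<^sup>2 + y\<^sup>2) ^ 3)))"
        using integral_y_over_cube[of 0] by (intro integrable_mult_right) (simp add: has_bochner_integral_iff)
      show "AE y in lborel. norm (w (u n) y) \<le> C ^ 6 * (indicator {0<..} y *\<^sub>R (y / (1 + 0\<^sup>2 + y\<^sup>2) ^ 3))" for n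
        using w_bound_uniform w_nonneg by (intro AE_I2) (smt (verit) real_norm_def)
      have "(\<lambda>n. w (u n) y) \<longlonglongrightarrow> w x y" for y
      proof (cases "0 < y")
        case True
        then have "isCont (\<lambda>x. w x y) x"
          unfolding w_def using DERIV_isCont[OF dx[OF True]] by (auto intro!: continuous_intros)
        then show ?thesis by (rule isCont_tendsto_compose[OF _ u])
      qed (simp add: w_def)
      then show "AE y in lborel. (\<lambda>n. w (u n) y) \<longlonglongrightarrow> w x y" by simp
    qed (use w_measurable_slice in simp_all)
    then show "(m \<circ> u) \<longlonglongrightarrow> m x" by (simp add: m_def comp_def)
  qed
  then show ?thesis by (simp add: continuous_on_eq_continuous_at)
qed

lemma m_integrable: "integrable lborel m"
proof (rule Bochner_Integration.integrable_bound)
  show "integrable lborel (\<lambda>x. C ^ 6 * (1 / (4 * (1 + x\<^sup>2)\<^sup>2)))"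
    using integral_inverse_square has_bochner_integral_iff[of lborel "\<lambda>s::real. 1 / (1 + s\<^sup>2)\<^sup>2"]
      integrable_mult_right[of "C ^ 6 / 4" lborel "\<lambda>s::real. 1 / (1 + s\<^sup>2)\<^sup>2"] by simp
  show "AE x in lborel. norm (m x) \<le> norm (C ^ 6 * (1 / (4 * (1 + x\<^sup>2)\<^sup>2)))"
    using m_bound m_pos by (intro AE_I2) (smt (verit) real_norm_def)
qed (use m_cont in \<open>auto intro: borel_measurable_continuous_onI\<close>)

lemma M_pos: "0 < M"
  using tail_strict[OF m_integrable m_cont less_imp_le[OF m_pos] m_pos, of 0] by (simp add: M_def)

lemma w_integral: "has_bochner_integral lborel (\<lambda>z. w (fst z) (snd z)) M"
  by (rule has_bochner_integral_iterated[where g = m])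
    (auto simp: w_measurable w_nonneg has_bochner_integral_iff w_integrable m_integrable M_def m_def[symmetric])

lemma R_bounds: assumes "0 < y" shows "0 < R x y" "R x y < 1"
  using tail_strict[OF w_integrable w_cont w_nonneg w_pos[OF assms], of x] m_pos[of x]
  by (simp_all add: R_def m_def)

lemma R_derivative: "(R x has_real_derivative - w x y / m x) (at y)"
  unfolding R_def by (rule DERIV_cdivide[OF tail_has_derivative[OF w_integrable w_cont]])

lemma R_at_top: "(R x \<longlongrightarrow> 0) at_top"
  unfolding R_def using tendsto_divide[OF tail_at_top[OF w_integrable] tendsto_const, of "m x" x] m_pos[of x]
  by simp

lemma R_at_0: "(R x \<longlongrightarrow> 1) (at_right 0)"
proof -
  have "(LINT t:{0<..}|lborel. w x t) = m x"
    unfolding set_lebesgue_integral_def m_def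
    by (intro Bochner_Integration.integral_cong) (auto simp: w_def)
  then have "R x 0 = 1" using m_pos[of x] by (simp add: R_def)
  moreover have "isCont (R x) 0" by (rule DERIV_isCont[OF R_derivative])
  ultimately have "(R x \<longlongrightarrow> 1) (at 0)" by (simp add: isCont_def)
  then show ?thesis by (rule tendsto_mono[rotated]) (simp add: at_le)
qed

lemma X_arg_bounds:
  "- (pi / 2) < pi * (1 / 2 - (LINT t:{x<..}|lborel. m t) / M)"
  "pi * (1 / 2 - (LINT t:{x<..}|lborel. m t) / M) < pi / 2"
proof -
  have t: "0 < (LINT t:{x<..}|lborel. m t) / M" "(LINT t:{x<..}|lborel. m t) / M < 1"
    using tail_strict[OF m_integrable m_cont less_imp_le[OF m_pos] m_pos, of x] M_pos
    by (simp_all add: M_def)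
  define r where "r = (LINT t:{x<..}|lborel. m t) / M"
  have "pi * (- (1 / 2)) < pi * (1 / 2 - r)" "pi * (1 / 2 - r) < pi * (1 / 2)"
    using t by (intro mult_strict_left_mono; simp add: r_def[symmetric])+
  then show "- (pi / 2) < pi * (1 / 2 - (LINT t:{x<..}|lborel. m t) / M)"
    "pi * (1 / 2 - (LINT t:{x<..}|lborel. m t) / M) < pi / 2" by (simp_all add: r_def)
qed

text \<open>
  The Monge--Ampere equation of the horizontal rearrangement.
\<close>

lemma X_derivative: "(X has_real_derivative (1 + (X x)\<^sup>2)\<^sup>2 / 2 * (pi * m x / M)) (at x)"
proof -
  have N: "((\<lambda>x. pi * (1 / 2 - (LINT t:{x<..}|lborel. m t) / M)) has_real_derivative pi * m x / M) (at x)"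
    using DERIV_cmult[OF DERIV_diff[OF DERIV_const[of "1/2"]
        DERIV_cdivide[OF tail_has_derivative[OF m_integrable m_cont], of M]], of pi x] by simp
  from DERIV_chain2[where f = angle_cdf_inv
      and g = "\<lambda>x. pi * (1 / 2 - (LINT t:{x<..}|lborel. m t) / M)" and x = x,
      OF angle_cdf_inv_derivative[OF X_arg_bounds(1)[of x] X_arg_bounds(2)[of x]] N]
  show ?thesis by (simp only: X_def[abs_def])
qed

lemma X_at_top: "filterlim X at_top at_top"
  unfolding X_def
proof (rule angle_cdf_inv_at_top[OF _ X_arg_bounds])
  have "((\<lambda>x. pi * (1 / 2 - (LINT t:{x<..}|lborel. m t) / M)) \<longlongrightarrow> pi * (1 / 2 - 0 / M)) at_top"
    using M_pos by (intro tendsto_intros tail_at_top m_integrable) auto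
  then show "((\<lambda>x. pi * (1 / 2 - (LINT t:{x<..}|lborel. m t) / M)) \<longlongrightarrow> pi / 2) at_top" by simp
qed

lemma X_at_bot: "filterlim X at_bot at_bot"
  unfolding X_def
proof (rule angle_cdf_inv_at_bot[OF _ X_arg_bounds])
  have "((\<lambda>x. pi * (1 / 2 - (LINT t:{x<..}|lborel. m t) / M)) \<longlongrightarrow> pi * (1 / 2 - M / M)) at_bot"
    using M_pos by (intro tendsto_intros tail_at_bot[OF m_integrable, folded M_def]) auto
  then show "((\<lambda>x. pi * (1 / 2 - (LINT t:{x<..}|lborel. m t) / M)) \<longlongrightarrow> - (pi / 2)) at_bot"
    using M_pos by simp
qed

lemma X_cont: "continuous_on UNIV X"
  using DERIV_isCont[OF X_derivative] by (simp add: continuous_on_eq_continuous_at)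

text \<open>
  The second moment of the image of \<open>m\<close> under \<open>X\<close>, computed by pulling back an antiderivative of
  \<open>s\<^sup>2 / (1 + s\<^sup>2)\<^sup>2\<close>.
\<close>

lemma m_X2_integral: "has_bochner_integral lborel (\<lambda>x. m x * (X x)\<^sup>2) M"
proof -
  define G :: "real \<Rightarrow> real" where "G s = (arctan s - s / (1 + s\<^sup>2)) / 2" for s
  have G: "(G has_real_derivative s\<^sup>2 / (1 + s\<^sup>2)\<^sup>2) (at s)" for s
  proof -
    have p: "1 + s\<^sup>2 \<noteq> 0" by (metis add_pos_nonneg less_irrefl zero_le_power2 zero_less_one)
    then have "(G has_real_derivative (1 / (1 + s\<^sup>2) - (1 * (1 + s\<^sup>2) - s * (2 * s)) / ((1 + s\<^sup>2) * (1 + s\<^sup>2))) / 2) (at s)"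
      unfolding G_def by (auto intro!: derivative_eq_intros simp: inverse_eq_divide)
    also have "(1 / (1 + s\<^sup>2) - (1 * (1 + s\<^sup>2) - s * (2 * s)) / ((1 + s\<^sup>2) * (1 + s\<^sup>2))) / 2 = s\<^sup>2 / (1 + s\<^sup>2)\<^sup>2"
      using p by (simp add: divide_simps) (simp add: power2_eq_square algebra_simps)
    finally show ?thesis .
  qed
  have G_lim: "(G \<longlongrightarrow> pi / 4) at_top" "(G \<longlongrightarrow> - (pi / 4)) at_bot"
    unfolding G_def by real_asymp+
  have "has_bochner_integral lborel (\<lambda>x. m x * (X x)\<^sup>2) (2 * M / pi * (pi / 4) - 2 * M / pi * (- (pi / 4)))"
  proof (rule FTC_nonneg_line)
    show "((\<lambda>x. 2 * M / pi * G (X x)) has_real_derivative m x * (X x)\<^sup>2) (at x)" for x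
    proof -
      have p: "1 + (X x)\<^sup>2 \<noteq> 0" by (metis add_pos_nonneg less_irrefl zero_le_power2 zero_less_one)
      have "2 * M / pi * ((X x)\<^sup>2 / (1 + (X x)\<^sup>2)\<^sup>2 * ((1 + (X x)\<^sup>2)\<^sup>2 / 2 * (pi * m x / M))) = m x * (X x)\<^sup>2"
        using p M_pos by (simp add: field_simps)
      with DERIV_cmult[OF DERIV_chain2[OF G X_derivative[of x]], of "2 * M / pi"] show ?thesis by simp
    qed
    show "((\<lambda>x. 2 * M / pi * G (X x)) \<longlongrightarrow> 2 * M / pi * (pi / 4)) at_top"
      by (intro tendsto_mult_left filterlim_compose[OF G_lim(1) X_at_top])
    show "((\<lambda>x. 2 * M / pi * G (X x)) \<longlongrightarrow> 2 * M / pi * (- (pi / 4))) at_bot"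
      by (intro tendsto_mult_left filterlim_compose[OF G_lim(2) X_at_bot])
    show "continuous_on UNIV (\<lambda>x. m x * (X x)\<^sup>2)" by (intro continuous_intros m_cont X_cont)
    show "0 \<le> m x * (X x)\<^sup>2" for x using less_imp_le[OF m_pos[of x]] by simp
  qed
  then show ?thesis by simp
qed

lemma R_sqrt_gt: assumes "0 < y" shows "1 < 1 / sqrt (R x y)"
  using R_bounds[OF assms, of x] by simp

lemma T_pos: assumes "0 < y" shows "0 < T x y"
  using R_sqrt_gt[OF assms, of x] unfolding T_def
  by (intro iffD2[OF real_sqrt_gt_0_iff] mult_pos_pos) (auto simp: add_pos_nonneg)

lemma T_square: assumes "0 < y" shows "(T x y)\<^sup>2 = (1 + (X x)\<^sup>2) * (1 / sqrt (R x y) - 1)"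
  unfolding T_def using R_sqrt_gt[OF assms, of x]
  by (intro real_sqrt_pow2 mult_nonneg_nonneg) auto

text \<open>
  The vertical derivative of \<open>T\<close>; see \<open>T_derivative\<close>.
\<close>

definition Ty :: "real \<Rightarrow> real \<Rightarrow> real" where
  "Ty x y = (1 + (X x)\<^sup>2) * w x y / (4 * m x * T x y * (R x y * sqrt (R x y)))"

lemma T_derivative: assumes "0 < y" shows "(T x has_real_derivative Ty x y) (at y)"
proof -
  have r: "0 < R x y" and q: "0 < (1 + (X x)\<^sup>2) * (1 / sqrt (R x y) - 1)"
    using R_bounds[OF assms, of x] T_pos[OF assms, of x] by (auto simp: T_def)
  have "((\<lambda>r. 1 / sqrt r) has_real_derivative - (1 / (2 * r * sqrt r))) (at r)" if "0 < r" for r :: real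
    using that by (auto intro!: derivative_eq_intros simp: field_simps)
  from DERIV_chain2[OF this[OF r] R_derivative]
  have "((\<lambda>y. 1 / sqrt (R x y)) has_real_derivative - (1 / (2 * R x y * sqrt (R x y))) * (- w x y / m x)) (at y)" .
  from DERIV_cmult[OF DERIV_diff[OF this DERIV_const[of 1]], of "1 + (X x)\<^sup>2"]
  have "((\<lambda>y. (1 + (X x)\<^sup>2) * (1 / sqrt (R x y) - 1)) has_real_derivative
    (1 + (X x)\<^sup>2) * (- (1 / (2 * R x y * sqrt (R x y))) * (- w x y / m x) - 0)) (at y)" .
  from DERIV_chain2[OF DERIV_real_sqrt[OF q] this]
  have "(T x has_real_derivative inverse (T x y) / 2 *
     ((1 + (X x)\<^sup>2) * (- (1 / (2 * R x y * sqrt (R x y))) * (- w x y / m x) - 0))) (at y)"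
    by (simp add: T_def [abs_def])
  also have "inverse (T x y) / 2 * ((1 + (X x)\<^sup>2) * (- (1 / (2 * R x y * sqrt (R x y))) * (- w x y / m x) - 0)) = Ty x y"
    by (simp add: Ty_def field_simps)
  finally show ?thesis .
qed

text \<open>
  In terms of the tail \<open>R\<close>, this is the integral of \<open>1 / sqrt r - 1\<close> over \<open>0 < r < 1\<close>, which equals 1.
\<close>

lemma w_T2_slice: "has_bochner_integral lborel (\<lambda>y. w x y * (T x y)\<^sup>2) (m x + m x * (X x)\<^sup>2)"
proof -
  let ?A = "m x * (1 + (X x)\<^sup>2)"
  have "has_bochner_integral lborel (\<lambda>y. indicator {0<..} y *\<^sub>R (w x y * (T x y)\<^sup>2)) (0 - - ?A)"
  proof (rule FTC_nonneg_half_line)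
    show "((\<lambda>y. - ?A * (2 * sqrt (R x y) - R x y)) has_real_derivative w x y * (T x y)\<^sup>2) (at y)" if "0 < y" for y
    proof -
      have r: "0 < R x y" using R_bounds[OF that] by simp
      have "((\<lambda>r. 2 * sqrt r - r) has_real_derivative 1 / sqrt (R x y) - 1) (at (R x y))"
        using r by (auto intro!: derivative_eq_intros simp: field_simps)
      from DERIV_cmult[OF DERIV_chain2[OF this R_derivative], of "- ?A"]
      have "((\<lambda>y. - ?A * (2 * sqrt (R x y) - R x y)) has_real_derivative
        - ?A * ((1 / sqrt (R x y) - 1) * (- w x y / m x))) (at y)" .
      also have "- ?A * ((1 / sqrt (R x y) - 1) * (- w x y / m x)) = w x y * (T x y)\<^sup>2"
        unfolding T_square[OF that] using m_pos[of x] by (simp add: mult_ac)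
      finally show ?thesis .
    qed
    show "continuous_on {0<..} (\<lambda>y. w x y * (T x y)\<^sup>2)"
      using DERIV_isCont[OF T_derivative]
      by (intro continuous_intros continuous_on_subset[OF w_cont] continuous_at_imp_continuous_on) auto
    have "((\<lambda>y. - ?A * (2 * sqrt (R x y) - R x y)) \<longlongrightarrow> - ?A * (2 * sqrt 1 - 1)) (at_right 0)"
      by (intro tendsto_intros R_at_0)
    then show "((\<lambda>y. - ?A * (2 * sqrt (R x y) - R x y)) \<longlongrightarrow> - ?A) (at_right 0)" by simp
    have "((\<lambda>y. - ?A * (2 * sqrt (R x y) - R x y)) \<longlongrightarrow> - ?A * (2 * sqrt 0 - 0)) at_top"
      by (intro tendsto_intros R_at_top)
    then show "((\<lambda>y. - ?A * (2 * sqrt (R x y) - R x y)) \<longlongrightarrow> 0) at_top" by simp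
  qed (use w_nonneg in auto)
  moreover have "(\<lambda>y. indicator {0<..} y *\<^sub>R (w x y * (T x y)\<^sup>2)) = (\<lambda>y. w x y * (T x y)\<^sup>2)"
    by (auto simp: w_def indicator_def)
  ultimately show ?thesis by (simp add: algebra_simps)
qed

end

lemma young_inequality:
  fixes a b k :: real
  assumes "0 < k"
  shows "\<bar>2 * a * b\<bar> \<le> k * a\<^sup>2 + b\<^sup>2 / k"
proof -
  have "0 \<le> (k * \<bar>a\<bar> - \<bar>b\<bar>)\<^sup>2 / k" using assms by simp
  also have "\<dots> = k * a\<^sup>2 + b\<^sup>2 / k - \<bar>2 * a * b\<bar>"
    using assms by (simp add: power2_diff power_mult_distrib abs_mult diff_divide_distrib add_divide_distrib)
      (simp add: power2_eq_square field_simps)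
  finally show ?thesis by simp
qed

context half_plane_profile
begin

lemma X_measurable: "(\<lambda>z :: real \<times> real. X (fst z)) \<in> borel_measurable borel"
  by (rule borel_measurable_continuous_onI)
    (use continuous_on_compose2[OF X_cont, of UNIV fst] in \<open>simp add: continuous_on_fst\<close>)

lemma m_measurable: "(\<lambda>z :: real \<times> real. m (fst z)) \<in> borel_measurable borel"
  by (rule borel_measurable_continuous_onI)
    (use continuous_on_compose2[OF m_cont, of UNIV fst] in \<open>simp add: continuous_on_fst\<close>)

text \<open>
  Joint measurability of the tails: an integral depending on the parameter \<open>(x, y)\<close>.
\<close>

lemma R_measurable: "(\<lambda>z. R (fst z) (snd z)) \<in> borel_measurable borel"
proof -
  have "(\<lambda>(z :: real \<times> real, t). indicator {snd z<..} t *\<^sub>R w (fst z) t) \<in> borel_measurable (borel \<Otimes>\<^sub>M lborel)"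
  proof -
    have [measurable]: "(\<lambda>p :: (real \<times> real) \<times> real. w (fst (fst p)) (snd p)) \<in> borel_measurable borel"
      using measurable_compose[OF borel_measurable_continuous_onI w_measurable,
          of "\<lambda>p :: (real \<times> real) \<times> real. (fst (fst p), snd p)"]
      by (simp add: continuous_intros)
    have "open {p :: (real \<times> real) \<times> real. snd (fst p) < snd p}"
      by (intro open_Collect_less continuous_intros)
    then have [measurable]: "(\<lambda>p :: (real \<times> real) \<times> real. indicator {p. snd (fst p) < snd p} p :: real) \<in> borel_measurable borel"
      by simp
    have "(\<lambda>p :: (real \<times> real) \<times> real. indicator {p. snd (fst p) < snd p} p *\<^sub>R w (fst (fst p)) (snd p)) \<in> borel_measurable borel"
      by measurable
    also have "(\<lambda>p :: (real \<times> real) \<times> real. indicator {p. snd (fst p) < snd p} p *\<^sub>R w (fst (fst p)) (snd p))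
        = (\<lambda>(z, t). indicator {snd z<..} t *\<^sub>R w (fst z) t)"
      by (auto simp: indicator_def)
    finally show ?thesis
      by (simp add: measurable_cong_sets[OF sets_pair_measure_cong[OF refl sets_lborel] refl] borel_prod)
  qed
  from lborel.borel_measurable_lebesgue_integral[OF this]
  show ?thesis unfolding R_def set_lebesgue_integral_def
    by (intro borel_measurable_divide m_measurable) (simp add: case_prod_unfold)
qed

lemma T_measurable: "(\<lambda>z. T (fst z) (snd z)) \<in> borel_measurable borel"
  unfolding T_def using X_measurable R_measurable by measurable

lemma w_X2_integral: "has_bochner_integral lborel (\<lambda>z. w (fst z) (snd z) * (X (fst z))\<^sup>2) M"
proof (rule has_bochner_integral_iterated[OF _ _ _ m_X2_integral])
  show "(\<lambda>z. w (fst z) (snd z) * (X (fst z))\<^sup>2) \<in> borel_measurable borel"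
    using w_measurable X_measurable by measurable
  show "has_bochner_integral lborel (\<lambda>y. w (fst (x, y)) (snd (x, y)) * (X (fst (x, y)))\<^sup>2) (m x * (X x)\<^sup>2)" for x
    using w_integrable[of x] by (simp add: has_bochner_integral_iff m_def)
qed (simp add: w_nonneg)

lemma w_T2_integral: "has_bochner_integral lborel (\<lambda>z. w (fst z) (snd z) * (T (fst z) (snd z))\<^sup>2) (2 * M)"
proof (rule has_bochner_integral_iterated)
  show "(\<lambda>z. w (fst z) (snd z) * (T (fst z) (snd z))\<^sup>2) \<in> borel_measurable borel"
    using w_measurable T_measurable by measurable
  show "has_bochner_integral lborel (\<lambda>y. w (fst (x, y)) (snd (x, y)) * (T (fst (x, y)) (snd (x, y)))\<^sup>2)
      (m x + m x * (X x)\<^sup>2)" for x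
    using w_T2_slice[of x] by simp
  show "has_bochner_integral lborel (\<lambda>x. m x + m x * (X x)\<^sup>2) (2 * M)"
    using has_bochner_integral_add[OF _ m_X2_integral, of m M] m_integrable
    by (simp add: has_bochner_integral_iff M_def[symmetric])
qed (simp add: w_nonneg)

text \<open>
  The target density is \<open>kappa ^ 3 * y * (1 + x\<^sup>2 + y\<^sup>2) ^ (-3)\<close>; since the integral of
  \<open>y * (1 + x\<^sup>2 + y\<^sup>2) ^ (-3)\<close> over the half-plane is \<open>pi / 8\<close>, this determines \<open>kappa\<close>.
\<close>

definition kappa :: real where "kappa = (8 * M / pi) powr (1 / 3)"

lemma kappa_pos: "0 < kappa"
  using M_pos by (simp add: kappa_def)

lemma kappa_cube: "kappa ^ 3 = 8 * M / pi"
proof -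
  have p: "0 < 8 * M / pi" using M_pos by simp
  have "kappa ^ 3 = kappa powr real 3" by (rule powr_realpow[OF kappa_pos, symmetric])
  also have "\<dots> = (8 * M / pi) powr 1" unfolding kappa_def powr_powr by simp
  also have "\<dots> = 8 * M / pi" by (rule powr_one[OF less_imp_le[OF p]])
  finally show ?thesis .
qed

text \<open>
  The derivative of \<open>X\<close>; see \<open>X_derivative\<close>.
\<close>

definition Xx :: "real \<Rightarrow> real" where "Xx x = (1 + (X x)\<^sup>2)\<^sup>2 / 2 * (pi * m x / M)"

text \<open>
  The transport equation says that \<open>Xx * Ty * (T / y)\<close> equals \<open>h ^ 6\<close> divided by the target profile at the image
  point, which is a perfect cube. The arithmetic-geometric mean inequality turns this product into the
  sum \<open>Xx + Ty + T / y\<close>, which is the divergence of \<open>(X, T)\<close> for the weight \<open>y\<close>. The horizontal derivative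
  of \<open>T\<close> does not enter because the map is triangular.
\<close>

lemma transport_amgm:
  assumes "0 < y"
  shows "3 / kappa * (w x y + w x y * (X x)\<^sup>2 + w x y * (T x y)\<^sup>2)
    \<le> y * h x y ^ 4 * Xx x + h x y ^ 4 * (T x y + y * Ty x y)"
proof -
  let ?a = "1 + (X x)\<^sup>2"
  define r where "r = sqrt (R x y)"
  have r: "0 < r" and R: "R x y = r\<^sup>2" using R_bounds[OF assms, of x] by (auto simp: r_def)
  have a: "0 < ?a" by (simp add: add_pos_nonneg)
  note [simp] = kappa_pos[THEN less_imp_neq, THEN not_sym]
  have h: "0 < h x y" by (rule pos[OF assms])
  have t: "0 < T x y" by (rule T_pos[OF assms])
  have m: "0 < m x" by (rule m_pos)
  \<comment> \<open>everything is expressed through \<open>kappa\<close> and \<open>r = sqrt R\<close>, so that the product is visibly a cube\<close>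
  have M: "M = pi * kappa ^ 3 / 8" using kappa_cube by simp
  have "3 * (?a * (h x y)\<^sup>2 / (kappa * r)) \<le> Xx x + Ty x y + T x y / y"
  proof (rule amgm3)
    have "Xx x = 4 * m x * ?a\<^sup>2 / kappa ^ 3"
      unfolding Xx_def M by (simp add: field_simps)
    moreover have "Ty x y = ?a * (y * h x y ^ 6) / (4 * m x * T x y * (r\<^sup>2 * r))"
      unfolding Ty_def R using assms r by (simp add: w_def)
    ultimately have "Xx x * Ty x y * (T x y / y)
        = (4 * m x * ?a\<^sup>2 / kappa ^ 3) * (?a * (y * h x y ^ 6) / (4 * m x * T x y * (r\<^sup>2 * r))) * (T x y / y)"
      by simp
    also have "\<dots> = ?a ^ 3 * h x y ^ 6 / (kappa ^ 3 * r ^ 3)"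
      using m t assms by (simp add: power2_eq_square power3_eq_cube)
    also have "\<dots> = (?a * (h x y)\<^sup>2 / (kappa * r)) ^ 3"
      by (simp add: power_divide power_mult_distrib flip: power_mult)
    finally show "Xx x * Ty x y * (T x y / y) = (?a * (h x y)\<^sup>2 / (kappa * r)) ^ 3" .
    show "0 \<le> Xx x" unfolding Xx_def using m M_pos by simp
    show "0 \<le> Ty x y" unfolding Ty_def R using m t r a w_nonneg[of x y] by (intro divide_nonneg_nonneg mult_nonneg_nonneg) auto
    show "0 \<le> T x y / y" using t assms by simp
    show "0 \<le> ?a * (h x y)\<^sup>2 / (kappa * r)" using a r kappa_pos by (intro divide_nonneg_nonneg mult_nonneg_nonneg) auto
  qed
  from mult_left_mono[OF this, of "y * h x y ^ 4"] assms h
  have "y * h x y ^ 4 * (3 * (?a * (h x y)\<^sup>2 / (kappa * r))) \<le> y * h x y ^ 4 * (Xx x + Ty x y + T x y / y)" by simp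
  also have "y * h x y ^ 4 * (Xx x + Ty x y + T x y / y) = y * h x y ^ 4 * Xx x + h x y ^ 4 * (T x y + y * Ty x y)"
    using assms by (simp add: field_simps)
  also have "y * h x y ^ 4 * (3 * (?a * (h x y)\<^sup>2 / (kappa * r))) = 3 / kappa * (w x y * (?a / r))"
    using assms by (simp add: w_def power_add[of _ 4 2, simplified])
  also have "?a / r = 1 + (X x)\<^sup>2 + (T x y)\<^sup>2"
    unfolding T_square[OF assms] r_def by (simp add: algebra_simps add_divide_distrib)
  finally show ?thesis by (simp add: algebra_simps)
qed

lemma h_le_C: assumes "0 < y" shows "y * (h x y)\<^sup>2 \<le> C\<^sup>2"
proof -
  have "2 * (1 * y) \<le> 1\<^sup>2 + y\<^sup>2" using sum_squares_bound[of 1 y] by simp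
  then have "y \<le> 1 + x\<^sup>2 + y\<^sup>2" using assms zero_le_power2[of x] by (smt (verit) power_one)
  have "y * (h x y)\<^sup>2 \<le> y * (C\<^sup>2 / (1 + x\<^sup>2 + y\<^sup>2))" using assms h_bound by (intro mult_left_mono) auto
  also have "\<dots> = C\<^sup>2 * (y / (1 + x\<^sup>2 + y\<^sup>2))" by simp
  also have "\<dots> \<le> C\<^sup>2 * 1"
    using \<open>y \<le> 1 + x\<^sup>2 + y\<^sup>2\<close> one_plus_squares_pos[of x y] by (intro mult_left_mono) (auto simp: divide_le_eq_1)
  finally show ?thesis by simp
qed

text \<open>
  Controls the boundary terms of both integrations by parts, with \<open>S\<close> being \<open>X\<close> or \<open>T\<close>, by the integrable
  second moments.
\<close>

lemma boundary_square:
  assumes "0 < y"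
  shows "(y * h x y ^ 4 * S)\<^sup>2 \<le> C\<^sup>2 * (w x y * S\<^sup>2)"
proof -
  have "(y * h x y ^ 4 * S)\<^sup>2 = (y * (h x y)\<^sup>2) * (w x y * S\<^sup>2)"
    using assms by (simp add: w_def power_mult_distrib power2_eq_square eval_nat_numeral mult_ac)
  also have "\<dots> \<le> C\<^sup>2 * (w x y * S\<^sup>2)"
    using h_le_C[OF assms] w_nonneg by (intro mult_right_mono) auto
  finally show ?thesis .
qed

text \<open>
  \<open>Kx\<close> and \<open>Ky\<close> are the horizontal and vertical parts of \<open>y * h ^ 4\<close> times the weighted divergence of the
  transport map; \<open>Lx\<close> and \<open>Ly\<close> are the corresponding terms in which the derivative falls on \<open>h ^ 4\<close>; \<open>Ex\<close> and
  \<open>Ey\<close> are the two parts of the energy density.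
\<close>

definition Kx :: "real \<times> real \<Rightarrow> real" where
  "Kx z = (if 0 < snd z then snd z * h (fst z) (snd z) ^ 4 * Xx (fst z) else 0)"

definition Ky :: "real \<times> real \<Rightarrow> real" where
  "Ky z = (if 0 < snd z then h (fst z) (snd z) ^ 4 * (T (fst z) (snd z) + snd z * Ty (fst z) (snd z)) else 0)"

definition Lx :: "real \<times> real \<Rightarrow> real" where
  "Lx z = (if 0 < snd z then 4 * snd z * h (fst z) (snd z) ^ 3 * hx (fst z) (snd z) else 0) * X (fst z)"

definition Ly :: "real \<times> real \<Rightarrow> real" where
  "Ly z = (if 0 < snd z then 4 * snd z * h (fst z) (snd z) ^ 3 * hy (fst z) (snd z) else 0) * T (fst z) (snd z)"

definition Ex :: "real \<times> real \<Rightarrow> real" where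
  "Ex z = (if 0 < snd z then snd z * (hx (fst z) (snd z))\<^sup>2 else 0)"

definition Ey :: "real \<times> real \<Rightarrow> real" where
  "Ey z = (if 0 < snd z then snd z * (hy (fst z) (snd z))\<^sup>2 else 0)"

lemma Xx_measurable: "(\<lambda>z :: real \<times> real. Xx (fst z)) \<in> borel_measurable borel"
  unfolding Xx_def using X_measurable m_measurable by measurable

lemma Ty_measurable: "(\<lambda>z. Ty (fst z) (snd z)) \<in> borel_measurable borel"
  unfolding Ty_def using X_measurable m_measurable w_measurable T_measurable R_measurable by measurable

lemma Kx_measurable: "Kx \<in> borel_measurable borel"
proof -
  have "(\<lambda>z. (if 0 < snd z then snd z * h (fst z) (snd z) ^ 4 else 0) * Xx (fst z)) \<in> borel_measurable borel"
    using cont by (intro borel_measurable_times Xx_measurable borel_measurable_half_plane continuous_intros)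
  also have "(\<lambda>z. (if 0 < snd z then snd z * h (fst z) (snd z) ^ 4 else 0) * Xx (fst z)) = Kx"
    by (auto simp: Kx_def)
  finally show ?thesis .
qed

lemma Ky_measurable: "Ky \<in> borel_measurable borel"
proof -
  have "(\<lambda>z. (if 0 < snd z then h (fst z) (snd z) ^ 4 else 0) * T (fst z) (snd z)
      + (if 0 < snd z then h (fst z) (snd z) ^ 4 * snd z else 0) * Ty (fst z) (snd z)) \<in> borel_measurable borel"
    using cont by (intro borel_measurable_add borel_measurable_times T_measurable Ty_measurable
        borel_measurable_half_plane continuous_intros)
  also have "(\<lambda>z. (if 0 < snd z then h (fst z) (snd z) ^ 4 else 0) * T (fst z) (snd z)
      + (if 0 < snd z then h (fst z) (snd z) ^ 4 * snd z else 0) * Ty (fst z) (snd z)) = Ky"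
    by (auto simp: Ky_def algebra_simps)
  finally show ?thesis .
qed

lemma Lx_measurable: "Lx \<in> borel_measurable borel"
  unfolding Lx_def using cont
  by (intro borel_measurable_times X_measurable borel_measurable_half_plane continuous_intros)

lemma Ly_measurable: "Ly \<in> borel_measurable borel"
  unfolding Ly_def using cont
  by (intro borel_measurable_times T_measurable borel_measurable_half_plane continuous_intros)

lemma Ex_measurable: "Ex \<in> borel_measurable borel"
  unfolding Ex_def[abs_def] using cont by (intro borel_measurable_half_plane continuous_intros)

lemma Ey_measurable: "Ey \<in> borel_measurable borel"
  unfolding Ey_def[abs_def] using cont by (intro borel_measurable_half_plane continuous_intros)

text \<open>
  The weight \<open>kappa\<close> in Young's inequality is the one for which equality holds when \<open>h\<close> is extremal.
\<close>

lemma young_slope: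
  assumes "0 < y"
  shows "\<bar>4 * y * h x y ^ 3 * d * S\<bar> \<le> 2 * kappa * (y * d\<^sup>2) + 2 / kappa * (w x y * S\<^sup>2)"
proof -
  have "\<bar>2 * d * (h x y ^ 3 * S)\<bar> \<le> kappa * d\<^sup>2 + (h x y ^ 3 * S)\<^sup>2 / kappa"
    by (rule young_inequality[OF kappa_pos])
  from mult_left_mono[OF this, of "2 * y"] assms
  have "2 * y * \<bar>2 * d * (h x y ^ 3 * S)\<bar> \<le> 2 * y * (kappa * d\<^sup>2 + (h x y ^ 3 * S)\<^sup>2 / kappa)" by simp
  also have "2 * y * \<bar>2 * d * (h x y ^ 3 * S)\<bar> = \<bar>4 * y * h x y ^ 3 * d * S\<bar>"
    using assms by (simp add: abs_mult)
  also have "2 * y * (kappa * d\<^sup>2 + (h x y ^ 3 * S)\<^sup>2 / kappa) = 2 * kappa * (y * d\<^sup>2) + 2 / kappa * (w x y * S\<^sup>2)"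
    using assms by (simp add: w_def power_mult_distrib algebra_simps flip: power_mult)
  finally show ?thesis .
qed

lemma Lx_bound: "\<bar>Lx z\<bar> \<le> 2 * kappa * Ex z + 2 / kappa * (w (fst z) (snd z) * (X (fst z))\<^sup>2)"
  using young_slope[of "snd z" "fst z" "hx (fst z) (snd z)" "X (fst z)"]
  by (simp add: Lx_def Ex_def w_def)

lemma Ly_bound: "\<bar>Ly z\<bar> \<le> 2 * kappa * Ey z + 2 / kappa * (w (fst z) (snd z) * (T (fst z) (snd z))\<^sup>2)"
  using young_slope[of "snd z" "fst z" "hy (fst z) (snd z)" "T (fst z) (snd z)"]
  by (simp add: Ly_def Ey_def w_def)


lemma h4_derivative_x:
  assumes "0 < y"
  shows "((\<lambda>x. y * h x y ^ 4 * X x) has_real_derivative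
    (y * h x y ^ 4 * Xx x + 4 * y * h x y ^ 3 * hx x y * X x)) (at x)"
proof -
  have "((\<lambda>x. y * h x y ^ 4) has_real_derivative y * (4 * hx x y * h x y ^ 3)) (at x)"
    using DERIV_cmult[OF DERIV_power[OF dx[OF assms], of 4], of y] by (simp add: mult_ac)
  from DERIV_mult[OF this X_derivative] show ?thesis
    by (rule DERIV_cong) (simp add: Xx_def mult_ac)
qed

lemma h4_derivative_y:
  assumes "0 < y"
  shows "((\<lambda>y. y * h x y ^ 4 * T x y) has_real_derivative
    (h x y ^ 4 * (T x y + y * Ty x y) + 4 * y * h x y ^ 3 * hy x y * T x y)) (at y)"
proof -
  have "((\<lambda>y. y * h x y ^ 4) has_real_derivative 1 * h x y ^ 4 + (4 * hy x y * h x y ^ 3) * y) (at y)"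
    using DERIV_mult[OF DERIV_ident DERIV_power[OF dy[OF assms], where n = 4]] by (simp add: mult_ac)
  from DERIV_mult[OF this T_derivative[OF assms]] show ?thesis
    by (rule DERIV_cong) (simp add: algebra_simps)
qed

lemma Xx_cont: "continuous_on UNIV Xx"
  unfolding Xx_def[abs_def] using M_pos by (intro continuous_intros X_cont m_cont) auto

lemma Xx_nonneg: "0 \<le> Xx x"
  unfolding Xx_def using m_pos[of x] M_pos by simp

lemma T_cont: "continuous_on {0<..} (T x)"
  by (intro continuous_at_imp_continuous_on) (auto intro: DERIV_isCont[OF T_derivative])

lemma Ty_nonneg: "0 < y \<Longrightarrow> 0 \<le> Ty x y"
  unfolding Ty_def using m_pos[of x] T_pos[of y x] R_bounds[of y x] w_nonneg[of x y]
  by (intro divide_nonneg_nonneg mult_nonneg_nonneg) auto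

lemma Ty_cont: "continuous_on {0<..} (Ty x)"
proof -
  have "continuous_on {0<..} (R x)"
    by (intro continuous_at_imp_continuous_on) (auto intro: DERIV_isCont[OF R_derivative])
  moreover have "4 * m x * T x y * (R x y * sqrt (R x y)) \<noteq> 0" if "y \<in> {0<..}" for y
    using m_pos[of x] T_pos[of y x] R_bounds[of y x] that by simp
  ultimately show ?thesis
    unfolding Ty_def[abs_def]
    by (intro continuous_intros T_cont continuous_on_subset[OF w_cont]) auto
qed

lemma Lx_integrable:
  assumes "integrable lborel Ex" shows "integrable lborel Lx"
proof (rule Bochner_Integration.integrable_bound)
  show "integrable lborel (\<lambda>z. 2 * kappa * Ex z + 2 / kappa * (w (fst z) (snd z) * (X (fst z))\<^sup>2))"
    using assms w_X2_integral unfolding has_bochner_integral_iff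
    by (intro Bochner_Integration.integrable_add integrable_mult_right) auto
  show "AE z in lborel. norm (Lx z) \<le> norm (2 * kappa * Ex z + 2 / kappa * (w (fst z) (snd z) * (X (fst z))\<^sup>2))"
    using Lx_bound by (intro AE_I2) (metis abs_ge_self order_trans real_norm_def)
qed (use Lx_measurable in simp)

lemma Ly_integrable:
  assumes "integrable lborel Ey" shows "integrable lborel Ly"
proof (rule Bochner_Integration.integrable_bound)
  show "integrable lborel (\<lambda>z. 2 * kappa * Ey z + 2 / kappa * (w (fst z) (snd z) * (T (fst z) (snd z))\<^sup>2))"
    using assms w_T2_integral unfolding has_bochner_integral_iff
    by (intro Bochner_Integration.integrable_add integrable_mult_right) auto
  show "AE z in lborel. norm (Ly z) \<le> norm (2 * kappa * Ey z + 2 / kappa * (w (fst z) (snd z) * (T (fst z) (snd z))\<^sup>2))"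
    using Ly_bound by (intro AE_I2) (metis abs_ge_self order_trans real_norm_def)
qed (use Ly_measurable in simp)

lemma Kx_le_Lx:
  assumes "integrable lborel Ex"
  shows "(\<integral>\<^sup>+z. ennreal (Kx z) \<partial>lborel) \<le> ennreal (- (\<integral>z. Lx z \<partial>lborel))"
proof (rule nn_integral_le_of_slices_swap[OF Kx_measurable Lx_integrable[OF assms]])
  have "AE y in lborel. integrable lborel (\<lambda>x. Lx (x, y))"
    using lborel_pair.AE_integrable_snd[of "\<lambda>x y. Lx (x, y)"] Lx_integrable[OF assms]
    by (simp add: lborel_prod)
  moreover have "AE y in lborel. integrable lborel (\<lambda>x. w x y * (X x)\<^sup>2)"
    using lborel_pair.AE_integrable_snd[of "\<lambda>x y. w x y * (X x)\<^sup>2"] w_X2_integral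
    by (simp add: lborel_prod has_bochner_integral_iff case_prod_unfold)
  ultimately show "AE y in lborel. (\<integral>\<^sup>+x. ennreal (Kx (x, y)) \<partial>lborel) \<le> ennreal (- (\<integral>x. Lx (x, y) \<partial>lborel))
      \<and> 0 \<le> - (\<integral>x. Lx (x, y) \<partial>lborel)"
  proof eventually_elim
    case (elim y)
    show ?case
    proof (cases "0 < y")
      case True
      note c = cont_slices(1)[OF cont(1) True] cont_slices(1)[OF cont(2) True]
      have kc: "continuous_on UNIV (\<lambda>x. y * h x y ^ 4 * Xx x)"
        by (intro continuous_intros c Xx_cont)
      have lc: "continuous_on UNIV (\<lambda>x. 4 * y * h x y ^ 3 * hx x y * X x)"
        by (intro continuous_intros c X_cont)
      have k0: "0 \<le> y * h x y ^ 4 * Xx x" for x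
        using True pos[OF True, of x] Xx_nonneg[of x] by simp
      have li: "integrable lborel (\<lambda>x. 4 * y * h x y ^ 3 * hx x y * X x)"
        using elim(1) True by (simp add: Lx_def)
      have ui: "integrable lborel (\<lambda>x. C\<^sup>2 * (w x y * (X x)\<^sup>2))"
        using elim(2) by (rule integrable_mult_right)
      note integration_by_parts_line[OF h4_derivative_x[OF True] kc k0 lc li ui boundary_square[OF True]]
      with True show ?thesis by (simp add: Kx_def Lx_def)
    qed (simp add: Kx_def Lx_def)
  qed
qed

lemma Ky_le_Ly:
  assumes "integrable lborel Ey"
  shows "(\<integral>\<^sup>+z. ennreal (Ky z) \<partial>lborel) \<le> ennreal (- (\<integral>z. Ly z \<partial>lborel))"
proof (rule nn_integral_le_of_slices[OF Ky_measurable Ly_integrable[OF assms]])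
  have "AE x in lborel. integrable lborel (\<lambda>y. Ly (x, y))"
    using lborel_pair.AE_integrable_fst'[of Ly] Ly_integrable[OF assms]
    by (simp add: lborel_prod)
  then show "AE x in lborel. (\<integral>\<^sup>+y. ennreal (Ky (x, y)) \<partial>lborel) \<le> ennreal (- (\<integral>y. Ly (x, y) \<partial>lborel))
      \<and> 0 \<le> - (\<integral>y. Ly (x, y) \<partial>lborel)"
  proof eventually_elim
    case (elim x)
    let ?k = "\<lambda>y. h x y ^ 4 * (T x y + y * Ty x y)" and ?l = "\<lambda>y. 4 * y * h x y ^ 3 * hy x y * T x y"
    note c = cont_slices(2)[OF cont(1)] cont_slices(2)[OF cont(3)]
    have L: "(\<lambda>y. indicator {0<..} y *\<^sub>R ?l y) = (\<lambda>y. Ly (x, y))"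
      by (auto simp: Ly_def indicator_def)
    have K: "(\<lambda>y. ennreal (?k y) * indicator {0<..} y) = (\<lambda>y. ennreal (Ky (x, y)))"
      by (auto simp: Ky_def indicator_def)
    have kc: "continuous_on {0<..} ?k" by (intro continuous_intros c T_cont Ty_cont)
    have lc: "continuous_on {0<..} ?l" by (intro continuous_intros c T_cont)
    have k0: "0 \<le> ?k y" if "0 < y" for y
      using that pos[OF that, of x] T_pos[OF that, of x] Ty_nonneg[OF that, of x] by simp
    have li: "set_integrable lborel {0<..} ?l"
      unfolding set_integrable_def L using elim .
    have ui: "set_integrable lborel {0<..} (\<lambda>y. C\<^sup>2 * (w x y * (T x y)\<^sup>2))"
      using w_T2_slice[of x] unfolding set_integrable_def has_bochner_integral_iff
      by (intro integrable_mult_indicator integrable_mult_right) auto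
    have \<Phi>0: "0 \<le> y * h x y ^ 4 * T x y" if "0 < y" for y
      using that pos[OF that, of x] T_pos[OF that, of x] by simp
    note integration_by_parts_half_line[OF h4_derivative_y kc k0 lc li ui boundary_square \<Phi>0]
    then show ?case unfolding K set_lebesgue_integral_def L by simp
  qed
qed

text \<open>
  Integrating \<open>transport_amgm\<close> gives \<open>12 * M / kappa\<close> on the left, since the moments of 1, \<open>X\<^sup>2\<close> and \<open>T\<^sup>2\<close> are
  \<open>M\<close>, \<open>M\<close> and \<open>2 * M\<close>. Integration by parts and Young's inequality bound the right-hand side by \<open>2 * kappa\<close> times
  the energy plus \<open>6 * M / kappa\<close>.
\<close>

lemma sobolev_inequality:
  assumes Ex: "integrable lborel Ex" and Ey: "integrable lborel Ey"
  shows "3 * M \<le> kappa\<^sup>2 * ((\<integral>z. Ex z \<partial>lborel) + (\<integral>z. Ey z \<partial>lborel))"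
proof -
  let ?W = "\<lambda>z. 3 / kappa * (w (fst z) (snd z) + w (fst z) (snd z) * (X (fst z))\<^sup>2
      + w (fst z) (snd z) * (T (fst z) (snd z))\<^sup>2)"
  let ?Ex = "\<integral>z. Ex z \<partial>lborel" and ?Ey = "\<integral>z. Ey z \<partial>lborel"
  have W0: "0 \<le> ?W z" for z
    using kappa_pos w_nonneg by (intro mult_nonneg_nonneg add_nonneg_nonneg) auto
  have "has_bochner_integral lborel ?W (3 / kappa * (M + M + 2 * M))"
    by (intro has_bochner_integral_mult_right has_bochner_integral_add w_integral w_X2_integral w_T2_integral)
  then have W: "(\<integral>\<^sup>+z. ennreal (?W z) \<partial>lborel) = ennreal (12 * M / kappa)"
    using W0 by (subst nn_integral_eq_integral) (auto simp: has_bochner_integral_iff)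
  have pw: "ennreal (?W z) \<le> ennreal (Kx z) + ennreal (Ky z)" for z
  proof (cases "0 < snd z")
    case True
    have K0: "0 \<le> Kx z" "0 \<le> Ky z"
      using True pos[OF True, of "fst z"] T_pos[OF True, of "fst z"] Ty_nonneg[OF True, of "fst z"]
        Xx_nonneg[of "fst z"] by (simp_all add: Kx_def Ky_def)
    have "?W z \<le> Kx z + Ky z" using transport_amgm[OF True, of "fst z"] True by (simp add: Kx_def Ky_def)
    then show ?thesis unfolding ennreal_plus[OF K0, symmetric] by (rule ennreal_leI)
  qed (simp add: w_def)
  have "ennreal (12 * M / kappa) \<le> (\<integral>\<^sup>+z. ennreal (Kx z) + ennreal (Ky z) \<partial>lborel)"
    unfolding W[symmetric] by (intro nn_integral_mono pw)
  also have "\<dots> = (\<integral>\<^sup>+z. ennreal (Kx z) \<partial>lborel) + (\<integral>\<^sup>+z. ennreal (Ky z) \<partial>lborel)"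
    using Kx_measurable Ky_measurable by (intro nn_integral_add) auto
  also have "\<dots> \<le> ennreal (- (\<integral>z. Lx z \<partial>lborel)) + ennreal (- (\<integral>z. Ly z \<partial>lborel))"
    by (intro add_mono Kx_le_Lx Ky_le_Ly Ex Ey)
  also have "\<dots> \<le> ennreal (2 * kappa * ?Ex + 2 / kappa * M) + ennreal (2 * kappa * ?Ey + 2 / kappa * (2 * M))"
  proof (intro add_mono ennreal_leI)
    have b: "has_bochner_integral lborel (\<lambda>z. 2 * kappa * Ex z + 2 / kappa * (w (fst z) (snd z) * (X (fst z))\<^sup>2))
        (2 * kappa * ?Ex + 2 / kappa * M)"
      by (intro has_bochner_integral_add has_bochner_integral_mult_right w_X2_integral
          has_bochner_integral_integrable Ex)
    have "- Lx z \<le> 2 * kappa * Ex z + 2 / kappa * (w (fst z) (snd z) * (X (fst z))\<^sup>2)" for z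
      using Lx_bound[of z] by linarith
    then have "(\<integral>z. - Lx z \<partial>lborel)
        \<le> (\<integral>z. 2 * kappa * Ex z + 2 / kappa * (w (fst z) (snd z) * (X (fst z))\<^sup>2) \<partial>lborel)"
      using Lx_integrable[OF Ex] has_bochner_integral_iff[THEN iffD1, OF b]
      by (intro integral_mono Bochner_Integration.integrable_minus) auto
    also have "\<dots> = 2 * kappa * ?Ex + 2 / kappa * M" by (rule has_bochner_integral_integral_eq[OF b])
    finally have "(\<integral>z. - Lx z \<partial>lborel) \<le> 2 * kappa * ?Ex + 2 / kappa * M" .
    then show "- (\<integral>z. Lx z \<partial>lborel) \<le> 2 * kappa * ?Ex + 2 / kappa * M" by simp
    have b: "has_bochner_integral lborel (\<lambda>z. 2 * kappa * Ey z + 2 / kappa * (w (fst z) (snd z) * (T (fst z) (snd z))\<^sup>2))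
        (2 * kappa * ?Ey + 2 / kappa * (2 * M))"
      by (intro has_bochner_integral_add has_bochner_integral_mult_right w_T2_integral
          has_bochner_integral_integrable Ey)
    have "- Ly z \<le> 2 * kappa * Ey z + 2 / kappa * (w (fst z) (snd z) * (T (fst z) (snd z))\<^sup>2)" for z
      using Ly_bound[of z] by linarith
    then have "(\<integral>z. - Ly z \<partial>lborel)
        \<le> (\<integral>z. 2 * kappa * Ey z + 2 / kappa * (w (fst z) (snd z) * (T (fst z) (snd z))\<^sup>2) \<partial>lborel)"
      using Ly_integrable[OF Ey] has_bochner_integral_iff[THEN iffD1, OF b]
      by (intro integral_mono Bochner_Integration.integrable_minus) auto
    also have "\<dots> = 2 * kappa * ?Ey + 2 / kappa * (2 * M)" by (rule has_bochner_integral_integral_eq[OF b])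
    finally have "(\<integral>z. - Ly z \<partial>lborel) \<le> 2 * kappa * ?Ey + 2 / kappa * (2 * M)" .
    then show "- (\<integral>z. Ly z \<partial>lborel) \<le> 2 * kappa * ?Ey + 2 / kappa * (2 * M)" by simp
  qed
  also have "\<dots> = ennreal (2 * kappa * (?Ex + ?Ey) + 6 * M / kappa)"
  proof -
    have "0 \<le> ?Ex" "0 \<le> ?Ey"
      by (intro Bochner_Integration.integral_nonneg; simp add: Ex_def Ey_def)+
    then show ?thesis using kappa_pos M_pos
      by (subst ennreal_plus[symmetric]) (simp_all add: algebra_simps)
  qed
  finally have "12 * M / kappa \<le> 2 * kappa * (?Ex + ?Ey) + 6 * M / kappa"
  proof (subst (asm) ennreal_le_iff)
    have "0 \<le> ?Ex" "0 \<le> ?Ey"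
      by (intro Bochner_Integration.integral_nonneg; simp add: Ex_def Ey_def)+
    then show "0 \<le> 2 * kappa * (?Ex + ?Ey) + 6 * M / kappa" using kappa_pos M_pos by simp
  qed
  then have "6 * M / kappa \<le> 2 * kappa * (?Ex + ?Ey)" by simp
  then have "6 * M \<le> 2 * kappa * (?Ex + ?Ey) * kappa" using kappa_pos by (simp add: pos_divide_le_eq)
  then show ?thesis by (simp add: power2_eq_square algebra_simps)
qed

end

section \<open>From positive profiles to the weighted inequality on the half-plane\<close>

lemma half_plane_eq: "half_plane = {z. 0 < snd z}"
  by (simp add: half_plane_def)

lemma open_half_plane: "open half_plane"
  unfolding half_plane_def by (intro open_Collect_less continuous_intros)

lemma half_plane_borel: "half_plane \<in> sets borel"
  using open_half_plane by auto

lemma integral_y_gradient: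
  fixes x :: real
  shows "has_bochner_integral lborel
    (\<lambda>y. indicator {0<..} y *\<^sub>R (y * (x\<^sup>2 + y\<^sup>2) / (1 + x\<^sup>2 + y\<^sup>2) ^ 3))
    (1 / (2 * (1 + x\<^sup>2)) - 1 / (4 * (1 + x\<^sup>2)\<^sup>2))"
proof -
  have p: "0 < 1 + x\<^sup>2 + y\<^sup>2" for y :: real by (rule one_plus_squares_pos)
  let ?F = "\<lambda>s::real. - 1 / (2 * s) + 1 / (4 * s\<^sup>2)"
  have s: "(?F has_real_derivative 1 / (2 * s\<^sup>2) - 1 / (2 * s ^ 3)) (at s)" if "0 < s" for s :: real
    using that by (auto intro!: derivative_eq_intros simp: power2_eq_square power3_eq_cube field_simps)
  have q: "((\<lambda>y. 1 + x\<^sup>2 + y\<^sup>2) has_real_derivative 2 * y) (at y)" for y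
    by (auto intro!: derivative_eq_intros)
  have e: "(1 / (2 * s\<^sup>2) - 1 / (2 * s ^ 3)) * (2 * y) = y * (s - 1) / s ^ 3" if "0 < s" for s y :: real
    using that by (simp add: field_simps power2_eq_square power3_eq_cube)
  have "has_bochner_integral lborel (\<lambda>y. indicator {0<..} y *\<^sub>R (y * (x\<^sup>2 + y\<^sup>2) / (1 + x\<^sup>2 + y\<^sup>2) ^ 3))
      (0 - ?F (1 + x\<^sup>2))"
  proof (rule FTC_nonneg_half_line)
    show "((\<lambda>y. ?F (1 + x\<^sup>2 + y\<^sup>2)) has_real_derivative y * (x\<^sup>2 + y\<^sup>2) / (1 + x\<^sup>2 + y\<^sup>2) ^ 3) (at y)" for y
      using DERIV_chain2[OF s[OF p] q, of y] unfolding e[OF p] by simp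
    show "continuous_on {0<..} (\<lambda>y. y * (x\<^sup>2 + y\<^sup>2) / (1 + x\<^sup>2 + y\<^sup>2) ^ 3)"
      using p by (intro continuous_intros) (metis less_irrefl power_eq_0_iff)
    have "isCont (\<lambda>y. ?F (1 + x\<^sup>2 + y\<^sup>2)) 0" by (rule DERIV_isCont[OF DERIV_chain2[OF s[OF p] q]])
    then show "((\<lambda>y. ?F (1 + x\<^sup>2 + y\<^sup>2)) \<longlongrightarrow> ?F (1 + x\<^sup>2)) (at_right 0)"
      by (simp add: isCont_def filterlim_at_split)
    show "((\<lambda>y. ?F (1 + x\<^sup>2 + y\<^sup>2)) \<longlongrightarrow> 0) at_top" by real_asymp
  qed (use p in \<open>auto intro!: divide_nonneg_pos\<close>)
  then show ?thesis by (simp add: algebra_simps)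
qed

lemma integral_inverse: "has_bochner_integral lborel (\<lambda>s::real. 1 / (1 + s\<^sup>2)) pi"
proof -
  have p: "1 + s\<^sup>2 \<noteq> 0" for s :: real by (metis add_pos_nonneg less_irrefl zero_le_power2 zero_less_one)
  have "has_bochner_integral lborel (\<lambda>s::real. 1 / (1 + s\<^sup>2)) (pi / 2 - - (pi / 2))"
  proof (rule FTC_nonneg_line)
    show "(arctan has_real_derivative 1 / (1 + s\<^sup>2)) (at s)" for s
      using DERIV_arctan[of s] by (simp add: inverse_eq_divide)
    show "(arctan \<longlongrightarrow> pi / 2) at_top" "(arctan \<longlongrightarrow> - (pi / 2)) at_bot" by real_asymp+
  qed (use p in \<open>auto intro!: continuous_intros\<close>)
  then show ?thesis by simp
qed

text \<open>
  The energy of the extremal function \<open>(1 + x\<^sup>2 + y\<^sup>2) ^ (-1/2)\<close> for the weight \<open>y\<close>. It enters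
  twice: as the cost of a regularisation and in the computation that shows sharpness.
\<close>

lemma bubble_energy:
  "has_bochner_integral lborel
    (\<lambda>z. indicator half_plane z *\<^sub>R (snd z * ((fst z)\<^sup>2 + (snd z)\<^sup>2) / (1 + (fst z)\<^sup>2 + (snd z)\<^sup>2) ^ 3)) (3 * pi / 8)"
proof (rule has_bochner_integral_iterated)
  show "(\<lambda>z. indicator half_plane z *\<^sub>R (snd z * ((fst z)\<^sup>2 + (snd z)\<^sup>2) / (1 + (fst z)\<^sup>2 + (snd z)\<^sup>2) ^ 3))
      \<in> borel_measurable borel"
    using one_plus_squares_pos
    by (intro borel_measurable_continuous_on_indicator half_plane_borel continuous_intros)
       (metis less_irrefl power_eq_0_iff)
  show "has_bochner_integral lborel (\<lambda>y. indicator half_plane (x, y) *\<^sub>R (snd (x, y) * ((fst (x, y))\<^sup>2 + (snd (x, y))\<^sup>2)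
      / (1 + (fst (x, y))\<^sup>2 + (snd (x, y))\<^sup>2) ^ 3)) (1 / (2 * (1 + x\<^sup>2)) - 1 / (4 * (1 + x\<^sup>2)\<^sup>2))" for x
    using integral_y_gradient[of x] by (simp add: half_plane_def indicator_def)
  have "has_bochner_integral lborel (\<lambda>x::real. (1 / (1 + x\<^sup>2)) / 2 - (1 / (1 + x\<^sup>2)\<^sup>2) / 4) (pi / 2 - (pi / 2) / 4)"
    by (intro has_bochner_integral_diff has_bochner_integral_divide_zero integral_inverse integral_inverse_square)
  then show "has_bochner_integral lborel (\<lambda>x::real. 1 / (2 * (1 + x\<^sup>2)) - 1 / (4 * (1 + x\<^sup>2)\<^sup>2)) (3 * pi / 8)"
    by (simp add: mult.commute)
  show "0 \<le> indicator half_plane z *\<^sub>R (snd z * ((fst z)\<^sup>2 + (snd z)\<^sup>2) / (1 + (fst z)\<^sup>2 + (snd z)\<^sup>2) ^ 3)" for z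
    using one_plus_squares_pos[of "fst z" "snd z"] by (auto simp: half_plane_def indicator_def intro!: divide_nonneg_pos)
qed

text \<open>
  Cauchy--Schwarz for vectors with one extra real coordinate of weight \<open>e\<close>; it shows that
  \<open>sqrt (norm f ^ 2 + e * g ^ 2)\<close> has at most the energy of \<open>f\<close> plus \<open>e\<close> times that of \<open>g\<close>.
\<close>

lemma cauchy_schwarz_extended:
  fixes p q :: "'a::real_inner" and e a b :: real
  assumes "0 \<le> e"
  shows "(p \<bullet> q + e * (a * b))\<^sup>2 \<le> ((norm p)\<^sup>2 + e * a\<^sup>2) * ((norm q)\<^sup>2 + e * b\<^sup>2)"
proof -
  have "(sqrt e * a) * (sqrt e * b) = (sqrt e * sqrt e) * (a * b)" by (simp only: mult_ac)
  then have "p \<bullet> q + e * (a * b) = (p, sqrt e * a) \<bullet> (q, sqrt e * b)"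
    using assms by (simp add: inner_prod_def)
  moreover have "(norm (p, sqrt e * a))\<^sup>2 = (norm p)\<^sup>2 + e * a\<^sup>2" "(norm (q, sqrt e * b))\<^sup>2 = (norm q)\<^sup>2 + e * b\<^sup>2"
    using assms by (simp_all add: norm_prod_def power_mult_distrib)
  ultimately show ?thesis
    using Cauchy_Schwarz_ineq[of "(p, sqrt e * a)" "(q, sqrt e * b)"]
    by (simp only: power2_norm_eq_inner)
qed

lemma sobolev_constant:
  fixes M E :: real
  assumes M: "0 < M" and le: "3 * M \<le> ((8 * M / pi) powr (1 / 3))\<^sup>2 * E"
  shows "3 / 4 * pi powr (2 / 3) * M powr (1 / 3) \<le> E"
proof -
  define \<mu> p where "\<mu> = M powr (1 / 3)" and "p = pi powr (1 / 3)"
  have pos: "0 < \<mu>" "0 < p" using M by (simp_all add: \<mu>_def p_def)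
  have cube: "(r powr (1 / 3)) ^ 3 = r" if "0 < r" for r :: real
    using that powr_realpow[of "r powr (1 / 3)" 3] by (simp add: powr_powr)
  have M3: "M = \<mu> ^ 3" unfolding \<mu>_def by (rule cube[OF M, symmetric])
  have eight: "8 powr (1 / 3) = (2 :: real)"
    by (rule power_eq_imp_eq_base[of _ 3]) (use cube[of 8] in auto)
  have "(8 * M / pi) powr (1 / 3) = 2 * \<mu> / p"
    using M eight by (simp add: powr_divide powr_mult \<mu>_def p_def)
  with le have "3 * \<mu> ^ 3 \<le> (2 * \<mu> / p)\<^sup>2 * E" unfolding M3[symmetric] by simp
  then have "3 * \<mu> ^ 3 * p\<^sup>2 \<le> 4 * \<mu>\<^sup>2 * E"
    using pos by (simp add: power_divide power_mult_distrib pos_le_divide_eq)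
  then have "\<mu>\<^sup>2 * (3 * \<mu> * p\<^sup>2) \<le> \<mu>\<^sup>2 * (4 * E)"
    by (simp add: power2_eq_square power3_eq_cube mult_ac)
  then have "3 * \<mu> * p\<^sup>2 \<le> 4 * E" using pos by (simp add: mult_le_cancel_left_pos)
  moreover have "pi powr (2 / 3) = p\<^sup>2" using powr_add[of pi "1/3" "1/3"] by (simp add: p_def power2_eq_square)
  ultimately show ?thesis by (simp add: \<mu>_def[symmetric] mult_ac)
qed

text \<open>
  Adding a small multiple of the extremal function \<open>g = (1 + x\<^sup>2 + y\<^sup>2) ^ (-1/2)\<close> in the sense of
  \<open>h = sqrt (norm f ^ 2 + e * g ^ 2)\<close> produces a positive continuously differentiable profile, so that the
  transport argument applies; it handles vector values and zeros of \<open>f\<close> at once, can only increase the \<open>L^6\<close> norm,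
  and raises the energy by at most \<open>e * (3 * pi / 8)\<close>.
\<close>

lemma regularised_sobolev:
  fixes f fx fy :: "real \<times> real \<Rightarrow> 'k::real_inner"
  assumes e: "0 < e"
    and cf: "continuous_on half_plane f" "continuous_on half_plane fx" "continuous_on half_plane fy"
    and fx: "\<And>x y. 0 < y \<Longrightarrow> ((\<lambda>t. f (t, y)) has_vector_derivative fx (x, y)) (at x)"
    and fy: "\<And>x y. 0 < y \<Longrightarrow> ((\<lambda>t. f (x, t)) has_vector_derivative fy (x, y)) (at y)"
    and bd: "\<And>x y. 0 < y \<Longrightarrow> (norm (f (x, y)))\<^sup>2 \<le> B / (1 + x\<^sup>2 + y\<^sup>2)"
    and int: "set_integrable lborel half_plane (\<lambda>z. snd z * ((norm (fx z))\<^sup>2 + (norm (fy z))\<^sup>2))"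
  shows "3 / 4 * pi powr (2 / 3) * (LINT z:half_plane|lborel. snd z * norm (f z) ^ 6) powr (1 / 3)
    \<le> (LINT z:half_plane|lborel. snd z * ((norm (fx z))\<^sup>2 + (norm (fy z))\<^sup>2)) + e * (3 * pi / 8)"
proof -
  define s where "s x y = 1 + x\<^sup>2 + y\<^sup>2" for x y :: real
  have s: "0 < s x y" for x y unfolding s_def by (rule one_plus_squares_pos)
  define q where "q x y = (norm (f (x, y)))\<^sup>2 + e / s x y" for x y
  have q: "0 < q x y" for x y
    using s[of x y] e by (simp add: q_def add_nonneg_pos)
  define h where "h x y = sqrt (q x y)" for x y
  define hx where "hx x y = (f (x, y) \<bullet> fx (x, y) - e * x / (s x y)\<^sup>2) / h x y" for x y
  define hy where "hy x y = (f (x, y) \<bullet> fy (x, y) - e * y / (s x y)\<^sup>2) / h x y" for x y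
  have h: "0 < h x y" for x y using q by (simp add: h_def)
  have cs: "continuous_on half_plane (\<lambda>z. s (fst z) (snd z))"
    unfolding s_def by (intro continuous_intros)
  have ch: "continuous_on half_plane (\<lambda>z. h (fst z) (snd z))"
    unfolding h_def q_def using s[THEN less_imp_neq] by (simp, intro continuous_intros cf cs) metis
  interpret half_plane_profile h hx hy "sqrt (B + e)"
  proof
    show "0 < h x y" for x y by (rule h)
    show "h x y \<le> sqrt (B + e) / sqrt (1 + x\<^sup>2 + y\<^sup>2)" if "0 < y" for x y
    proof -
      have "q x y \<le> (B + e) / s x y" using bd[OF that, of x] by (simp add: q_def s_def add_divide_distrib)
      then show ?thesis unfolding h_def by (simp add: s_def flip: real_sqrt_divide)
    qed
    show "continuous_on {z. 0 < snd z} (\<lambda>z. h (fst z) (snd z))" using ch by (simp add: half_plane_eq)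
    show "continuous_on {z. 0 < snd z} (\<lambda>z. hx (fst z) (snd z))"
      unfolding half_plane_eq[symmetric] hx_def using s[THEN less_imp_neq] h[THEN less_imp_neq]
      by (simp, intro continuous_intros cf cs ch) (metis power_eq_0_iff)+
    show "continuous_on {z. 0 < snd z} (\<lambda>z. hy (fst z) (snd z))"
      unfolding half_plane_eq[symmetric] hy_def using s[THEN less_imp_neq] h[THEN less_imp_neq]
      by (simp, intro continuous_intros cf cs ch) (metis power_eq_0_iff)+
    \<comment> \<open>one-variable derivative shared by the horizontal and the vertical direction\<close>
    have main: "((\<lambda>t. sqrt ((norm (u t))\<^sup>2 + e / v t)) has_real_derivative
        (u t \<bullet> u' - e * (v' / 2) / (v t)\<^sup>2) / sqrt ((norm (u t))\<^sup>2 + e / v t)) (at t)"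
      if u: "(u has_vector_derivative u') (at t)" and v: "(v has_real_derivative v') (at t)" and "0 < v t"
      for u :: "real \<Rightarrow> 'k" and v u' v' t
    proof -
      have "((\<lambda>t. u t \<bullet> u t) has_vector_derivative u t \<bullet> u' + u' \<bullet> u t) (at t)"
        by (rule bounded_bilinear.has_vector_derivative[OF bounded_bilinear_inner u u])
      then have 1: "((\<lambda>t. (norm (u t))\<^sup>2) has_real_derivative 2 * (u t \<bullet> u')) (at t)"
        by (simp add: has_real_derivative_iff_has_vector_derivative power2_norm_eq_inner inner_commute)
      have 2: "((\<lambda>t. e / v t) has_real_derivative - (e * v' / (v t)\<^sup>2)) (at t)"
        using DERIV_divide[OF DERIV_const[of e] v] \<open>0 < v t\<close> by (simp add: power2_eq_square)
      have p: "0 < (norm (u t))\<^sup>2 + e / v t" using \<open>0 < v t\<close> e by (simp add: add_nonneg_pos)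
      show ?thesis
      proof (rule DERIV_cong[OF DERIV_chain2[OF DERIV_real_sqrt[OF p] DERIV_add[OF 1 2]]])
        have "inverse S / 2 * (2 * a + - (e * b / c)) = (a - e * (b / 2) / c) / S"
          if "S \<noteq> 0" "c \<noteq> 0" for S a b c :: real
          using that by (simp add: field_simps)
        then show "inverse (sqrt ((norm (u t))\<^sup>2 + e / v t)) / 2 * (2 * (u t \<bullet> u') + - (e * v' / (v t)\<^sup>2))
            = (u t \<bullet> u' - e * (v' / 2) / (v t)\<^sup>2) / sqrt ((norm (u t))\<^sup>2 + e / v t)"
          using p \<open>0 < v t\<close> by (metis less_irrefl power_eq_0_iff real_sqrt_eq_zero_cancel_iff)
      qed
    qed
    show "((\<lambda>x. h x y) has_real_derivative hx x y) (at x)" if "0 < y" for x y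
    proof -
      have v: "((\<lambda>x. s x y) has_real_derivative 2 * x) (at x)"
        unfolding s_def by (auto intro!: derivative_eq_intros)
      from main[OF fx[OF that] v s] show ?thesis
        by (simp add: h_def q_def hx_def)
    qed
    show "((\<lambda>y. h x y) has_real_derivative hy x y) (at y)" if "0 < y" for x y
    proof -
      have v: "((\<lambda>y. s x y) has_real_derivative 2 * y) (at y)"
        unfolding s_def by (auto intro!: derivative_eq_intros)
      from main[OF fy[OF that] v s] show ?thesis
        by (simp add: h_def[abs_def] q_def hy_def)
    qed
  qed
  let ?A = "\<lambda>z. indicator half_plane z *\<^sub>R (snd z * ((norm (fx z))\<^sup>2 + (norm (fy z))\<^sup>2))"
  let ?G = "\<lambda>z. indicator half_plane z *\<^sub>R (snd z * ((fst z)\<^sup>2 + (snd z)\<^sup>2) / (1 + (fst z)\<^sup>2 + (snd z)\<^sup>2) ^ 3)"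
  have A: "integrable lborel ?A" using int by (simp add: set_integrable_def)
  have G: "integrable lborel ?G" "(\<integral>z. ?G z \<partial>lborel) = 3 * pi / 8"
    using bubble_energy by (simp_all only: has_bochner_integral_iff)
  have slope: "((f z \<bullet> d - e * t / (s (fst z) (snd z))\<^sup>2) / h (fst z) (snd z))\<^sup>2
      \<le> (norm d)\<^sup>2 + e * (t\<^sup>2 / (s (fst z) (snd z)) ^ 3)" for z d t
  proof -
    let ?s = "s (fst z) (snd z)"
    note [simp] = s[of "fst z" "snd z", THEN less_imp_neq, THEN not_sym] s[of "fst z" "snd z"]
    \<comment> \<open>the last factor is the slope of \<open>(1 + x\<^sup>2 + y\<^sup>2) ^ (-1/2)\<close> in the coordinate whose value is \<open>t\<close>\<close>
    have "(f z \<bullet> d + e * ((1 / sqrt ?s) * (- t / (?s * sqrt ?s))))\<^sup>2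
        \<le> ((norm (f z))\<^sup>2 + e * (1 / sqrt ?s)\<^sup>2) * ((norm d)\<^sup>2 + e * (- t / (?s * sqrt ?s))\<^sup>2)"
      using e by (intro cauchy_schwarz_extended) simp
    also have "(1 / sqrt ?s) * (- t / (?s * sqrt ?s)) = - (t / ?s\<^sup>2)"
      by (simp add: power2_eq_square less_imp_le)
    also have "(1 / sqrt ?s)\<^sup>2 = 1 / ?s" by (simp add: power_divide less_imp_le)
    also have "(- t / (?s * sqrt ?s))\<^sup>2 = t\<^sup>2 / ?s ^ 3"
      by (simp add: power_divide power_mult_distrib less_imp_le power3_eq_cube power2_eq_square)
    finally have "(f z \<bullet> d - e * t / ?s\<^sup>2)\<^sup>2 \<le> (h (fst z) (snd z))\<^sup>2 * ((norm d)\<^sup>2 + e * (t\<^sup>2 / ?s ^ 3))"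
      using q[of "fst z" "snd z"] by (simp add: h_def q_def less_imp_le)
    then show ?thesis
      using h[of "fst z" "snd z"] by (simp add: power_divide pos_divide_le_eq mult.commute)
  qed
  have EE: "Ex z + Ey z \<le> ?A z + e * ?G z" for z
  proof (cases "0 < snd z")
    case True
    have "Ex z + Ey z = snd z * ((hx (fst z) (snd z))\<^sup>2 + (hy (fst z) (snd z))\<^sup>2)"
      using True by (simp add: Ex_def Ey_def algebra_simps)
    also have "\<dots> \<le> snd z * (((norm (fx z))\<^sup>2 + e * ((fst z)\<^sup>2 / (s (fst z) (snd z)) ^ 3))
        + ((norm (fy z))\<^sup>2 + e * ((snd z)\<^sup>2 / (s (fst z) (snd z)) ^ 3)))"
      using True slope[of z "fx z" "fst z"] slope[of z "fy z" "snd z"]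
      by (intro mult_left_mono add_mono) (simp_all add: hx_def hy_def)
    also have "\<dots> = ?A z + e * ?G z"
      using True by (simp add: half_plane_def s_def algebra_simps add_divide_distrib)
    finally show ?thesis .
  qed (simp add: Ex_def Ey_def half_plane_def)
  have E0: "0 \<le> Ex z" "0 \<le> Ey z" for z by (simp_all add: Ex_def Ey_def)
  have AG: "integrable lborel (\<lambda>z. ?A z + e * ?G z)"
    by (intro Bochner_Integration.integrable_add A integrable_mult_right G)
  have Exi: "integrable lborel Ex"
  proof (rule Bochner_Integration.integrable_bound[OF AG])
    have "norm (Ex z) \<le> norm (?A z + e * ?G z)" for z
      using EE[of z] E0[of z] unfolding real_norm_def by linarith
    then show "AE z in lborel. norm (Ex z) \<le> norm (?A z + e * ?G z)" by (intro AE_I2)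
  qed (use Ex_measurable in simp)
  have Eyi: "integrable lborel Ey"
  proof (rule Bochner_Integration.integrable_bound[OF AG])
    have "norm (Ey z) \<le> norm (?A z + e * ?G z)" for z
      using EE[of z] E0[of z] unfolding real_norm_def by linarith
    then show "AE z in lborel. norm (Ey z) \<le> norm (?A z + e * ?G z)" by (intro AE_I2)
  qed (use Ey_measurable in simp)
  have "(\<integral>z. Ex z \<partial>lborel) + (\<integral>z. Ey z \<partial>lborel) = (\<integral>z. Ex z + Ey z \<partial>lborel)"
    using Exi Eyi by simp
  also have "\<dots> \<le> (\<integral>z. ?A z + e * ?G z \<partial>lborel)"
    by (intro integral_mono Bochner_Integration.integrable_add Exi Eyi AG EE A integrable_mult_right G)
  also have "\<dots> = (\<integral>z. ?A z \<partial>lborel) + e * (3 * pi / 8)"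
    by (simp only: Bochner_Integration.integral_add[OF A integrable_mult_right[OF G(1)]]
        integral_mult_right_zero G(2))
  finally have upper: "(\<integral>z. Ex z \<partial>lborel) + (\<integral>z. Ey z \<partial>lborel) \<le> (\<integral>z. ?A z \<partial>lborel) + e * (3 * pi / 8)" .
  let ?N = "LINT z:half_plane|lborel. snd z * norm (f z) ^ 6"
  have N: "?N \<le> M"
  proof -
    have le: "indicator half_plane z *\<^sub>R (snd z * norm (f z) ^ 6) \<le> w (fst z) (snd z)" for z
    proof (cases "0 < snd z")
      case True
      have "norm (f z) \<le> h (fst z) (snd z)"
        using s[of "fst z" "snd z"] e by (auto simp: h_def q_def intro!: real_le_rsqrt)
      then have "norm (f z) ^ 6 \<le> h (fst z) (snd z) ^ 6" by (intro power_mono) auto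
      then show ?thesis using True by (simp add: half_plane_def w_def)
    qed (simp add: half_plane_def w_def)
    have wi: "integrable lborel (\<lambda>z. w (fst z) (snd z))" "(\<integral>z. w (fst z) (snd z) \<partial>lborel) = M"
      using w_integral by (auto simp: has_bochner_integral_iff)
    have "?N \<le> (\<integral>z. w (fst z) (snd z) \<partial>lborel)"
      unfolding set_lebesgue_integral_def
      by (rule integral_mono'[OF wi(1) le]) (rule w_nonneg)
    then show ?thesis by (simp add: wi)
  qed
  have N0: "0 \<le> ?N"
    unfolding set_lebesgue_integral_def
    by (intro Bochner_Integration.integral_nonneg) (auto simp: half_plane_def indicator_def)
  have "3 / 4 * pi powr (2 / 3) * ?N powr (1 / 3) \<le> 3 / 4 * pi powr (2 / 3) * M powr (1 / 3)"
    using N N0 by (intro mult_left_mono powr_mono2) auto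
  also have "\<dots> \<le> (\<integral>z. Ex z \<partial>lborel) + (\<integral>z. Ey z \<partial>lborel)"
    using sobolev_inequality[OF Exi Eyi] unfolding kappa_def by (rule sobolev_constant[OF M_pos])
  also note upper
  finally show ?thesis by (simp add: set_lebesgue_integral_def)
qed

text \<open>
  The sharp Sobolev inequality for the weight \<open>y\<close> on the half-plane. For functions on three-dimensional space
  that are symmetric about an axis it is the classical sharp Sobolev inequality, \<open>y\<close> being the distance to the
  axis.
\<close>

lemma weighted_sobolev:
  fixes f fx fy :: "real \<times> real \<Rightarrow> 'k::real_inner"
  assumes cf: "continuous_on half_plane f" "continuous_on half_plane fx" "continuous_on half_plane fy"
    and fx: "\<And>x y. 0 < y \<Longrightarrow> ((\<lambda>t. f (t, y)) has_vector_derivative fx (x, y)) (at x)"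
    and fy: "\<And>x y. 0 < y \<Longrightarrow> ((\<lambda>t. f (x, t)) has_vector_derivative fy (x, y)) (at y)"
    and bd: "\<And>x y. 0 < y \<Longrightarrow> (norm (f (x, y)))\<^sup>2 \<le> B / (1 + x\<^sup>2 + y\<^sup>2)"
    and int: "set_integrable lborel half_plane (\<lambda>z. snd z * ((norm (fx z))\<^sup>2 + (norm (fy z))\<^sup>2))"
  shows "3 / 4 * pi powr (2 / 3) * (LINT z:half_plane|lborel. snd z * norm (f z) ^ 6) powr (1 / 3)
    \<le> (LINT z:half_plane|lborel. snd z * ((norm (fx z))\<^sup>2 + (norm (fy z))\<^sup>2))"
proof (rule field_le_epsilon)
  fix d :: real assume "0 < d"
  then have "0 < d / (3 * pi / 8)" by simp
  from regularised_sobolev[OF this cf fx fy bd int]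
  show "3 / 4 * pi powr (2 / 3) * (LINT z:half_plane|lborel. snd z * norm (f z) ^ 6) powr (1 / 3)
    \<le> (LINT z:half_plane|lborel. snd z * ((norm (fx z))\<^sup>2 + (norm (fy z))\<^sup>2)) + d" by simp
qed

section \<open>The hyperbolic setting\<close>

lemma hyp_measure_integral:
  fixes f :: "real \<times> real \<Rightarrow> real"
  assumes "continuous_on half_plane f"
  shows "(\<integral>z. f z \<partial>hyp_measure) = (LINT z:half_plane|lborel. f z / (snd z)\<^sup>2)"
    and "integrable hyp_measure f \<longleftrightarrow> set_integrable lborel half_plane (\<lambda>z. f z / (snd z)\<^sup>2)"
proof -
  have ss: "sets (restrict_space lborel half_plane) = sets (restrict_space borel half_plane)"
    by (intro sets_restrict_space_cong) simp
  have m: "f \<in> borel_measurable (restrict_space lborel half_plane)"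
    using borel_measurable_continuous_on_restrict[OF assms] measurable_cong_sets[OF ss refl] by blast
  have "continuous_on half_plane (\<lambda>z :: real \<times> real. 1 / (snd z)\<^sup>2)"
    by (intro continuous_intros) (auto simp: half_plane_def)
  then have d: "(\<lambda>z :: real \<times> real. 1 / (snd z)\<^sup>2) \<in> borel_measurable (restrict_space lborel half_plane)"
    using borel_measurable_continuous_on_restrict measurable_cong_sets[OF ss refl] by blast
  have H: "half_plane \<inter> space lborel \<in> sets lborel" using half_plane_borel by simp
  show "(\<integral>z. f z \<partial>hyp_measure) = (LINT z:half_plane|lborel. f z / (snd z)\<^sup>2)"
    unfolding hyp_measure_def set_lebesgue_integral_def
    by (subst integral_density[OF m d]) (simp_all add: integral_restrict_space[OF H])
  show "integrable hyp_measure f \<longleftrightarrow> set_integrable lborel half_plane (\<lambda>z. f z / (snd z)\<^sup>2)"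
    unfolding hyp_measure_def set_integrable_def
    by (subst integrable_density[OF m d]) (simp_all add: integrable_restrict_space[OF H])
qed

lemma borel_measurable_hyp_measure:
  fixes F :: "real \<times> real \<Rightarrow> 'b::topological_space"
  assumes "continuous_on half_plane F"
  shows "F \<in> borel_measurable hyp_measure"
proof -
  have ss: "sets hyp_measure = sets (restrict_space borel half_plane)"
    unfolding hyp_measure_def sets_density by (intro sets_restrict_space_cong) simp
  show ?thesis
    using borel_measurable_continuous_on_restrict[OF assms] measurable_cong_sets[OF ss refl] by blast
qed

text \<open>
  Allows a function to be simplified by identities that hold in the half-plane only, such as
  \<open>y powr (- a) * y powr a = 1\<close>, before its gradient is taken.
\<close>

lemma grad_eqI:
  fixes F G :: "real \<times> real \<Rightarrow> 'k::real_normed_vector"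
  assumes y: "0 < y" and eq: "\<And>z. z \<in> half_plane \<Longrightarrow> G z = F z"
    and dx: "((\<lambda>t. F (t, y)) has_vector_derivative a) (at x)"
    and dy: "((\<lambda>t. F (x, t)) has_vector_derivative b) (at y)"
  shows "grad G (x, y) = (a, b)"
proof -
  have "((\<lambda>t. G (t, y)) has_vector_derivative a) (at x)"
    by (rule has_vector_derivative_transform_within_open[OF dx, of UNIV])
      (use y eq in \<open>auto simp: half_plane_def\<close>)
  moreover have "((\<lambda>t. G (x, t)) has_vector_derivative b) (at y)"
    by (rule has_vector_derivative_transform_within_open[OF dy, of "{0<..}"])
      (use y eq in \<open>auto simp: half_plane_def\<close>)
  ultimately show ?thesis by (simp add: grad_def vector_derivative_at)
qed

lemma C1_on_half_plane_partials:
  fixes F :: "real \<times> real \<Rightarrow> 'k::real_normed_vector"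
  assumes "C1_on F half_plane"
  obtains Fx Fy where "continuous_on half_plane Fx" "continuous_on half_plane Fy"
    "\<And>x y. 0 < y \<Longrightarrow> ((\<lambda>t. F (t, y)) has_vector_derivative Fx (x, y)) (at x)"
    "\<And>x y. 0 < y \<Longrightarrow> ((\<lambda>t. F (x, t)) has_vector_derivative Fy (x, y)) (at y)"
proof -
  obtain F' where d: "\<And>z. z \<in> half_plane \<Longrightarrow> (F has_derivative blinfun_apply (F' z)) (at z)"
    and c: "continuous_on half_plane F'"
    using assms by (auto simp: C1_on_def)
  show ?thesis
  proof
    show "continuous_on half_plane (\<lambda>z. blinfun_apply (F' z) (1, 0))"
      "continuous_on half_plane (\<lambda>z. blinfun_apply (F' z) (0, 1))"
      by (intro continuous_intros c)+
    fix x y :: real assume "0 < y"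
    then have F: "(F has_derivative blinfun_apply (F' (x, y))) (at (x, y))" by (intro d) (simp add: half_plane_def)
    have "((F \<circ> (\<lambda>t. (t, y))) has_vector_derivative blinfun_apply (F' (x, y)) (1, 0)) (at x within UNIV)"
      by (rule vector_derivative_diff_chain_within has_derivative_at_withinI[OF F]
          has_vector_derivative_Pair has_vector_derivative_id has_vector_derivative_const)+
    then show "((\<lambda>t. F (t, y)) has_vector_derivative blinfun_apply (F' (x, y)) (1, 0)) (at x)"
      by (simp add: comp_def)
    have "((F \<circ> (\<lambda>t. (x, t))) has_vector_derivative blinfun_apply (F' (x, y)) (0, 1)) (at y within UNIV)"
      by (rule vector_derivative_diff_chain_within has_derivative_at_withinI[OF F]
          has_vector_derivative_Pair has_vector_derivative_id has_vector_derivative_const)+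
    then show "((\<lambda>t. F (x, t)) has_vector_derivative blinfun_apply (F' (x, y)) (0, 1)) (at y)"
      by (simp add: comp_def)
  qed
qed


lemma C1_on_half_planeI:
  fixes F Fx Fy :: "real \<times> real \<Rightarrow> 'k::real_normed_vector"
  assumes c: "continuous_on half_plane Fx" "continuous_on half_plane Fy"
    and dx: "\<And>x y. 0 < y \<Longrightarrow> ((\<lambda>t. F (t, y)) has_vector_derivative Fx (x, y)) (at x)"
    and dy: "\<And>x y. 0 < y \<Longrightarrow> ((\<lambda>t. F (x, t)) has_vector_derivative Fy (x, y)) (at y)"
  shows "C1_on F half_plane"
proof -
  define S where "S v = blinfun_scaleR_left v" for v :: 'k
  have S [simp]: "blinfun_apply (S v) t = t *\<^sub>R v" for v t
    by (simp add: S_def)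
  have cS: "continuous_on half_plane (\<lambda>z. S (u z))" if "continuous_on half_plane u" for u :: "real \<times> real \<Rightarrow> 'k"
    unfolding S_def
    by (rule bounded_linear.continuous_on[OF bounded_linear_blinfun_scaleR_left that])
  have H: "half_plane = UNIV \<times> {0<..}" by (auto simp: half_plane_def)
  show ?thesis
    unfolding C1_on_def
  proof (intro exI conjI ballI)
    show "continuous_on half_plane (\<lambda>z. (S (Fx z) o\<^sub>L fst_blinfun) + (S (Fy z) o\<^sub>L snd_blinfun))"
      by (intro continuous_intros cS c)
    fix z :: "real \<times> real" assume z: "z \<in> half_plane"
    obtain x y where zxy: "z = (x, y)" and y: "0 < y" using z by (cases z) (auto simp: half_plane_def)
    have "((\<lambda>(x, y). F (x, y)) has_derivative (\<lambda>(s, t). s *\<^sub>R Fx (x, y) + blinfun_apply (S (Fy (x, y))) t))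
        (at (x, y) within UNIV \<times> {0<..})"
    proof (rule has_derivative_partialsI)
      show "((\<lambda>x. F (x, y)) has_derivative (\<lambda>s. s *\<^sub>R Fx (x, y))) (at x within UNIV)"
        using dx[OF y, of x] by (simp add: has_vector_derivative_def)
      show "((\<lambda>y. F (x, y)) has_derivative blinfun_apply (S (Fy (x, y)))) (at y within {0<..})"
        if "x \<in> UNIV" "y \<in> {0<..}" for x y
        using dy[of y x] that by (auto simp: has_vector_derivative_def S_def intro!: has_derivative_at_withinI)
      show "continuous (at (x, y) within UNIV \<times> {0<..}) (\<lambda>(x, y). S (Fy (x, y)))"
        using cS[OF c(2)] y unfolding H continuous_on_eq_continuous_within
        by (auto simp: case_prod_unfold)
    qed (use y in auto)
    then have "(F has_derivative (\<lambda>(s, t). s *\<^sub>R Fx (x, y) + t *\<^sub>R Fy (x, y))) (at (x, y) within half_plane)"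
      by (simp add: H)
    then have "(F has_derivative (\<lambda>(s, t). s *\<^sub>R Fx (x, y) + t *\<^sub>R Fy (x, y))) (at z)"
      using z zxy by (simp add: at_within_open[OF _ open_half_plane])
    then show "(F has_derivative blinfun_apply ((S (Fx z) o\<^sub>L fst_blinfun) + (S (Fy z) o\<^sub>L snd_blinfun))) (at z)"
      by (rule has_derivative_eq_rhs) (auto simp: blinfun.bilinear_simps zxy fun_eq_iff)
  qed
qed

lemma compact_half_plane_margins:
  assumes "compact K" "K \<subseteq> half_plane"
  obtains p q where "0 < p" "p < q" "\<And>x y. (x, y) \<in> K \<Longrightarrow> p < y \<and> y < q"
proof -
  have "compact (snd ` K)" using assms(1) by (intro compact_continuous_image continuous_intros)
  then obtain b where b: "\<And>t. t \<in> snd ` K \<Longrightarrow> \<bar>t\<bar> \<le> b"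
    using compact_imp_bounded bounded_iff by (metis real_norm_def)
  obtain a where a: "0 < a" "\<And>t. t \<in> snd ` K \<Longrightarrow> a \<le> t"
  proof (cases "K = {}")
    case False
    then obtain t where "t \<in> snd ` K" "\<forall>s\<in>snd ` K. t \<le> s"
      using compact_attains_inf[OF \<open>compact (snd ` K)\<close>] by auto
    then show ?thesis using that[of t] assms(2) by (auto simp: half_plane_def)
  qed (use that[of 1] in auto)
  show ?thesis
  proof (rule that[of "min a 1 / 2" "\<bar>b\<bar> + 1"])
    fix x y assume "(x, y) \<in> K"
    then have "y \<in> snd ` K" by force
    from a(2)[OF this] b[OF this] a(1) show "min a 1 / 2 < y \<and> y < \<bar>b\<bar> + 1" by auto
  qed (use a(1) in auto)
qed

lemma set_integrable_half_plane_compact: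
  fixes f :: "real \<times> real \<Rightarrow> real"
  assumes K: "compact K" "K \<subseteq> half_plane" and f: "continuous_on half_plane f"
    and zero: "\<And>z. z \<in> half_plane \<Longrightarrow> z \<notin> K \<Longrightarrow> f z = 0"
  shows "set_integrable lborel half_plane f"
proof -
  have "integrable lborel (\<lambda>z. indicator K z *\<^sub>R f z)"
    by (rule borel_integrable_compact[OF K(1) continuous_on_subset[OF f K(2)]])
  also have "(\<lambda>z. indicator K z *\<^sub>R f z) = (\<lambda>z. indicator half_plane z *\<^sub>R f z)"
    using K(2) zero by (auto simp: indicator_def fun_eq_iff)
  finally show ?thesis by (simp add: set_integrable_def)
qed

lemma integral_vertical_derivative_zero:
  fixes q q' :: "real \<times> real \<Rightarrow> real"
  assumes K: "compact K" "K \<subseteq> half_plane"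
    and d: "\<And>x y. 0 < y \<Longrightarrow> ((\<lambda>t. q (x, t)) has_real_derivative q' (x, y)) (at y)"
    and c: "continuous_on half_plane q'"
    and zero: "\<And>z. z \<in> half_plane \<Longrightarrow> z \<notin> K \<Longrightarrow> q z = 0 \<and> q' z = 0"
  shows "(LINT z:half_plane|lborel. q' z) = 0"
proof -
  obtain a b where ab: "0 < a" "a < b" "\<And>x y. (x, y) \<in> K \<Longrightarrow> a < y \<and> y < b"
    using compact_half_plane_margins[OF K] by metis
  have i: "integrable (lborel \<Otimes>\<^sub>M lborel) (\<lambda>z. indicator half_plane z *\<^sub>R q' z)"
    using set_integrable_half_plane_compact[OF K c] zero by (simp add: lborel_prod set_integrable_def)
  have inner: "(\<integral>y. indicator half_plane (x, y) *\<^sub>R q' (x, y) \<partial>lborel) = 0" for x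
  proof -
    have "(\<lambda>y. indicator half_plane (x, y) *\<^sub>R q' (x, y)) = (\<lambda>y. indicator {a..b} y *\<^sub>R q' (x, y))"
    proof
      fix y
      show "indicator half_plane (x, y) *\<^sub>R q' (x, y) = indicator {a..b} y *\<^sub>R q' (x, y)"
        using ab(1) ab(3)[of x y] zero[of "(x, y)"]
        by (cases "(x, y) \<in> K") (auto simp: half_plane_def indicator_def)
    qed
    moreover have "(\<integral>y. indicator {a..b} y *\<^sub>R q' (x, y) \<partial>lborel) = q (x, b) - q (x, a)"
    proof (rule integral_FTC_Icc)
      show "a \<le> b" using ab by simp
      show "((\<lambda>y. q (x, y)) has_vector_derivative q' (x, y)) (at y within {a..b})" if "a \<le> y" "y \<le> b" for y
        using d[of y x] that ab(1)
        by (simp add: has_real_derivative_iff_has_vector_derivative has_vector_derivative_at_within)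
      show "continuous_on {a..b} (\<lambda>y. q' (x, y))"
        by (rule continuous_on_compose2[OF c]) (use ab(1) in \<open>auto simp: half_plane_def intro!: continuous_intros\<close>)
    qed
    moreover have "q (x, a) = 0" "q (x, b) = 0"
      using ab(1,2) ab(3)[of x a] ab(3)[of x b] zero[of "(x, a)"] zero[of "(x, b)"]
      by (auto simp: half_plane_def)
    ultimately show ?thesis by simp
  qed
  have "(LINT z:half_plane|lborel. q' z) = (\<integral>x. (\<integral>y. indicator half_plane (x, y) *\<^sub>R q' (x, y) \<partial>lborel) \<partial>lborel)"
    using lborel_pair.integral_fst'[OF i] by (simp add: lborel_prod set_lebesgue_integral_def)
  then show ?thesis unfolding inner by simp
qed

lemma powr_sixth_square: "((P::real) powr (1 / 6))\<^sup>2 = P powr (1 / 3)"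
  by (simp add: power2_eq_square flip: powr_add)

text \<open>
  Put \<open>F = sqrt y * f\<close>. Then the energy of \<open>F\<close> minus a quarter of its squared \<open>L^2\<close> norm becomes the energy
  of \<open>f\<close> for the weight \<open>y\<close>, up to the integral of the vertical derivative of \<open>norm F ^ 2 / (2 * y)\<close>, which vanishes
  because the support is compact; and the \<open>L^6\<close> norm becomes the one for the weight \<open>y\<close>.
\<close>

lemma hyperbolic_sobolev_poincare:
  fixes F :: "real \<times> real \<Rightarrow> 'k::real_inner"
  assumes F: "C1_compact_support F"
  shows "3 / 4 * pi powr (2 / 3) * (Lp_norm 6 F)\<^sup>2
    \<le> (\<integral>z. (norm (hyp_grad F z))\<^sup>2 \<partial>hyp_measure) - 1 / 4 * (\<integral>z. (norm (F z))\<^sup>2 \<partial>hyp_measure)"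
proof -
  define K where "K = half_plane \<inter> closure {z \<in> half_plane. F z \<noteq> 0}"
  have C1: "C1_on F half_plane" and K: "compact K" "K \<subseteq> half_plane"
    using F by (auto simp: C1_compact_support_def K_def)
  have F0: "F z = 0" if "z \<in> half_plane" "z \<notin> K" for z
    using that closure_subset[of "{z \<in> half_plane. F z \<noteq> 0}"] by (auto simp: K_def)
  have cF: "continuous_on half_plane F"
    using C1 unfolding C1_on_def by (meson continuous_at_imp_continuous_on has_derivative_continuous)
  obtain Fx Fy where cFx: "continuous_on half_plane Fx" and cFy: "continuous_on half_plane Fy"
    and Fx: "\<And>x y. 0 < y \<Longrightarrow> ((\<lambda>t. F (t, y)) has_vector_derivative Fx (x, y)) (at x)"
    and Fy: "\<And>x y. 0 < y \<Longrightarrow> ((\<lambda>t. F (x, t)) has_vector_derivative Fy (x, y)) (at y)"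
    using C1_on_half_plane_partials[OF C1] by metis
  have op: "open (half_plane - K)" using open_half_plane compact_imp_closed[OF K(1)] by (rule open_Diff)
  have D0: "Fx z = 0 \<and> Fy z = 0" if z: "z \<in> half_plane" "z \<notin> K" for z
  proof -
    obtain x y where zxy: "z = (x, y)" and y: "0 < y" using z(1) by (cases z) (auto simp: half_plane_def)
    have ox: "open ((\<lambda>t. (t, y)) -` (half_plane - K))" and oy: "open ((\<lambda>t. (x, t)) -` (half_plane - K))"
      by (intro open_vimage op continuous_intros)+
    have "((\<lambda>t. F (t, y)) has_vector_derivative 0) (at x)"
      by (rule has_vector_derivative_transform_within_open[OF has_vector_derivative_const ox])
        (use z zxy F0 in auto)
    moreover have "((\<lambda>t. F (x, t)) has_vector_derivative 0) (at y)"
      by (rule has_vector_derivative_transform_within_open[OF has_vector_derivative_const oy])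
        (use z zxy F0 in auto)
    ultimately show ?thesis using Fx[OF y, of x] Fy[OF y, of x] zxy vector_derivative_unique_at by blast
  qed
  have ne: "snd z \<noteq> 0" "0 < snd z" if "z \<in> half_plane" for z using that by (auto simp: half_plane_def)
  \<comment> \<open>\<open>fx\<close> and \<open>fy\<close> are the partial derivatives of \<open>f = F / sqrt y\<close>\<close>
  define f where "f z = (1 / sqrt (snd z)) *\<^sub>R F z" for z
  define fx where "fx z = (1 / sqrt (snd z)) *\<^sub>R Fx z" for z
  define fy where "fy z = (1 / sqrt (snd z)) *\<^sub>R Fy z - (1 / (2 * snd z * sqrt (snd z))) *\<^sub>R F z" for z
  have cf: "continuous_on half_plane f" "continuous_on half_plane fx" "continuous_on half_plane fy"
    unfolding f_def fx_def fy_def using ne by (auto intro!: continuous_intros cF cFx cFy)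
  have dfx: "((\<lambda>t. f (t, y)) has_vector_derivative fx (x, y)) (at x)" if "0 < y" for x y
    unfolding f_def fx_def snd_conv
    by (rule bounded_linear.has_vector_derivative[OF bounded_linear_scaleR_right Fx[OF that]])
  have dfy: "((\<lambda>t. f (x, t)) has_vector_derivative fy (x, y)) (at y)" if "0 < y" for x y
  proof -
    have r: "((\<lambda>t. 1 / sqrt t) has_real_derivative - (1 / (2 * y * sqrt y))) (at y)"
      using that by (auto intro!: derivative_eq_intros simp: field_simps)
    from has_vector_derivative_scaleR[OF r Fy[OF that, of x]] show ?thesis
      by (simp add: f_def fy_def)
  qed
  obtain B where bd: "\<And>x y. 0 < y \<Longrightarrow> (norm (f (x, y)))\<^sup>2 \<le> B / (1 + x\<^sup>2 + y\<^sup>2)"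
  proof -
    define \<phi> where "\<phi> z = (norm (f z))\<^sup>2 * (1 + (fst z)\<^sup>2 + (snd z)\<^sup>2)" for z
    have "compact (\<phi> ` K)"
      unfolding \<phi>_def by (intro compact_continuous_image K continuous_intros continuous_on_subset[OF cf(1) K(2)])
    then obtain B where B: "\<And>t. t \<in> \<phi> ` K \<Longrightarrow> \<bar>t\<bar> \<le> B"
      using compact_imp_bounded bounded_iff by (metis real_norm_def)
    show ?thesis
    proof (rule that[of "\<bar>B\<bar>"])
      fix x y :: real assume y: "0 < y"
      have "\<phi> (x, y) \<le> \<bar>B\<bar>"
      proof (cases "(x, y) \<in> K")
        case True
        then have "\<bar>\<phi> (x, y)\<bar> \<le> B" by (intro B imageI)
        then show ?thesis by linarith
      next
        case False
        then have "F (x, y) = 0" using y by (intro F0) (auto simp: half_plane_def)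
        then show ?thesis by (simp add: \<phi>_def f_def)
      qed
      then show "(norm (f (x, y)))\<^sup>2 \<le> \<bar>B\<bar> / (1 + x\<^sup>2 + y\<^sup>2)"
        using one_plus_squares_pos[of x y] by (simp add: \<phi>_def pos_le_divide_eq)
    qed
  qed
  let ?e = "\<lambda>z. snd z * ((norm (fx z))\<^sup>2 + (norm (fy z))\<^sup>2)"
  let ?g = "\<lambda>z. (norm (Fx z))\<^sup>2 + (norm (Fy z))\<^sup>2"
  let ?n = "\<lambda>z. (norm (F z))\<^sup>2 / (snd z)\<^sup>2"
  let ?q = "\<lambda>z. 2 * (F z \<bullet> Fy z) / snd z - (norm (F z))\<^sup>2 / (snd z)\<^sup>2"
  have int: "set_integrable lborel half_plane ?e"
  proof (rule set_integrable_half_plane_compact[OF K])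
    show "continuous_on half_plane ?e" by (intro continuous_intros cf)
    show "?e z = 0" if "z \<in> half_plane" "z \<notin> K" for z
      using F0[OF that] D0[OF that] by (simp add: fx_def fy_def)
  qed
  have int_g: "set_integrable lborel half_plane ?g"
    by (rule set_integrable_half_plane_compact[OF K]) (use D0 in \<open>auto intro!: continuous_intros cFx cFy\<close>)
  have int_n: "set_integrable lborel half_plane ?n"
    by (rule set_integrable_half_plane_compact[OF K]) (use F0 ne in \<open>auto intro!: continuous_intros cF\<close>)
  have cq: "continuous_on half_plane ?q"
    using ne by (auto intro!: continuous_intros cF cFy)
  have int_q: "set_integrable lborel half_plane ?q"
    by (rule set_integrable_half_plane_compact[OF K cq]) (use F0 in auto)
  \<comment> \<open>\<open>?q\<close> is the vertical derivative of \<open>norm F ^ 2 / y\<close>\<close>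
  have q0: "(LINT z:half_plane|lborel. ?q z) = 0"
  proof (rule integral_vertical_derivative_zero[OF K _ cq, where q = "\<lambda>z. (norm (F z))\<^sup>2 / snd z"])
    fix x y :: real assume y: "0 < y"
    have "((\<lambda>t. F (x, t) \<bullet> F (x, t)) has_vector_derivative F (x, y) \<bullet> Fy (x, y) + Fy (x, y) \<bullet> F (x, y)) (at y)"
      by (rule bounded_bilinear.has_vector_derivative[OF bounded_bilinear_inner Fy[OF y] Fy[OF y]])
    then have 1: "((\<lambda>t. (norm (F (x, t)))\<^sup>2) has_real_derivative 2 * (F (x, y) \<bullet> Fy (x, y))) (at y)"
      by (simp add: has_real_derivative_iff_has_vector_derivative power2_norm_eq_inner inner_commute)
    have e: "(a * y - b * 1) / (y * y) = a / y - b / y\<^sup>2" for a b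
      using y by (simp add: field_simps power2_eq_square)
    from DERIV_divide[OF 1 DERIV_ident] y
    show "((\<lambda>t. (norm (F (x, t)))\<^sup>2 / snd (x, t)) has_real_derivative ?q (x, y)) (at y)"
      unfolding snd_conv e by simp
  qed (use F0 in auto)
  have norm6: "norm v powr 6 = norm v ^ 6" for v :: 'k by simp
  have Lp: "(Lp_norm 6 F)\<^sup>2 = (LINT z:half_plane|lborel. snd z * norm (f z) ^ 6) powr (1 / 3)"
  proof -
    have "(\<integral>z. norm (F z) powr 6 \<partial>hyp_measure) = (LINT z:half_plane|lborel. norm (F z) ^ 6 / (snd z)\<^sup>2)"
      unfolding norm6 by (intro hyp_measure_integral continuous_intros cF)
    also have "\<dots> = (LINT z:half_plane|lborel. snd z * norm (f z) ^ 6)"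
    proof (rule set_lebesgue_integral_cong)
      show "\<forall>z. z \<in> half_plane \<longrightarrow> norm (F z) ^ 6 / (snd z)\<^sup>2 = snd z * norm (f z) ^ 6"
      proof (intro allI impI)
        fix z assume "z \<in> half_plane"
        then have y: "0 < snd z" by (rule ne)
        have "sqrt (snd z) ^ 6 = ((sqrt (snd z))\<^sup>2) ^ 3" by (simp flip: power_mult)
        then have s6: "sqrt (snd z) ^ 6 = snd z ^ 3" using y by simp
        have "norm (f z) ^ 6 = norm (F z) ^ 6 / snd z ^ 3"
          using y by (simp add: f_def power_divide s6)
        then show "norm (F z) ^ 6 / (snd z)\<^sup>2 = snd z * norm (f z) ^ 6"
          using y by (simp add: power2_eq_square power3_eq_cube)
      qed
    qed (use half_plane_borel in simp)
    finally show ?thesis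
      unfolding Lp_norm_def by (simp add: powr_sixth_square)
  qed
  have D: "(\<integral>z. (norm (hyp_grad F z))\<^sup>2 \<partial>hyp_measure) = (LINT z:half_plane|lborel. ?g z)"
  proof -
    have hg: "(norm (hyp_grad F z))\<^sup>2 = (snd z)\<^sup>2 * ?g z" if "z \<in> half_plane" for z
    proof -
      obtain x y where z: "z = (x, y)" and y: "0 < y" using \<open>z \<in> half_plane\<close> by (cases z) (auto simp: half_plane_def)
      have "grad F z = (Fx z, Fy z)" unfolding z by (rule grad_eqI[OF y refl Fx[OF y] Fy[OF y]])
      then show ?thesis by (simp add: hyp_grad_def power_mult_distrib norm_Pair distrib_left)
    qed
    have "continuous_on half_plane (\<lambda>z. (snd z)\<^sup>2 * ?g z)" by (intro continuous_intros cFx cFy)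
    then have "continuous_on half_plane (\<lambda>z. (norm (hyp_grad F z))\<^sup>2)"
      by (rule continuous_on_eq) (simp add: hg)
    then have "(\<integral>z. (norm (hyp_grad F z))\<^sup>2 \<partial>hyp_measure)
        = (LINT z:half_plane|lborel. (norm (hyp_grad F z))\<^sup>2 / (snd z)\<^sup>2)"
      by (rule hyp_measure_integral)
    also have "\<dots> = (LINT z:half_plane|lborel. ?g z)"
      by (rule set_lebesgue_integral_cong) (use half_plane_borel hg ne in auto)
    finally show ?thesis .
  qed
  have N: "(\<integral>z. (norm (F z))\<^sup>2 \<partial>hyp_measure) = (LINT z:half_plane|lborel. ?n z)"
    by (intro hyp_measure_integral continuous_intros cF)
  have "(LINT z:half_plane|lborel. ?e z) = (LINT z:half_plane|lborel. ?g z - 1 / 4 * ?n z - 1 / 2 * ?q z)"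
  proof (rule set_lebesgue_integral_cong)
    show "\<forall>z. z \<in> half_plane \<longrightarrow> ?e z = ?g z - 1 / 4 * ?n z - 1 / 2 * ?q z"
    proof (intro allI impI)
      fix z assume "z \<in> half_plane"
      then have y: "0 < snd z" by (rule ne)
      have "snd z * (norm (fx z))\<^sup>2 = (norm (Fx z))\<^sup>2"
        using y by (simp add: fx_def power_divide)
      moreover have "snd z * (norm (fy z))\<^sup>2 = (norm (Fy z))\<^sup>2 - (F z \<bullet> Fy z) / snd z + (norm (F z))\<^sup>2 / (4 * (snd z)\<^sup>2)"
      proof -
        have "fy z = (1 / sqrt (snd z)) *\<^sub>R (Fy z - (1 / (2 * snd z)) *\<^sub>R F z)"
          by (simp add: fy_def algebra_simps)
        then have "snd z * (norm (fy z))\<^sup>2 = (norm (Fy z - (1 / (2 * snd z)) *\<^sub>R F z))\<^sup>2"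
          using y by (simp add: power_divide)
        also have "\<dots> = (norm (Fy z))\<^sup>2 - (F z \<bullet> Fy z) / snd z + (norm (F z))\<^sup>2 / (4 * (snd z)\<^sup>2)"
        proof -
          have "(a - k *\<^sub>R b) \<bullet> (a - k *\<^sub>R b) = a \<bullet> a - 2 * k * (b \<bullet> a) + k\<^sup>2 * (b \<bullet> b)" for a b :: 'k and k
            by (simp add: inner_diff_left inner_diff_right inner_commute power2_eq_square algebra_simps)
          from this[of "Fy z" "1 / (2 * snd z)" "F z"] show ?thesis
            unfolding power2_norm_eq_inner by (simp add: power_divide power_mult_distrib)
        qed
        finally show ?thesis .
      qed
      ultimately show "?e z = ?g z - 1 / 4 * ?n z - 1 / 2 * ?q z"
        by (simp add: algebra_simps)
    qed
  qed (use half_plane_borel in simp)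
  also have "\<dots> = (LINT z:half_plane|lborel. ?g z) - 1 / 4 * (LINT z:half_plane|lborel. ?n z)
      - 1 / 2 * (LINT z:half_plane|lborel. ?q z)"
  proof -
    have n4: "set_integrable lborel half_plane (\<lambda>z. 1 / 4 * ?n z)"
      and q2: "set_integrable lborel half_plane (\<lambda>z. 1 / 2 * ?q z)"
      by (intro set_integrable_mult_right int_n int_q)+
    show ?thesis
      unfolding set_integral_diff(2)[OF set_integral_diff(1)[OF int_g n4] q2]
        set_integral_diff(2)[OF int_g n4] set_integral_mult_right ..
  qed
  finally have E: "(LINT z:half_plane|lborel. ?e z)
      = (LINT z:half_plane|lborel. ?g z) - 1 / 4 * (LINT z:half_plane|lborel. ?n z)"
    using q0 by simp
  show ?thesis
    unfolding D N E[symmetric] Lp by (rule weighted_sobolev[OF cf dfx dfy bd int])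
qed

section \<open>Sharpness\<close>

text \<open>
  Reduces membership in the limiting class, the norm and the energy of \<open>F = y powr a * u\<close> to two integrals
  of \<open>u\<close>: the energy is designed so that the factor \<open>y powr a\<close> disappears.
\<close>

lemma limiting_class_of_profile:
  fixes u ux uy :: "real \<times> real \<Rightarrow> real" and F :: "real \<times> real \<Rightarrow> 'k::{real_normed_field, euclidean_space}"
  assumes F: "F = (\<lambda>z. of_real (snd z powr a * u z))"
    and c: "continuous_on half_plane u" "continuous_on half_plane ux" "continuous_on half_plane uy"
    and dx: "\<And>x y. 0 < y \<Longrightarrow> ((\<lambda>t. u (t, y)) has_real_derivative ux (x, y)) (at x)"
    and dy: "\<And>x y. 0 < y \<Longrightarrow> ((\<lambda>t. u (x, t)) has_real_derivative uy (x, y)) (at y)"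
    and P: "has_bochner_integral lborel (\<lambda>z. indicator half_plane z *\<^sub>R (snd z powr (6 * a - 2) * u z ^ 6)) P"
    and E: "has_bochner_integral lborel (\<lambda>z. indicator half_plane z *\<^sub>R (snd z powr (2 * a) * ((ux z)\<^sup>2 + (uy z)\<^sup>2))) E"
  shows "F \<in> limiting_class a" "(Lp_norm 6 F)\<^sup>2 = P powr (1 / 3)" "energy a F = E"
proof -
  have ne: "0 < snd z" "snd z \<noteq> 0" if "z \<in> half_plane" for z :: "real \<times> real"
    using that by (auto simp: half_plane_def)
  have of_real_deriv: "((\<lambda>t. of_real (v t) :: 'k) has_vector_derivative of_real v') (at t)"
    if "(v has_real_derivative v') (at t)" for v v' t
    using that by (intro bounded_linear.has_vector_derivative[OF bounded_linear_of_real])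
      (simp add: has_real_derivative_iff_has_vector_derivative)
  have cF: "continuous_on half_plane F"
    unfolding F using ne by (intro continuous_intros c) auto
  have C1: "C1_on F half_plane"
  proof (rule C1_on_half_planeI)
    show "continuous_on half_plane (\<lambda>z. of_real (snd z powr a * ux z) :: 'k)"
      using ne by (intro continuous_intros c) auto
    show "continuous_on half_plane (\<lambda>z. of_real (a * snd z powr (a - 1) * u z + uy z * snd z powr a) :: 'k)"
      using ne by (intro continuous_intros c) auto
    fix x y :: real assume y: "0 < y"
    show "((\<lambda>t. F (t, y)) has_vector_derivative of_real (snd (x, y) powr a * ux (x, y))) (at x)"
      unfolding F snd_conv by (intro of_real_deriv DERIV_cmult dx y)
    show "((\<lambda>t. F (x, t)) has_vector_derivative
        of_real (a * snd (x, y) powr (a - 1) * u (x, y) + uy (x, y) * snd (x, y) powr a)) (at y)"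
      unfolding F snd_conv by (intro of_real_deriv DERIV_mult dy y has_real_derivative_powr)
  qed
  have n6: "norm (F z) powr 6 = norm (F z) ^ 6" for z by simp
  have F6: "norm (F z) ^ 6 / (snd z)\<^sup>2 = snd z powr (6 * a - 2) * u z ^ 6" if "z \<in> half_plane" for z
  proof -
    have y: "0 < snd z" by (rule ne[OF that])
    have "(snd z powr a) ^ 6 = snd z powr (6 * a)"
      using y by (simp add: powr_powr mult.commute flip: powr_realpow)
    moreover have "snd z powr (6 * a - 2) = snd z powr (6 * a) / (snd z)\<^sup>2"
      using y by (simp add: powr_diff)
    ultimately show ?thesis
      unfolding F norm_of_real using y by (simp add: abs_mult power_mult_distrib power_even_abs)
  qed
  have i6: "(\<lambda>z. indicator half_plane z *\<^sub>R (norm (F z) ^ 6 / (snd z)\<^sup>2))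
      = (\<lambda>z. indicator half_plane z *\<^sub>R (snd z powr (6 * a - 2) * u z ^ 6))"
    using F6 by (auto simp: indicator_def fun_eq_iff)
  have c6: "continuous_on half_plane (\<lambda>z. norm (F z) ^ 6)" by (intro continuous_intros cF)
  have Lp: "in_Lp 6 F"
    unfolding in_Lp_def n6 hyp_measure_integral(2)[OF c6] set_integrable_def i6
    using borel_measurable_hyp_measure[OF cF] P by (simp add: has_bochner_integral_iff)
  have "(\<integral>z. norm (F z) powr 6 \<partial>hyp_measure) = P"
    unfolding n6 hyp_measure_integral(1)[OF c6] set_lebesgue_integral_def i6
    by (rule has_bochner_integral_integral_eq[OF P])
  then show "(Lp_norm 6 F)\<^sup>2 = P powr (1 / 3)"
    unfolding Lp_norm_def by (simp add: powr_sixth_square)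
  have ed: "energy_density a F z = snd z powr (2 * a) * ((ux z)\<^sup>2 + (uy z)\<^sup>2)" if "z \<in> half_plane" for z
  proof -
    obtain x y where z: "z = (x, y)" and y: "0 < y" using \<open>z \<in> half_plane\<close> by (cases z) (auto simp: half_plane_def)
    have "grad (\<lambda>w. snd w powr - a *\<^sub>R F w) (x, y) = (of_real (ux (x, y)), of_real (uy (x, y)))"
    proof (rule grad_eqI[OF y, where F = "\<lambda>w. of_real (u w)"])
      fix w :: "real \<times> real" assume "w \<in> half_plane"
      then have "snd w powr - a * snd w powr a = 1" using ne[of w] by (simp flip: powr_add)
      then have e: "snd w powr - a * (snd w powr a * u w) = u w" by (simp flip: mult.assoc)
      show "snd w powr - a *\<^sub>R F w = of_real (u w)"
        by (simp only: F scaleR_conv_of_real of_real_mult[symmetric] e)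
    qed (intro of_real_deriv dx dy y)+
    then show ?thesis by (simp add: energy_density_def z norm_Pair)
  qed
  have ie: "(\<lambda>z. indicator half_plane z *\<^sub>R energy_density a F z)
      = (\<lambda>z. indicator half_plane z *\<^sub>R (snd z powr (2 * a) * ((ux z)\<^sup>2 + (uy z)\<^sup>2)))"
    using ed by (auto simp: indicator_def fun_eq_iff)
  show "F \<in> limiting_class a"
  proof -
    have "set_integrable lborel half_plane (energy_density a F)"
      unfolding set_integrable_def ie using E by (simp only: has_bochner_integral_iff)
    with C1 Lp show ?thesis by (simp add: limiting_class_def)
  qed
  show "energy a F = E"
    unfolding energy_def set_lebesgue_integral_def ie by (rule has_bochner_integral_integral_eq[OF E])
qed

lemma bubble_mass:
  "has_bochner_integral lborel
    (\<lambda>z. indicator half_plane z *\<^sub>R (snd z / (1 + (fst z)\<^sup>2 + (snd z)\<^sup>2) ^ 3)) (pi / 8)"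
proof (rule has_bochner_integral_iterated)
  show "(\<lambda>z. indicator half_plane z *\<^sub>R (snd z / (1 + (fst z)\<^sup>2 + (snd z)\<^sup>2) ^ 3)) \<in> borel_measurable borel"
    using one_plus_squares_pos
    by (intro borel_measurable_continuous_on_indicator half_plane_borel continuous_intros)
       (metis less_irrefl power_eq_0_iff)
  show "has_bochner_integral lborel (\<lambda>y. indicator half_plane (x, y) *\<^sub>R (snd (x, y) / (1 + (fst (x, y))\<^sup>2 + (snd (x, y))\<^sup>2) ^ 3))
      ((1 / (1 + x\<^sup>2)\<^sup>2) / 4)" for x
    using integral_y_over_cube[of x] by (simp add: half_plane_def indicator_def mult.commute)
  show "has_bochner_integral lborel (\<lambda>x::real. (1 / (1 + x\<^sup>2)\<^sup>2) / 4) (pi / 8)"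
    using has_bochner_integral_divide_zero[OF integral_inverse_square, of 4] by simp
  show "0 \<le> indicator half_plane z *\<^sub>R (snd z / (1 + (fst z)\<^sup>2 + (snd z)\<^sup>2) ^ 3)" for z
    using one_plus_squares_pos[of "fst z" "snd z"] by (auto simp: half_plane_def indicator_def intro!: divide_nonneg_pos)
qed

lemma one_third_power:
  fixes t :: real
  assumes "0 \<le> t" "0 < s" "t ^ 3 = s"
  shows "s powr (1 / 3) = t"
proof -
  have t: "0 < t" using assms by (cases "t = 0") auto
  have e: "s = t powr 3" using assms(3) powr_realpow[OF t, of 3] by simp
  show ?thesis unfolding e powr_powr using t by simp
qed

lemma pi_cube_root: "pi powr (- 2 / 3) * pi = pi powr (1 / 3)"
  using powr_add[of pi "- 2 / 3" 1] by simp

text \<open>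
  The extremal function \<open>u = (1 + x\<^sup>2 + y\<^sup>2) ^ (-1/2)\<close> attains equality with the constant \<open>4/3 * pi powr (-2/3)\<close>: its mass is
  \<open>pi / 8\<close> and its energy \<open>3 * pi / 8\<close>.
\<close>

lemma sharpness_exponent_half:
  assumes "C < 4 / 3 * pi powr (- 2 / 3)"
  shows "\<exists>F :: real \<times> real \<Rightarrow> 'k::{real_normed_field, euclidean_space}.
    F \<in> limiting_class (1 / 2) \<and> C * energy (1 / 2) F < (Lp_norm 6 F)\<^sup>2"
proof -
  define s :: "real \<times> real \<Rightarrow> real" where "s z = 1 + (fst z)\<^sup>2 + (snd z)\<^sup>2" for z
  have s: "0 < s z" for z unfolding s_def by (rule one_plus_squares_pos)
  have s0: "s z \<noteq> 0" for z using s[of z] by simp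
  define u where "u z = 1 / sqrt (s z)" for z
  define ux where "ux z = - (fst z / (s z * sqrt (s z)))" for z
  define uy where "uy z = - (snd z / (s z * sqrt (s z)))" for z
  define F :: "real \<times> real \<Rightarrow> 'k" where "F = (\<lambda>z. of_real (snd z powr (1 / 2) * u z))"
  have cs: "continuous_on half_plane s" unfolding s_def by (intro continuous_intros)
  have d: "((\<lambda>t. 1 / sqrt (v t)) has_real_derivative - (v' / 2 / (v t * sqrt (v t)))) (at t)"
    if "(v has_real_derivative v') (at t)" "0 < v t" for v v' and t :: real
  proof -
    have "((\<lambda>r. 1 / sqrt r) has_real_derivative - (1 / (2 * r * sqrt r))) (at r)" if "0 < r" for r :: real
      using that by (auto intro!: derivative_eq_intros simp: field_simps)
    from DERIV_chain2[OF this[OF that(2)] that(1)] show ?thesis by (simp add: field_simps)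
  qed
  have cu: "continuous_on half_plane u" "continuous_on half_plane ux" "continuous_on half_plane uy"
    unfolding u_def ux_def uy_def using s0 by (auto intro!: continuous_intros cs)
  have dx: "((\<lambda>t. u (t, y)) has_real_derivative ux (x, y)) (at x)" for x y
  proof -
    have "((\<lambda>t. s (t, y)) has_real_derivative 2 * x) (at x)"
      unfolding s_def by (auto intro!: derivative_eq_intros)
    from d[OF this s] show ?thesis by (simp add: u_def ux_def)
  qed
  have dy: "((\<lambda>t. u (x, t)) has_real_derivative uy (x, y)) (at y)" for x y
  proof -
    have "((\<lambda>t. s (x, t)) has_real_derivative 2 * y) (at y)"
      unfolding s_def by (auto intro!: derivative_eq_intros)
    from d[OF this s] show ?thesis by (simp add: u_def uy_def)
  qed
  have P: "has_bochner_integral lborel (\<lambda>z. indicator half_plane z *\<^sub>R (snd z powr (6 * (1 / 2) - 2) * u z ^ 6)) (pi / 8)"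
  proof -
    have "u z ^ 6 = 1 / s z ^ 3" for z
    proof -
      have "sqrt (s z) ^ 6 = ((sqrt (s z))\<^sup>2) ^ 3" by (simp flip: power_mult)
      then show ?thesis using s[of z] by (simp add: u_def power_divide)
    qed
    then have "(\<lambda>z. indicator half_plane z *\<^sub>R (snd z powr (6 * (1 / 2) - 2) * u z ^ 6))
        = (\<lambda>z. indicator half_plane z *\<^sub>R (snd z / (1 + (fst z)\<^sup>2 + (snd z)\<^sup>2) ^ 3))"
      by (auto simp: half_plane_def indicator_def fun_eq_iff s_def)
    then show ?thesis using bubble_mass by simp
  qed
  have E: "has_bochner_integral lborel (\<lambda>z. indicator half_plane z *\<^sub>R (snd z powr (2 * (1 / 2)) * ((ux z)\<^sup>2 + (uy z)\<^sup>2))) (3 * pi / 8)"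
  proof -
    have "(ux z)\<^sup>2 + (uy z)\<^sup>2 = ((fst z)\<^sup>2 + (snd z)\<^sup>2) / s z ^ 3" for z
    proof -
      have "(s z * sqrt (s z))\<^sup>2 = (s z)\<^sup>2 * s z"
        by (simp only: power_mult_distrib real_sqrt_pow2[OF less_imp_le[OF s]])
      then have "(s z * sqrt (s z))\<^sup>2 = s z ^ 3" by (simp only: power2_eq_square power3_eq_cube)
      then show ?thesis by (simp only: ux_def uy_def power2_minus power_divide add_divide_distrib)
    qed
    then have "(\<lambda>z. indicator half_plane z *\<^sub>R (snd z powr (2 * (1 / 2)) * ((ux z)\<^sup>2 + (uy z)\<^sup>2)))
        = (\<lambda>z. indicator half_plane z *\<^sub>R (snd z * ((fst z)\<^sup>2 + (snd z)\<^sup>2) / (1 + (fst z)\<^sup>2 + (snd z)\<^sup>2) ^ 3))"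
      by (auto simp: half_plane_def indicator_def fun_eq_iff s_def)
    then show ?thesis using bubble_energy by simp
  qed
  note L = limiting_class_of_profile[OF F_def cu dx dy P E]
  have "(pi powr (1 / 3)) ^ 3 = pi"
    using powr_realpow[of "pi powr (1 / 3)" 3] by (simp add: powr_powr)
  then have "(pi / 8) powr (1 / 3) = pi powr (1 / 3) / 2"
    by (intro one_third_power) (simp_all add: power_divide)
  moreover have "C * (3 * pi / 8) < 4 / 3 * pi powr (- 2 / 3) * (3 * pi / 8)"
    using assms by (intro mult_strict_right_mono) auto
  moreover have "4 / 3 * pi powr (- 2 / 3) * (3 * pi / 8) = pi powr (1 / 3) / 2"
    using pi_cube_root by simp
  ultimately have "C * (3 * pi / 8) < (pi / 8) powr (1 / 3)" by linarith
  then show ?thesis by (intro exI[of _ F] conjI L(1)) (simp only: L(2,3))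
qed

lemma integral_x_shifted:
  fixes a :: real
  assumes "0 < a"
  shows "has_bochner_integral lborel (\<lambda>x. 1 / ((a\<^sup>2 + x\<^sup>2) * sqrt (a\<^sup>2 + x\<^sup>2))) (2 / a\<^sup>2)"
proof -
  have p: "0 < a\<^sup>2 + x\<^sup>2" for x using assms by (intro add_pos_nonneg) auto
  have p0: "a\<^sup>2 + x\<^sup>2 \<noteq> 0" for x by (metis p less_irrefl)
  have "has_bochner_integral lborel (\<lambda>x. 1 / ((a\<^sup>2 + x\<^sup>2) * sqrt (a\<^sup>2 + x\<^sup>2))) (inverse (a\<^sup>2) - - inverse (a\<^sup>2))"
  proof (rule FTC_nonneg_line)
    show "((\<lambda>x. x / (a\<^sup>2 * sqrt (a\<^sup>2 + x\<^sup>2))) has_real_derivative 1 / ((a\<^sup>2 + x\<^sup>2) * sqrt (a\<^sup>2 + x\<^sup>2))) (at x)" for x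
    proof -
      let ?r = "sqrt (a\<^sup>2 + x\<^sup>2)"
      have r: "0 < ?r" "?r\<^sup>2 = a\<^sup>2 + x\<^sup>2" using p[of x] by (auto simp: less_imp_le)
      have "((\<lambda>x. a\<^sup>2 + x\<^sup>2) has_real_derivative 2 * x) (at x)" by (auto intro!: derivative_eq_intros)
      from DERIV_cmult[OF DERIV_chain2[OF DERIV_real_sqrt[OF p] this], of "a\<^sup>2"]
      have "((\<lambda>x. a\<^sup>2 * sqrt (a\<^sup>2 + x\<^sup>2)) has_real_derivative a\<^sup>2 * (inverse ?r / 2 * (2 * x))) (at x)" .
      from DERIV_divide[OF DERIV_ident this] r assms
      have "((\<lambda>x. x / (a\<^sup>2 * sqrt (a\<^sup>2 + x\<^sup>2))) has_real_derivative
        (1 * (a\<^sup>2 * ?r) - x * (a\<^sup>2 * (inverse ?r / 2 * (2 * x)))) / ((a\<^sup>2 * ?r) * (a\<^sup>2 * ?r))) (at x)" by simp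
      also have "(1 * (a\<^sup>2 * ?r) - x * (a\<^sup>2 * (inverse ?r / 2 * (2 * x)))) / ((a\<^sup>2 * ?r) * (a\<^sup>2 * ?r))
          = (?r\<^sup>2 - x\<^sup>2) / (a\<^sup>2 * (?r\<^sup>2 * ?r))"
      proof -
        have "(1 * (c * r) - x * (c * (inverse r / 2 * (2 * x)))) / ((c * r) * (c * r)) = (r\<^sup>2 - x\<^sup>2) / (c * (r\<^sup>2 * r))"
          if "c \<noteq> 0" "r \<noteq> 0" for c r :: real
          using that by (simp add: field_simps power2_eq_square)
        from this[of "a\<^sup>2" ?r] show ?thesis using r(1) assms by (simp only: power_eq_0_iff) simp
      qed
      also have "\<dots> = 1 / ((a\<^sup>2 + x\<^sup>2) * ?r)"
        unfolding r(2) using assms by simp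
      finally show ?thesis .
    qed
    show "((\<lambda>x. x / (a\<^sup>2 * sqrt (a\<^sup>2 + x\<^sup>2))) \<longlongrightarrow> - inverse (a\<^sup>2)) at_bot" using assms by real_asymp
    show "((\<lambda>x. x / (a\<^sup>2 * sqrt (a\<^sup>2 + x\<^sup>2))) \<longlongrightarrow> inverse (a\<^sup>2)) at_top" using assms by real_asymp
    show "continuous_on UNIV (\<lambda>x. 1 / ((a\<^sup>2 + x\<^sup>2) * sqrt (a\<^sup>2 + x\<^sup>2)))"
      using p0 by (intro continuous_intros) auto
    show "0 \<le> 1 / ((a\<^sup>2 + x\<^sup>2) * sqrt (a\<^sup>2 + x\<^sup>2))" for x using p[of x] by simp
  qed
  then show ?thesis by (simp add: inverse_eq_divide)
qed

lemma integral_grushin_mass: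
  "has_bochner_integral lborel (\<lambda>y::real. indicator {0<..} y *\<^sub>R (1 / sqrt y * (2 / (1 + y)\<^sup>2))) pi"
proof -
  have "has_bochner_integral lborel (\<lambda>y::real. indicator {0<..} y *\<^sub>R (1 / sqrt y * (2 / (1 + y)\<^sup>2))) (pi - 0)"
  proof (rule FTC_nonneg_half_line)
    show "((\<lambda>y. 2 * (arctan (sqrt y) + sqrt y / (1 + y))) has_real_derivative 1 / sqrt y * (2 / (1 + y)\<^sup>2)) (at y)"
      if "0 < y" for y :: real
    proof -
      have sqrt_factor: "2 * (2 / q * (inverse r / 2)) = 1 / r * (2 / q)" for q r :: real
        by (simp add: inverse_eq_divide)
      from DERIV_cmult[OF DERIV_chain2[OF angle_cdf_derivative DERIV_real_sqrt[OF that]], of 2]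
      have "((\<lambda>y. 2 * angle_cdf (sqrt y)) has_real_derivative 2 * (2 / (1 + y)\<^sup>2 * (inverse (sqrt y) / 2))) (at y)"
        using that by (simp only: real_sqrt_pow2[OF less_imp_le[OF that]])
      also have "2 * (2 / (1 + y)\<^sup>2 * (inverse (sqrt y) / 2)) = 1 / sqrt y * (2 / (1 + y)\<^sup>2)"
        by (rule sqrt_factor)
      finally show ?thesis
        by (rule has_field_derivative_transform_within_open[where S = "{0<..}"])
          (use that in \<open>auto simp: angle_cdf_def\<close>)
    qed
    show "continuous_on {0<..} (\<lambda>y::real. 1 / sqrt y * (2 / (1 + y)\<^sup>2))"
      by (intro continuous_intros) auto
    have "isCont (\<lambda>y::real. 2 * (arctan (sqrt y) + sqrt y / (1 + y))) 0" by (intro continuous_intros) simp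
    then show "((\<lambda>y::real. 2 * (arctan (sqrt y) + sqrt y / (1 + y))) \<longlongrightarrow> 0) (at_right 0)"
      by (simp add: isCont_def filterlim_at_split)
    show "((\<lambda>y::real. 2 * (arctan (sqrt y) + sqrt y / (1 + y))) \<longlongrightarrow> pi) at_top" by real_asymp
  qed auto
  then show ?thesis by (simp only: diff_zero)
qed

lemma integral_grushin_energy:
  "has_bochner_integral lborel (\<lambda>y::real. indicator {0<..} y *\<^sub>R (sqrt y / 4 * (2 / (1 + y)\<^sup>2))) (pi / 4)"
proof -
  have "has_bochner_integral lborel (\<lambda>y::real. indicator {0<..} y *\<^sub>R (sqrt y / 4 * (2 / (1 + y)\<^sup>2))) (pi / 4 - 0)"
  proof (rule FTC_nonneg_half_line)
    show "((\<lambda>y. (arctan (sqrt y) - sqrt y / (1 + y)) / 2) has_real_derivative sqrt y / 4 * (2 / (1 + y)\<^sup>2)) (at y)"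
      if "0 < y" for y :: real
    proof -
      define r where "r = sqrt y"
      have r: "0 < r" "y = r\<^sup>2" using that by (auto simp: r_def)
      have p: "1 + y \<noteq> 0" using that by simp
      have s: "(sqrt has_real_derivative inverse r / 2) (at y)"
        using DERIV_real_sqrt[OF that] by (simp add: r_def)
      have a: "((\<lambda>y. arctan (sqrt y)) has_real_derivative inverse (1 + y) * (inverse r / 2)) (at y)"
        using DERIV_chain2[OF DERIV_arctan s] that by simp
      have b: "((\<lambda>y. sqrt y / (1 + y)) has_real_derivative ((inverse r / 2) * (1 + y) - r * 1) / ((1 + y) * (1 + y))) (at y)"
        unfolding r_def
        by (rule DERIV_divide) (use p that in \<open>auto intro!: derivative_eq_intros DERIV_real_sqrt\<close>)
      have "(inverse q * (inverse r / 2) - ((inverse r / 2) * q - r * 1) / (q * q)) / 2 = r / 4 * (2 / q\<^sup>2)"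
        if "q \<noteq> 0" for q
        using that r(1) by (simp add: field_simps power2_eq_square)
      from this[OF p]
      have "(inverse (1 + y) * (inverse r / 2) - ((inverse r / 2) * (1 + y) - r * 1) / ((1 + y) * (1 + y))) / 2
          = r / 4 * (2 / (1 + y)\<^sup>2)" .
      with DERIV_cdivide[OF DERIV_diff[OF a b], of 2]
      have "((\<lambda>y. (arctan (sqrt y) - sqrt y / (1 + y)) / 2) has_real_derivative r / 4 * (2 / (1 + y)\<^sup>2)) (at y)"
        by (simp only:)
      then show ?thesis by (simp only: r_def)
    qed
    show "continuous_on {0<..} (\<lambda>y::real. sqrt y / 4 * (2 / (1 + y)\<^sup>2))"
      by (intro continuous_intros) auto
    show "((\<lambda>y::real. (arctan (sqrt y) - sqrt y / (1 + y)) / 2) \<longlongrightarrow> 0) (at_right 0)" by real_asymp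
    show "((\<lambda>y::real. (arctan (sqrt y) - sqrt y / (1 + y)) / 2) \<longlongrightarrow> pi / 4) at_top" by real_asymp
  qed auto
  then show ?thesis by (simp only: diff_zero)
qed

text \<open>
  The functions of interest for the exponent \<open>1/4\<close> depend on \<open>x\<close> only through \<open>(1 + y)\<^sup>2 + x\<^sup>2\<close>, so integration
  in \<open>x\<close> comes first and leaves the one-dimensional integrals above.
\<close>

lemma has_bochner_integral_shifted_weight:
  fixes g :: "real \<Rightarrow> real"
  assumes g: "continuous_on {0<..} g" "\<And>y. 0 < y \<Longrightarrow> 0 \<le> g y"
    and I: "has_bochner_integral lborel (\<lambda>y. indicator {0<..} y *\<^sub>R (g y * (2 / (1 + y)\<^sup>2))) c"
  shows "has_bochner_integral lborel (\<lambda>z. indicator half_plane z *\<^sub>R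
    (g (snd z) * (1 / (((1 + snd z)\<^sup>2 + (fst z)\<^sup>2) * sqrt ((1 + snd z)\<^sup>2 + (fst z)\<^sup>2))))) c"
proof (rule has_bochner_integral_iterated_swap[OF _ _ _ I])
  have p: "0 < (1 + snd z)\<^sup>2 + (fst z)\<^sup>2" if "z \<in> half_plane" for z
    using that by (intro add_pos_nonneg) (auto simp: half_plane_def)
  have p0: "((1 + snd z)\<^sup>2 + (fst z)\<^sup>2) * sqrt ((1 + snd z)\<^sup>2 + (fst z)\<^sup>2) \<noteq> 0" if "z \<in> half_plane" for z
    using p[OF that] by (metis less_irrefl mult_eq_0_iff real_sqrt_eq_zero_cancel_iff)
  have cg: "continuous_on half_plane (\<lambda>z. g (snd z))"
    by (rule continuous_on_compose2[OF g(1)]) (auto simp: half_plane_def intro!: continuous_intros)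
  show "(\<lambda>z. indicator half_plane z *\<^sub>R
    (g (snd z) * (1 / (((1 + snd z)\<^sup>2 + (fst z)\<^sup>2) * sqrt ((1 + snd z)\<^sup>2 + (fst z)\<^sup>2))))) \<in> borel_measurable borel"
    by (intro borel_measurable_continuous_on_indicator half_plane_borel continuous_intros cg ballI p0)
  show "0 \<le> indicator half_plane z *\<^sub>R
    (g (snd z) * (1 / (((1 + snd z)\<^sup>2 + (fst z)\<^sup>2) * sqrt ((1 + snd z)\<^sup>2 + (fst z)\<^sup>2))))" for z
    using g(2)[of "snd z"] by (auto simp: half_plane_def indicator_def)
  show "has_bochner_integral lborel (\<lambda>x. indicator half_plane (x, y) *\<^sub>R (g (snd (x, y)) *
      (1 / (((1 + snd (x, y))\<^sup>2 + (fst (x, y))\<^sup>2) * sqrt ((1 + snd (x, y))\<^sup>2 + (fst (x, y))\<^sup>2)))))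
     (indicator {0<..} y *\<^sub>R (g y * (2 / (1 + y)\<^sup>2)))" for y
  proof (cases "0 < y")
    case True
    then show ?thesis
      using has_bochner_integral_mult_right[OF integral_x_shifted[of "1 + y"], of "g y"]
      by (simp add: half_plane_def)
  qed (simp add: half_plane_def has_bochner_integral_zero)
qed

text \<open>
  The function \<open>u = ((1 + y)\<^sup>2 + x\<^sup>2) ^ (-1/4)\<close> satisfies equality with the constant \<open>4 * pi powr (-2/3)\<close>: its mass is
  \<open>pi\<close> and its energy \<open>pi / 4\<close>. With \<open>y = t\<^sup>2\<close> it is the extremal function \<open>((1 + t\<^sup>2)\<^sup>2 + x\<^sup>2) ^ (-1/4)\<close> for the
  Sobolev inequality of the Grushin operator. It does not vanish on the boundary line.
\<close>

lemma sharpness_exponent_quarter: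
  assumes "C < 4 * pi powr (- 2 / 3)"
  shows "\<exists>F :: real \<times> real \<Rightarrow> 'k::{real_normed_field, euclidean_space}.
    F \<in> limiting_class (1 / 4) \<and> C * energy (1 / 4) F < (Lp_norm 6 F)\<^sup>2"
proof -
  define s :: "real \<times> real \<Rightarrow> real" where "s z = (1 + snd z)\<^sup>2 + (fst z)\<^sup>2" for z
  have s: "0 < s z" if "z \<in> half_plane" for z
    unfolding s_def using that by (intro add_pos_nonneg) (auto simp: half_plane_def)
  have s': "0 < s (x, y)" if "0 < y" for x y using that by (intro s) (simp add: half_plane_def)
  have s0: "s z \<noteq> 0" if "z \<in> half_plane" for z using s[OF that] by simp
  define u where "u z = 1 / sqrt (sqrt (s z))" for z
  define ux where "ux z = - (fst z / (2 * s z * sqrt (sqrt (s z))))" for z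
  define uy where "uy z = - ((1 + snd z) / (2 * s z * sqrt (sqrt (s z))))" for z
  define F :: "real \<times> real \<Rightarrow> 'k" where "F = (\<lambda>z. of_real (snd z powr (1 / 4) * u z))"
  have cs: "continuous_on half_plane s" unfolding s_def by (intro continuous_intros)
  have d: "((\<lambda>t. 1 / sqrt (sqrt (v t))) has_real_derivative - (v' / 2 / (2 * v t * sqrt (sqrt (v t))))) (at t)"
    if "(v has_real_derivative v') (at t)" "0 < v t" for v v' and t :: real
  proof -
    define r where "r = sqrt (v t)"
    have r: "0 < r" "v t = r * r" using that by (auto simp: r_def)
    have 1: "((\<lambda>r. 1 / sqrt r) has_real_derivative - (1 / (2 * r * sqrt r))) (at r)" if "0 < r" for r :: real
      using that by (auto intro!: derivative_eq_intros simp: field_simps)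
    have 2: "((\<lambda>t. sqrt (v t)) has_real_derivative inverse r / 2 * v') (at t)"
      unfolding r_def by (rule DERIV_chain2[OF DERIV_real_sqrt[OF that(2)] that(1)])
    have "((\<lambda>t. 1 / sqrt (sqrt (v t))) has_real_derivative - (1 / (2 * r * sqrt r)) * (inverse r / 2 * v')) (at t)"
      by (rule DERIV_chain2[OF _ 2]) (use 1[OF r(1)] in \<open>simp add: r_def\<close>)
    also have "- (1 / (2 * r * sqrt r)) * (inverse r / 2 * v') = - (v' / 2 / (2 * v t * sqrt (sqrt (v t))))"
      unfolding r_def[symmetric] r(2) using r(1) by (simp add: field_simps)
    finally show ?thesis .
  qed
  have cu: "continuous_on half_plane u" "continuous_on half_plane ux" "continuous_on half_plane uy"
    unfolding u_def ux_def uy_def using s0 by (auto intro!: continuous_intros cs)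
  have dx: "((\<lambda>t. u (t, y)) has_real_derivative ux (x, y)) (at x)" if "0 < y" for x y
  proof -
    have "((\<lambda>t. s (t, y)) has_real_derivative 2 * x) (at x)"
      unfolding s_def by (auto intro!: derivative_eq_intros)
    from d[OF this s'[OF that]] show ?thesis by (simp add: u_def ux_def)
  qed
  have dy: "((\<lambda>t. u (x, t)) has_real_derivative uy (x, y)) (at y)" if "0 < y" for x y
  proof -
    have "((\<lambda>t. s (x, t)) has_real_derivative 2 * (1 + y)) (at y)"
      unfolding s_def by (auto intro!: derivative_eq_intros)
    from d[OF this s'[OF that]]
    have "((\<lambda>t. u (x, t)) has_real_derivative
        - (2 * (1 + y) / 2 / (2 * s (x, y) * sqrt (sqrt (s (x, y)))))) (at y)" by (simp only: u_def)
    moreover have "2 * (1 + y) / 2 = 1 + y" by simp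
    ultimately show ?thesis by (simp only: uy_def snd_conv)
  qed
  have P: "has_bochner_integral lborel (\<lambda>z. indicator half_plane z *\<^sub>R (snd z powr (6 * (1 / 4) - 2) * u z ^ 6)) pi"
  proof -
    have "snd z powr (6 * (1 / 4) - 2) * u z ^ 6 = 1 / sqrt (snd z) * (1 / (s z * sqrt (s z)))"
      if "z \<in> half_plane" for z
    proof -
      define r where "r = sqrt (sqrt (s z))"
      have r: "0 < r" "sqrt (s z) = r\<^sup>2" "s z = r ^ 4"
      proof -
        show "0 < r" "sqrt (s z) = r\<^sup>2" using s[OF that] by (auto simp: r_def)
        then show "s z = r ^ 4" using s[OF that] by (metis less_imp_le power_mult real_sqrt_pow2 mult_2_right numeral_Bit0)
      qed
      have "snd z powr (- (1 / 2)) = 1 / sqrt (snd z)"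
        using that by (simp add: half_plane_def powr_minus powr_half_sqrt inverse_eq_divide)
      then show ?thesis using r by (simp add: u_def power_divide r_def[symmetric] flip: power_add)
    qed
    then have eq: "(\<lambda>z. indicator half_plane z *\<^sub>R (snd z powr (6 * (1 / 4) - 2) * u z ^ 6))
        = (\<lambda>z. indicator half_plane z *\<^sub>R (1 / sqrt (snd z) * (1 / (s z * sqrt (s z)))))"
      by (auto simp: indicator_def fun_eq_iff)
    show ?thesis
      unfolding eq s_def
      by (rule has_bochner_integral_shifted_weight[OF _ _ integral_grushin_mass])
        (auto intro!: continuous_intros)
  qed
  have E: "has_bochner_integral lborel (\<lambda>z. indicator half_plane z *\<^sub>R (snd z powr (2 * (1 / 4)) * ((ux z)\<^sup>2 + (uy z)\<^sup>2))) (pi / 4)"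
  proof -
    have "snd z powr (2 * (1 / 4)) * ((ux z)\<^sup>2 + (uy z)\<^sup>2) = sqrt (snd z) / 4 * (1 / (s z * sqrt (s z)))"
      if "z \<in> half_plane" for z
    proof -
      have p: "0 < s z" by (rule s[OF that])
      have "(ux z)\<^sup>2 + (uy z)\<^sup>2 = ((1 + snd z)\<^sup>2 + (fst z)\<^sup>2) / (4 * (s z)\<^sup>2 * sqrt (s z))"
      proof -
        have "(2 * s z * sqrt (sqrt (s z)))\<^sup>2 = 2\<^sup>2 * (s z)\<^sup>2 * sqrt (s z)"
          by (simp only: power_mult_distrib real_sqrt_pow2[OF real_sqrt_ge_zero[OF less_imp_le[OF p]]])
        then have "(2 * s z * sqrt (sqrt (s z)))\<^sup>2 = 4 * (s z)\<^sup>2 * sqrt (s z)" by simp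
        then show ?thesis by (simp only: ux_def uy_def power2_minus power_divide
            add_divide_distrib[symmetric] add.commute[of "(fst z)\<^sup>2"])
      qed
      also have "\<dots> = 1 / (4 * (s z * sqrt (s z)))"
        unfolding s_def[symmetric] using p by (simp add: power2_eq_square)
      finally show ?thesis using that by (simp add: half_plane_def powr_half_sqrt)
    qed
    then have eq: "(\<lambda>z. indicator half_plane z *\<^sub>R (snd z powr (2 * (1 / 4)) * ((ux z)\<^sup>2 + (uy z)\<^sup>2)))
        = (\<lambda>z. indicator half_plane z *\<^sub>R (sqrt (snd z) / 4 * (1 / (s z * sqrt (s z)))))"
      by (auto simp: indicator_def fun_eq_iff)
    show ?thesis
      unfolding eq s_def
      by (rule has_bochner_integral_shifted_weight[OF _ _ integral_grushin_energy])
        (auto intro!: continuous_intros)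
  qed
  have L: "F \<in> limiting_class (1 / 4)" "(Lp_norm 6 F)\<^sup>2 = pi powr (1 / 3)" "energy (1 / 4) F = pi / 4"
    by (rule limiting_class_of_profile[OF F_def cu dx dy P E], assumption+)+
  have "C * (pi / 4) < 4 * pi powr (- 2 / 3) * (pi / 4)"
    using assms by (intro mult_strict_right_mono) auto
  moreover have "4 * pi powr (- 2 / 3) * (pi / 4) = pi powr (1 / 3)"
    using pi_cube_root by simp
  ultimately have "C * (pi / 4) < pi powr (1 / 3)" by linarith
  then show ?thesis by (intro exI[of _ F] conjI L(1)) (simp only: L(2,3))
qed

text \<open>
  Inequality (i) follows from (ii): passing from \<open>4/3\<close> to \<open>4\<close> and from \<open>1/4\<close> to \<open>3/16\<close> both enlarge the right-hand
  side, because the bracket in (ii) is nonnegative.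
\<close>

theorem theorem2:
  shows "(\<forall>F :: real \<times> real \<Rightarrow> 'k::{real_normed_field, euclidean_space}. C1_compact_support F \<longrightarrow>
       (Lp_norm 6 F)\<^sup>2 \<le> 4 * pi powr (-2/3) *
         ((\<integral>z. (norm (hyp_grad F z))\<^sup>2 \<partial>hyp_measure) - 3/16 * (\<integral>z. (norm (F z))\<^sup>2 \<partial>hyp_measure)))
    \<and> (\<forall>F :: real \<times> real \<Rightarrow> 'k. C1_compact_support F \<longrightarrow>
       (Lp_norm 6 F)\<^sup>2 \<le> 4/3 * pi powr (-2/3) *
         ((\<integral>z. (norm (hyp_grad F z))\<^sup>2 \<partial>hyp_measure) - 1/4 * (\<integral>z. (norm (F z))\<^sup>2 \<partial>hyp_measure)))
    \<and> (\<forall>C < 4 * pi powr (-2/3).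
       \<not> (\<forall>F :: real \<times> real \<Rightarrow> 'k. F \<in> limiting_class (1/4) \<longrightarrow> (Lp_norm 6 F)\<^sup>2 \<le> C * energy (1/4) F))
    \<and> (\<forall>C < 4/3 * pi powr (-2/3).
       \<not> (\<forall>F :: real \<times> real \<Rightarrow> 'k. F \<in> limiting_class (1/2) \<longrightarrow> (Lp_norm 6 F)\<^sup>2 \<le> C * energy (1/2) F))"
proof (intro conjI allI impI)
  fix F :: "real \<times> real \<Rightarrow> 'k" assume F: "C1_compact_support F"
  let ?D = "\<integral>z. (norm (hyp_grad F z))\<^sup>2 \<partial>hyp_measure" and ?N = "\<integral>z. (norm (F z))\<^sup>2 \<partial>hyp_measure"
  have pp: "pi powr (-2/3) * pi powr (2/3) = 1" by (simp flip: powr_add)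
  have "4/3 * pi powr (-2/3) * (3 / 4 * pi powr (2 / 3) * (Lp_norm 6 F)\<^sup>2) \<le> 4/3 * pi powr (-2/3) * (?D - 1/4 * ?N)"
    by (intro mult_left_mono hyperbolic_sobolev_poincare F) simp
  also have "4/3 * pi powr (-2/3) * (3 / 4 * pi powr (2 / 3) * (Lp_norm 6 F)\<^sup>2)
      = pi powr (-2/3) * pi powr (2/3) * (Lp_norm 6 F)\<^sup>2" by simp
  finally show ii: "(Lp_norm 6 F)\<^sup>2 \<le> 4/3 * pi powr (-2/3) * (?D - 1/4 * ?N)" unfolding pp by simp
  have "0 \<le> 3 / 4 * pi powr (2 / 3) * (Lp_norm 6 F)\<^sup>2" by simp
  then have D: "0 \<le> ?D - 1/4 * ?N" using hyperbolic_sobolev_poincare[OF F] by linarith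
  have N: "0 \<le> ?N" by (intro Bochner_Integration.integral_nonneg) simp
  note ii
  also have "4/3 * pi powr (-2/3) * (?D - 1/4 * ?N) \<le> 4 * pi powr (-2/3) * (?D - 1/4 * ?N)"
    using D by (intro mult_right_mono) simp_all
  also have "\<dots> \<le> 4 * pi powr (-2/3) * (?D - 3/16 * ?N)"
    using N by (intro mult_left_mono) simp_all
  finally show "(Lp_norm 6 F)\<^sup>2 \<le> 4 * pi powr (-2/3) * (?D - 3/16 * ?N)" .
next
  fix C :: real assume "C < 4 * pi powr (-2/3)"
  from sharpness_exponent_quarter[OF this, where 'k = 'k]
  show "\<not> (\<forall>F :: real \<times> real \<Rightarrow> 'k. F \<in> limiting_class (1/4) \<longrightarrow> (Lp_norm 6 F)\<^sup>2 \<le> C * energy (1/4) F)"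
    by (meson not_less)
next
  fix C :: real assume "C < 4/3 * pi powr (-2/3)"
  from sharpness_exponent_half[OF this, where 'k = 'k]
  show "\<not> (\<forall>F :: real \<times> real \<Rightarrow> 'k. F \<in> limiting_class (1/2) \<longrightarrow> (Lp_norm 6 F)\<^sup>2 \<le> C * energy (1/2) F)"
    by (meson not_less)
qed

end
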